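(* Let $\Lambda$ be a Legendrian knot in $(\mathbb{R}^3,\xi_{std})$ with a standard Lagrangian petal projection with $n$ petals and $k$ half-twists, oriented so that the petals of the underlying petal projection (the half-twists being removed) are traversed counterclockwise. Then the rotation number of $\Lambda$ is $\frac{n+1}{2}-k$.
   Context: The standard contact structure on $\mathbb{R}^3$ with coordinates $(x,y,z)$ is $\xi_{std}=\ker(dz-y\,dx)$. A Legendrian knot is a knot whose tangent vector at each of its points $p$ lies in the plane of $\xi_{std}$ at $p$. The Lagrangian projection is the projection to the $xy$-plane. The rotation number of an oriented Legendrian knot is the winding number of its Lagrangian projection, i.e. the total number of counterclockwise turns made by the tangent vector of the projected curve. An $n$-multi-crossing of a knot projection is a point where $n$ strands intersect such that each strand bisects the crossing (so any two of the strands cross there). An übercrossing projection is a knot projection with a single multi-crossing and no other crossings. A petal projection is an übercrossing projection with no nested loops; its loops are called petals. A Lagrangian petal projection of a Legendrian knot is a petal projection in the Lagrangian projection, with possible half-twists on the petals. Here a half-twist on a petal is an additional self-crossing of that petal of the kind created by a Reidemeister I (R1) move producing a negative crossing; after removing the half-twists the diagram is a petal projection. The number $n$ of petals is taken to be odd (the paper notes that with at least two petals the number must be odd for the projection to be that of a knot), and the multi-crossing then has $n$ strands. A Lagrangian petal projection is standard if each petal has at most one half-twist and no bounded region of the diagram is contained within another bounded region (so each half-twist lies on the outside of its petal). *)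

theory Defs
  imports "HOL-Analysis.Analysis" "HOL-Complex_Analysis.Winding_Numbers"
begin

text \<open>Oriented closed curves are represented by maps on the reals of period 1, the orientation
  being that of the parameter.  The \<open>xy\<close>-plane is identified with the complex plane.\<close>

definition smooth_curve :: "(real \<Rightarrow> 'a::real_normed_vector) \<Rightarrow> bool" where
  "smooth_curve \<gamma> \<longleftrightarrow>
     (\<exists>D. D 0 = \<gamma> \<and> (\<forall>k t. (D k has_vector_derivative D (Suc k) t) (at t)))"

abbreviation velocity :: "(real \<Rightarrow> 'a::real_normed_vector) \<Rightarrow> real \<Rightarrow> 'a" where
  "velocity \<gamma> t \<equiv> vector_derivative \<gamma> (at t)"

definition knot :: "(real \<Rightarrow> real ^ 3) \<Rightarrow> bool" where
  "knot \<gamma> \<longleftrightarrow> smooth_curve \<gamma> \<and> (\<forall>t. \<gamma> (t + 1) = \<gamma> t) \<and> inj_on \<gamma> {0..<1} \<and>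
     (\<forall>t. velocity \<gamma> t \<noteq> 0)"

text \<open>The plane \<open>ker (dz - y dx)\<close> at the point \<open>(x, y, z)\<close>.\<close>

definition xi_std :: "real ^ 3 \<Rightarrow> (real ^ 3) set" where
  "xi_std q = {v. v $ 3 - q $ 2 * v $ 1 = 0}"

definition legendrian_knot :: "(real \<Rightarrow> real ^ 3) \<Rightarrow> bool" where
  "legendrian_knot \<gamma> \<longleftrightarrow> knot \<gamma> \<and> (\<forall>t. velocity \<gamma> t \<in> xi_std (\<gamma> t))"

definition lagrangian_proj :: "(real \<Rightarrow> real ^ 3) \<Rightarrow> real \<Rightarrow> complex" where
  "lagrangian_proj \<gamma> t = Complex (\<gamma> t $ 1) (\<gamma> t $ 2)"

text \<open>The library's \<^const>\<open>winding_number\<close> is complex-valued; it only looks at the parameters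
  in \<open>{0..1}\<close>, i.e. one period.\<close>

definition rotation_number :: "(real \<Rightarrow> real ^ 3) \<Rightarrow> complex" where
  "rotation_number \<gamma> = winding_number (velocity (lagrangian_proj \<gamma>)) 0"

text \<open>The determinant of the pair \<open>(u, v)\<close> of plane vectors; it is positive iff \<open>(u, v)\<close> is
  a positively oriented basis.\<close>

definition det2 :: "complex \<Rightarrow> complex \<Rightarrow> real" where
  "det2 u v = Im (cnj u * v)"

text \<open>In what follows \<open>\<tau> 0 < \<dots> < \<tau> (n - 1)\<close> are the times, within the period that starts at
  \<open>\<tau> 0\<close>, at which a curve passes through its multi-crossing, and \<open>\<tau> n = \<tau> 0 + 1\<close> closes the
  period.  The \<open>n\<close> strands are required to have pairwise distinct tangent lines, so each of
  them bisects the crossing.\<close>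

definition multi_crossing :: "(real \<Rightarrow> complex) \<Rightarrow> (nat \<Rightarrow> real) \<Rightarrow> nat \<Rightarrow> bool" where
  "multi_crossing p \<tau> n \<longleftrightarrow>
     (\<forall>i<n. \<tau> i < \<tau> (Suc i)) \<and> \<tau> n = \<tau> 0 + 1 \<and>
     (\<forall>i<n. p (\<tau> i) = p (\<tau> 0)) \<and>
     (\<forall>i<n. \<forall>j<n. i \<noteq> j \<longrightarrow> det2 (velocity p (\<tau> i)) (velocity p (\<tau> j)) \<noteq> 0)"

text \<open>The \<open>i\<close>-th loop, parametrised by \<open>{0..1}\<close>.\<close>

definition petal :: "(real \<Rightarrow> complex) \<Rightarrow> (nat \<Rightarrow> real) \<Rightarrow> nat \<Rightarrow> real \<Rightarrow> complex" where
  "petal p \<tau> i = subpath (\<tau> i) (\<tau> (Suc i)) p"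

text \<open>A single multi-crossing and no other crossings.  The parametrisation is allowed to stop
  for a while, since removing half-twists below leaves the curve constant for some time; a
  coincidence \<open>p s = p t\<close> is then not a crossing if \<open>p\<close> rests between \<open>s\<close> and \<open>t\<close>.\<close>

definition ubercrossing_projection :: "(real \<Rightarrow> complex) \<Rightarrow> (nat \<Rightarrow> real) \<Rightarrow> nat \<Rightarrow> bool" where
  "ubercrossing_projection p \<tau> n \<longleftrightarrow> multi_crossing p \<tau> n \<and>
     (\<forall>s t. \<tau> 0 \<le> s \<and> s < t \<and> t < \<tau> n \<and> p s = p t \<longrightarrow>
        s \<in> \<tau> ` {..<n} \<and> t \<in> \<tau> ` {..<n} \<or> (\<forall>r\<in>{s..t}. p r = p s))"

definition petal_projection :: "(real \<Rightarrow> complex) \<Rightarrow> (nat \<Rightarrow> real) \<Rightarrow> nat \<Rightarrow> bool" where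
  "petal_projection p \<tau> n \<longleftrightarrow> ubercrossing_projection p \<tau> n \<and>
     (\<forall>i<n. \<forall>j<n. i \<noteq> j \<longrightarrow>
        \<not> inside (path_image (petal p \<tau> i)) \<subseteq> inside (path_image (petal p \<tau> j)))"

text \<open>The crossings apart from the multi-crossing, as pairs of times.\<close>

definition extra_crossings ::
  "(real \<Rightarrow> complex) \<Rightarrow> (nat \<Rightarrow> real) \<Rightarrow> nat \<Rightarrow> (real \<times> real) set" where
  "extra_crossings p \<tau> n = {(a, b). \<tau> 0 \<le> a \<and> a < b \<and> b < \<tau> n \<and> p a = p b \<and>
     \<not> (a \<in> \<tau> ` {..<n} \<and> b \<in> \<tau> ` {..<n})}"

text \<open>The sign of a crossing at the times \<open>a\<close>, \<open>b\<close>, seen from above (large \<open>z\<close>): it is positive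
  iff (direction of the upper strand, direction of the lower strand) is a positively oriented
  basis, and zero iff the strands are tangent.\<close>

definition crossing_sign :: "(real \<Rightarrow> real ^ 3) \<Rightarrow> real \<Rightarrow> real \<Rightarrow> real" where
  "crossing_sign \<gamma> a b =
     sgn ((\<gamma> a $ 3 - \<gamma> b $ 3) *
       det2 (velocity (lagrangian_proj \<gamma>) a) (velocity (lagrangian_proj \<gamma>) b))"

text \<open>A half-twist is a negative crossing of one petal with itself whose curl, traced over
  \<open>{a..b}\<close>, encloses no part of the rest of the diagram, as for an R1 move.\<close>

definition half_twist :: "(real \<Rightarrow> real ^ 3) \<Rightarrow> (nat \<Rightarrow> real) \<Rightarrow> nat \<Rightarrow> real \<times> real \<Rightarrow> bool" where
  "half_twist \<gamma> \<tau> n = (\<lambda>(a, b).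
     (\<exists>i<n. \<tau> i < a \<and> a < b \<and> b < \<tau> (Suc i)) \<and>
     lagrangian_proj \<gamma> a = lagrangian_proj \<gamma> b \<and>
     crossing_sign \<gamma> a b = -1 \<and>
     inside (lagrangian_proj \<gamma> ` {a..b}) \<inter> lagrangian_proj \<gamma> ` ({\<tau> 0..\<tau> n} - {a..b}) = {})"

text \<open>Curls obtained by successive R1 moves are traced over disjoint or nested time intervals.\<close>

definition unlinked :: "(real \<times> real) set \<Rightarrow> bool" where
  "unlinked H \<longleftrightarrow> (\<forall>(a, b)\<in>H. \<forall>(a', b')\<in>H. (a, b) \<noteq> (a', b') \<longrightarrow>
     {a..b} \<inter> {a'..b'} = {} \<or> {a..b} \<subseteq> {a'<..<b'} \<or> {a'..b'} \<subseteq> {a<..<b})"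

text \<open>Removal of the curls at the crossings \<open>H\<close>: during a curl the new curve waits at the
  crossing point.  For nested curls, the minimum selects the outermost one.\<close>

definition untwist :: "(real \<times> real) set \<Rightarrow> (real \<Rightarrow> complex) \<Rightarrow> real \<Rightarrow> complex" where
  "untwist H p t = p (Min (insert t {a. \<exists>b. (a, b) \<in> H \<and> a < t \<and> t < b}))"

definition underlying_projection ::
  "(real \<Rightarrow> real ^ 3) \<Rightarrow> (nat \<Rightarrow> real) \<Rightarrow> nat \<Rightarrow> real \<Rightarrow> complex" where
  "underlying_projection \<gamma> \<tau> n =
     untwist (extra_crossings (lagrangian_proj \<gamma>) \<tau> n) (lagrangian_proj \<gamma>)"

definition lagrangian_petal_projection ::
  "(real \<Rightarrow> real ^ 3) \<Rightarrow> (nat \<Rightarrow> real) \<Rightarrow> nat \<Rightarrow> bool" where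
  "lagrangian_petal_projection \<gamma> \<tau> n \<longleftrightarrow> odd n \<and>
     multi_crossing (lagrangian_proj \<gamma>) \<tau> n \<and>
     finite (extra_crossings (lagrangian_proj \<gamma>) \<tau> n) \<and>
     unlinked (extra_crossings (lagrangian_proj \<gamma>) \<tau> n) \<and>
     (\<forall>h\<in>extra_crossings (lagrangian_proj \<gamma>) \<tau> n. half_twist \<gamma> \<tau> n h) \<and>
     petal_projection (underlying_projection \<gamma> \<tau> n) \<tau> n"

definition bounded_regions :: "(real \<Rightarrow> complex) \<Rightarrow> complex set set" where
  "bounded_regions p = {U \<in> components (- range p). bounded U}"

text \<open>Distinct regions are disjoint as sets, so containment of \<open>U\<close> in \<open>V\<close> means that \<open>U\<close> is
  enclosed by the boundary of \<open>V\<close> (\<open>inside (frontier V)\<close> is \<open>V\<close> with its holes filled in).\<close>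

definition standard_lagrangian_petal_projection ::
  "(real \<Rightarrow> real ^ 3) \<Rightarrow> (nat \<Rightarrow> real) \<Rightarrow> nat \<Rightarrow> bool" where
  "standard_lagrangian_petal_projection \<gamma> \<tau> n \<longleftrightarrow>
     lagrangian_petal_projection \<gamma> \<tau> n \<and>
     (\<forall>i<n. card {(a, b) \<in> extra_crossings (lagrangian_proj \<gamma>) \<tau> n.
                    \<tau> i < a \<and> b < \<tau> (Suc i)} \<le> 1) \<and>
     (\<forall>U\<in>bounded_regions (lagrangian_proj \<gamma>). \<forall>V\<in>bounded_regions (lagrangian_proj \<gamma>).
        U \<noteq> V \<longrightarrow> \<not> U \<subseteq> inside (frontier V))"

definition num_half_twists :: "(real \<Rightarrow> real ^ 3) \<Rightarrow> (nat \<Rightarrow> real) \<Rightarrow> nat \<Rightarrow> nat" where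
  "num_half_twists \<gamma> \<tau> n = card (extra_crossings (lagrangian_proj \<gamma>) \<tau> n)"

definition petals_counterclockwise ::
  "(real \<Rightarrow> real ^ 3) \<Rightarrow> (nat \<Rightarrow> real) \<Rightarrow> nat \<Rightarrow> bool" where
  "petals_counterclockwise \<gamma> \<tau> n \<longleftrightarrow>
     (\<forall>i<n. \<forall>w\<in>inside (path_image (petal (underlying_projection \<gamma> \<tau> n) \<tau> i)).
        winding_number (petal (underlying_projection \<gamma> \<tau> n) \<tau> i) w = 1)"

end

theory Submission
  imports Defs
begin

text \<open>
  The rotation number is the total change of an argument of the velocity of the Lagrangian
  projection over one period, and this change is computed petal by petal.

  A petal is a loop with a corner at the multi-crossing.  For such a loop there is a turning
  formula in the style of Hopf and Whitney (\<open>turning_of_simple_loop\<close>,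
  \<open>turning_of_loop_with_one_crossing\<close>): the tangent turns by twice the angle swept by the
  secants through the corner, plus the exterior angle at the corner, minus \<open>2 * pi\<close> times the sign
  of the determinant of the two velocities at the self-crossing, if there is one.
  The secant map \<open>(s, t) \<mapsto> c t - c s\<close> on the triangle \<open>0 \<le> s \<le> t \<le> 1\<close> vanishes exactly on the diagonal, at the vertex \<open>(0, 1)\<close> and at the crossing.
  Near each of these zeros it is asymptotic to an explicit real-linear map, and the quotient by
  these maps has a continuous logarithm on the whole triangle.  Comparing the diagonal with the
  two legs gives the formula, all corrections being changes of explicit branches of \<open>Ln\<close>.

  The angle swept by the secants through the corner is the interior angle there.  The same
  division trick computes the winding number of the loop around points close to the corner
  (\<open>winding_number_near_corner\<close>); as it is 1 inside the counterclockwise petal and 0 outside, the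
  swept angle must be the angle from the outgoing strand counterclockwise to the reversed
  incoming strand, and that sector is locally inside (\<open>interior_sector_of_corner\<close>).

  A half-twist contributes \<open>- 2 * pi\<close>: if that determinant were negative, its curl would start
  into the inside of the petal (again by the corner lemma), and then the region enclosed by the
  curl would be encircled by the region between petal and curl, which a standard projection forbids
  (\<open>curl_turns_left\<close>).  So petal \<open>i\<close> turns by \<open>pi + \<alpha> i - 2 * pi * k i\<close>, where \<open>\<alpha> i\<close> is its interior
  angle and \<open>k i\<close> its number of half-twists (\<open>petal_turning\<close>).

  Petals are not nested, so no outgoing strand points into the sector of another petal; hence
  the sectors do not overlap and the angles \<open>\<alpha> i\<close> have a sum in \<open>{0<..2 * pi}\<close>.  The rotation number
  is an integer and \<open>n\<close> is odd, so this sum is an odd multiple of \<open>pi\<close>, which leaves only \<open>pi\<close>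
  itself.  The total turning is therefore \<open>n * pi + pi - 2 * pi * k\<close>.
\<close>

section \<open>Continuous logarithms\<close>

text \<open>Two continuous logarithms of a function differ by a continuous function with values in the
  discrete set \<open>2 * pi * \<i> * \<int>\<close>.  Thus the change of a logarithm between two points, whose imaginary
  part is the swept angle, depends only on the function.\<close>

lemma log_change_unique:
  fixes g h :: "'a::metric_space \<Rightarrow> complex"
  assumes "connected S" "continuous_on S g" "continuous_on S h"
    and eq: "\<And>x. x \<in> S \<Longrightarrow> exp (g x) = exp (h x)" and "x \<in> S" "y \<in> S"
  shows "g y - g x = h y - h x"
proof -
  have "(\<lambda>x. g x - h x) constant_on S"
  proof (rule continuous_discrete_range_constant[OF \<open>connected S\<close>])
    show "continuous_on S (\<lambda>x. g x - h x)" by (intro continuous_intros assms)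
    fix x assume x: "x \<in> S"
    show "\<exists>e>0. \<forall>y. y \<in> S \<and> g y - h y \<noteq> g x - h x \<longrightarrow> e \<le> norm (g y - h y - (g x - h x))"
    proof (intro exI[of _ "2*pi"] conjI allI impI)
      fix y assume y: "y \<in> S \<and> g y - h y \<noteq> g x - h x"
      have "exp (g y - h y - (g x - h x)) = exp 0"
        using eq[of x] eq[of y] x y by (simp add: exp_diff)
      then obtain k::int where k: "g y - h y - (g x - h x) = 0 + 2 * of_int k * of_real pi * \<i>"
        unfolding exp_eq by (auto simp: mult_ac)
      then have "k \<noteq> 0" using y by auto
      then have "1 \<le> \<bar>real_of_int k\<bar>" by linarith
      then have "2 * pi * 1 \<le> 2 * pi * \<bar>real_of_int k\<bar>" by (intro mult_left_mono) auto
      then show "2*pi \<le> norm (g y - h y - (g x - h x))" by (simp add: k norm_mult mult_ac)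
    qed simp
  qed
  then obtain c where "\<And>x. x\<in>S \<Longrightarrow> g x - h x = c" by (auto simp: constant_on_def)
  from this[of x] this[of y] assms show ?thesis by (simp add: algebra_simps)
qed

text \<open>The functions that are compared below are often given by different formulas at the end points,
  so it is convenient to ask for agreement in the open interval only.\<close>

lemma log_change_unique_Icc:
  fixes g h :: "real \<Rightarrow> complex"
  assumes "x < y" "continuous_on {x..y} g" "continuous_on {x..y} h"
    and eq: "\<And>t. \<lbrakk>x < t; t < y\<rbrakk> \<Longrightarrow> exp (g t) = exp (h t)"
  shows "g y - g x = h y - h x"
proof -
  have cl: "closure {x<..<y} = {x..y}" using assms(1) by simp
  have "exp (g t) - exp (h t) = 0" if "t \<in> {x..y}" for t
    by (rule continuous_constant_on_closure[of "{x<..<y}"])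
       (use that in \<open>auto simp: cl assms(1) eq intro!: continuous_intros assms\<close>)
  then show ?thesis
    by (intro log_change_unique[of "{x..y}"]) (use assms in auto)
qed

lemma log_on_convex:
  fixes f :: "'a::real_normed_vector \<Rightarrow> complex"
  assumes "convex S" "continuous_on S f" "\<And>z. z \<in> S \<Longrightarrow> f z \<noteq> 0"
  obtains g where "continuous_on S g" "\<And>z. z \<in> S \<Longrightarrow> exp (g z) = f z"
  using continuous_logarithm_on_contractible[OF assms(2) convex_imp_contractible[OF assms(1)] assms(3)]
  by metis

lemma winding_number_log_change:
  assumes "continuous_on {0..1} L" "\<And>t. t \<in> {0..1} \<Longrightarrow> exp (L t) = g t - z"
  shows "2 * of_real pi * \<i> * winding_number g z = L 1 - L 0"
proof -
  have "winding_number g z = winding_number (exp \<circ> L) 0"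
    unfolding winding_number_offset[of g z]
    by (rule winding_number_cong) (use assms(2) in auto)
  also have "\<dots> = (L 1 - L 0) / (2 * of_real pi * \<i>)"
    using winding_number_compose_exp[of L] assms(1)
    by (simp add: path_def pathfinish_def pathstart_def)
  finally show ?thesis by simp
qed

section \<open>Linear models near a zero\<close>

text \<open>In a neighbourhood of an isolated zero the maps below have the form \<open>\<alpha> * A + \<beta> * B\<close> with real
  coordinates \<open>\<alpha>\<close>, \<open>\<beta>\<close> that tend to 0 and complex \<open>A\<close>, \<open>B\<close> that tend to \<open>A0\<close>, \<open>B0\<close>.  If the linear
  model \<open>\<alpha> * A0 + \<beta> * B0\<close> is bounded below by a multiple of \<open>\<bar>\<alpha>\<bar> + \<bar>\<beta>\<bar>\<close>, dividing by it removes the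
  zero.\<close>

lemma linear_model_ratio_tendsto:
  fixes A B :: "'a \<Rightarrow> complex" and \<alpha> \<beta> :: "'a \<Rightarrow> real"
  assumes "(A \<longlongrightarrow> A0) F" "(B \<longlongrightarrow> B0) F" "0 < m"
    and low: "\<forall>\<^sub>F z in F. m * (\<bar>\<alpha> z\<bar> + \<bar>\<beta> z\<bar>) \<le> norm (of_real (\<alpha> z) * A0 + of_real (\<beta> z) * B0)"
    and nz: "\<forall>\<^sub>F z in F. \<alpha> z \<noteq> 0 \<or> \<beta> z \<noteq> 0"
  shows "((\<lambda>z. (of_real (\<alpha> z) * A z + of_real (\<beta> z) * B z) / (of_real (\<alpha> z) * A0 + of_real (\<beta> z) * B0)) \<longlongrightarrow> 1) F"
proof -
  have "((\<lambda>z. (norm (A z - A0) + norm (B z - B0)) / m) \<longlongrightarrow> (norm (A0 - A0) + norm (B0 - B0)) / m) F"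
    using assms(3) by (intro tendsto_intros assms) auto
  then have lim: "((\<lambda>z. (norm (A z - A0) + norm (B z - B0)) / m) \<longlongrightarrow> 0) F" by simp
  have "((\<lambda>z. (of_real (\<alpha> z) * A z + of_real (\<beta> z) * B z) / (of_real (\<alpha> z) * A0 + of_real (\<beta> z) * B0) - 1) \<longlongrightarrow> 0) F"
  proof (rule Lim_null_comparison[OF _ lim])
    show "\<forall>\<^sub>F z in F. norm ((of_real (\<alpha> z) * A z + of_real (\<beta> z) * B z) / (of_real (\<alpha> z) * A0 + of_real (\<beta> z) * B0) - 1)
             \<le> (norm (A z - A0) + norm (B z - B0)) / m"
      using low nz
    proof eventually_elim
      fix z assume l: "m * (\<bar>\<alpha> z\<bar> + \<bar>\<beta> z\<bar>) \<le> norm (of_real (\<alpha> z) * A0 + of_real (\<beta> z) * B0)"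
        and n: "\<alpha> z \<noteq> 0 \<or> \<beta> z \<noteq> 0"
      let ?M = "of_real (\<alpha> z) * A0 + of_real (\<beta> z) * B0"
      let ?s = "\<bar>\<alpha> z\<bar> + \<bar>\<beta> z\<bar>" and ?d = "norm (A z - A0) + norm (B z - B0)"
      have s: "0 < ?s" using n by auto
      then have M: "0 < norm ?M" using l \<open>0 < m\<close> by (smt (verit) mult_pos_pos)
      have "(of_real (\<alpha> z) * A z + of_real (\<beta> z) * B z) / ?M - 1 =
          (of_real (\<alpha> z) * (A z - A0) + of_real (\<beta> z) * (B z - B0)) / ?M"
        using M by (simp add: field_simps)
      then have "norm ((of_real (\<alpha> z) * A z + of_real (\<beta> z) * B z) / ?M - 1)
         = norm (of_real (\<alpha> z) * (A z - A0) + of_real (\<beta> z) * (B z - B0)) / norm ?M"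
        by (simp add: norm_divide)
      also have "\<dots> \<le> (?s * ?d) / (m * ?s)"
      proof (rule frac_le)
        have "norm (of_real (\<alpha> z) * (A z - A0) + of_real (\<beta> z) * (B z - B0))
            \<le> \<bar>\<alpha> z\<bar> * norm (A z - A0) + \<bar>\<beta> z\<bar> * norm (B z - B0)"
          by (rule norm_triangle_le) (simp add: norm_mult)
        also have "\<dots> \<le> ?s * ?d" by (simp add: algebra_simps)
        finally show "norm (of_real (\<alpha> z) * (A z - A0) + of_real (\<beta> z) * (B z - B0)) \<le> ?s * ?d" .
      qed (use s l \<open>0 < m\<close> in auto)
      also have "\<dots> = ?d / m" using s by simp
      finally show "norm ((of_real (\<alpha> z) * A z + of_real (\<beta> z) * B z) / ?M - 1) \<le> ?d / m" .
    qed
  qed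
  then show ?thesis using Lim_null by blast
qed

text \<open>On the quadrant of nonnegative coordinates it suffices that \<open>A0\<close> and \<open>B0\<close> do not point in opposite
  directions: by homogeneity the bound is the distance from 0 to the segment between them.\<close>

lemma linear_model_bound_quadrant:
  fixes A0 B0 :: complex
  assumes "B0 \<noteq> 0" "A0 / B0 \<notin> \<real>\<^sub>\<le>\<^sub>0"
  obtains m where "0 < m" "\<And>\<alpha> \<beta>. \<lbrakk>0 \<le> \<alpha>; 0 \<le> \<beta>\<rbrakk> \<Longrightarrow> m * (\<alpha> + \<beta>) \<le> norm (of_real \<alpha> * A0 + of_real \<beta> * B0)"
proof -
  let ?S = "closed_segment A0 B0"
  have "0 \<notin> ?S"
  proof
    assume "0 \<in> ?S"
    then obtain u where u: "0 \<le> u" "u \<le> 1" "0 = (1-u) *\<^sub>R A0 + u *\<^sub>R B0"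
      by (auto simp: in_segment)
    then have "u \<noteq> 1" using assms(1) by auto
    from u(3) have e: "of_real (1-u) * A0 = - (of_real u * B0)"
      by (simp only: scaleR_conv_of_real eq_neg_iff_add_eq_0)
    have "A0 = (of_real (1-u) * A0) / of_real (1-u)"
      using \<open>u \<noteq> 1\<close> by (metis nonzero_mult_div_cancel_left of_real_eq_0_iff right_minus_eq)
    then have "A0 = - (of_real u * B0) / of_real (1-u)" by (simp only: e)
    then have "A0 = of_real (- (u / (1-u))) * B0" by simp
    then have "A0 / B0 = of_real (- (u / (1-u)))" using assms(1) by simp
    then have "A0 / B0 \<in> \<real>\<^sub>\<le>\<^sub>0"
      using u by (simp only: nonpos_Reals_of_real_iff) simp
    then show False using assms(2) by simp
  qed
  then obtain m where m: "0 < m" "\<And>x. x \<in> ?S \<Longrightarrow> m \<le> dist 0 x"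
    using separate_point_closed[of ?S 0] by auto
  show thesis
  proof (rule that[OF m(1)])
    fix \<alpha> \<beta> :: real assume nn: "0 \<le> \<alpha>" "0 \<le> \<beta>"
    show "m * (\<alpha> + \<beta>) \<le> norm (of_real \<alpha> * A0 + of_real \<beta> * B0)"
    proof (cases "\<alpha> + \<beta> = 0")
      case False
      then have pos: "0 < \<alpha> + \<beta>" using nn by auto
      let ?u = "\<beta> / (\<alpha> + \<beta>)"
      have "(1 - ?u) *\<^sub>R A0 + ?u *\<^sub>R B0 \<in> ?S" using pos nn by (auto simp: in_segment divide_simps intro!: exI[of _ ?u])
      then have "m \<le> norm ((1 - ?u) *\<^sub>R A0 + ?u *\<^sub>R B0)" using m(2) by fastforce
      moreover have "(\<alpha>+\<beta>) *\<^sub>R ((1 - ?u) *\<^sub>R A0 + ?u *\<^sub>R B0) = of_real \<alpha> * A0 + of_real \<beta> * B0"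
      proof -
        have "(\<alpha>+\<beta>) * (1 - ?u) = \<alpha>" "(\<alpha>+\<beta>) * ?u = \<beta>" using pos by (simp_all add: field_simps)
        then show ?thesis by (simp only: scaleR_right_distrib scaleR_scaleR scaleR_conv_of_real[symmetric])
      qed
      ultimately show ?thesis using pos
        by (smt (verit) mult.commute mult_right_mono norm_scaleR)
    qed (use nn in auto)
  qed
qed

lemma linear_model_bound:
  fixes A0 B0 :: complex
  assumes "B0 \<noteq> 0" "A0 / B0 \<notin> \<real>"
  obtains m where "0 < m" "\<And>\<alpha> \<beta>. m * (\<bar>\<alpha>\<bar> + \<bar>\<beta>\<bar>) \<le> norm (of_real \<alpha> * A0 + of_real \<beta> * B0)"
proof -
  have "A0 / B0 \<notin> \<real>\<^sub>\<le>\<^sub>0" "(- A0) / B0 \<notin> \<real>\<^sub>\<le>\<^sub>0"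
    using assms(2) by (auto simp: complex_is_Real_iff complex_nonpos_Reals_iff)
  from linear_model_bound_quadrant[OF assms(1) this(1)] linear_model_bound_quadrant[OF assms(1) this(2)]
  obtain m1 m2 where
    m1: "0 < m1" "\<And>\<alpha> \<beta>. \<lbrakk>0 \<le> \<alpha>; 0 \<le> \<beta>\<rbrakk> \<Longrightarrow> m1 * (\<alpha> + \<beta>) \<le> norm (of_real \<alpha> * A0 + of_real \<beta> * B0)" and
    m2: "0 < m2" "\<And>\<alpha> \<beta>. \<lbrakk>0 \<le> \<alpha>; 0 \<le> \<beta>\<rbrakk> \<Longrightarrow> m2 * (\<alpha> + \<beta>) \<le> norm (of_real \<alpha> * (-A0) + of_real \<beta> * B0)"
    by metis
  have *: "min m1 m2 * (\<bar>\<alpha>\<bar> + \<bar>\<beta>\<bar>) \<le> norm (of_real \<alpha> * A0 + of_real \<beta> * B0)" if "0 \<le> \<beta>" for \<alpha> \<beta>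
  proof (cases "0 \<le> \<alpha>")
    case True
    then have "min m1 m2 * (\<alpha> + \<beta>) \<le> m1 * (\<alpha> + \<beta>)" using that by (intro mult_right_mono) auto
    with m1(2)[OF True that] True that show ?thesis by simp
  next
    case False
    then have "min m1 m2 * (-\<alpha> + \<beta>) \<le> m2 * (-\<alpha> + \<beta>)" using that by (intro mult_right_mono) auto
    with m2(2)[of "-\<alpha>" \<beta>] False that show ?thesis by (auto simp: algebra_simps)
  qed
  show thesis
  proof (rule that[of "min m1 m2"])
    fix \<alpha> \<beta> :: real
    show "min m1 m2 * (\<bar>\<alpha>\<bar> + \<bar>\<beta>\<bar>) \<le> norm (of_real \<alpha> * A0 + of_real \<beta> * B0)"
    proof (cases "0 \<le> \<beta>")
      case False
      have "norm (of_real \<alpha> * A0 + of_real \<beta> * B0) = norm (of_real (-\<alpha>) * A0 + of_real (-\<beta>) * B0)"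
        by (metis (no_types, lifting) minus_add_distrib mult_minus_left norm_minus_cancel of_real_minus)
      then show ?thesis using *[of "-\<beta>" "-\<alpha>"] False by simp
    qed (rule *)
  qed (use m1 m2 in auto)
qed

section \<open>The secant map\<close>

text \<open>The mean of the derivative along a secant extends the difference quotient continuously across
  the diagonal.\<close>

lemma secant_slope:
  fixes p p' :: "real \<Rightarrow> complex"
  assumes der: "\<And>t. (p has_vector_derivative p' t) (at t)" and "continuous_on UNIV p'"
  obtains \<sigma> where "continuous_on UNIV (\<lambda>(s, t). \<sigma> s t)" "\<And>t. \<sigma> t t = p' t"
    "\<And>s t. p t - p s = of_real (t - s) * \<sigma> s t"
proof
  let ?\<sigma> = "\<lambda>s t. integral {0..1} (\<lambda>r. p' (s + r * (t - s)))"
  have "continuous_on UNIV (\<lambda>z. integral (cbox 0 1) (\<lambda>r::real. p' (fst z + r * (snd z - fst z))))"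
    by (rule integral_continuous_on_param)
       (auto simp: case_prod_beta intro!: continuous_intros continuous_on_compose2[OF assms(2)])
  then show "continuous_on UNIV (\<lambda>(s, t). ?\<sigma> s t)" by (simp add: case_prod_beta)
  show "?\<sigma> t t = p' t" for t by simp
  fix s t :: real
  have "((\<lambda>r. (t - s) *\<^sub>R p' (s + r * (t - s))) has_integral
      (p (s + 1 * (t - s)) - p (s + 0 * (t - s)))) {0..1}"
  proof (rule fundamental_theorem_of_calculus)
    fix r :: real
    have "((\<lambda>r. s + r * (t - s)) has_vector_derivative (t - s)) (at r within {0..1})"
      by (auto intro!: derivative_eq_intros)
    then show "((\<lambda>r. p (s + r * (t - s))) has_vector_derivative (t - s) *\<^sub>R p' (s + r * (t - s))) (at r within {0..1})"
      using vector_diff_chain_within[OF _ has_vector_derivative_at_within[OF der], of "\<lambda>r. s + r * (t - s)" "t - s" r "{0..1}"]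
      by (auto simp: o_def)
  qed simp
  from integral_unique[OF this] show "p t - p s = of_real (t - s) * ?\<sigma> s t"
    by (simp add: scaleR_conv_of_real)
qed

lemma log_change_scaled:
  fixes g h :: "real \<Rightarrow> complex"
  assumes "x < y" "continuous_on {x..y} g" "continuous_on {x..y} h"
    and eq: "\<And>t. \<lbrakk>x < t; t < y\<rbrakk> \<Longrightarrow> exp (g t) = c * exp (h t)"
  shows "g y - g x = h y - h x"
proof -
  obtain t where "x < t" "t < y" using dense[OF assms(1)] by blast
  then have "c \<noteq> 0" using eq[of t] by auto
  then have "g y - g x = (Ln c + h y) - (Ln c + h x)"
    by (intro log_change_unique_Icc) (use assms in \<open>auto simp: exp_add intro!: continuous_intros\<close>)
  then show ?thesis by simp
qed

definition triangle :: "(real \<times> real) set" where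
  "triangle = {(s, t). 0 \<le> s \<and> s \<le> t \<and> t \<le> 1}"

text \<open>A nowhere vanishing function on the triangle has a continuous logarithm there, so its changes
  along the diagonal and along the two legs agree.  The constants allow for logarithms of
  multiples of the function.\<close>

lemma triangle_log_change:
  fixes K :: "real \<Rightarrow> real \<Rightarrow> complex" and D L U :: "real \<Rightarrow> complex"
  assumes "continuous_on triangle (\<lambda>(s, t). K s t)" "\<And>s t. (s, t) \<in> triangle \<Longrightarrow> K s t \<noteq> 0"
    and "continuous_on {0..1} D" "\<And>t. \<lbrakk>0 < t; t < 1\<rbrakk> \<Longrightarrow> exp (D t) = c1 * K t t"
    and "continuous_on {0..1} L" "\<And>t. \<lbrakk>0 < t; t < 1\<rbrakk> \<Longrightarrow> exp (L t) = c2 * K 0 t"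
    and "continuous_on {0..1} U" "\<And>t. \<lbrakk>0 < t; t < 1\<rbrakk> \<Longrightarrow> exp (U t) = c3 * K t 1"
  shows "D 1 - D 0 = (L 1 - L 0) + (U 1 - U 0)"
proof -
  have cvx: "convex triangle"
  proof -
    have "triangle = {z. (-1, 0) \<bullet> z \<le> 0} \<inter> {z. (1, -1) \<bullet> z \<le> 0} \<inter> {z. (0, 1) \<bullet> z \<le> (1::real)}"
      by (auto simp: triangle_def)
    then show ?thesis by (metis convex_Int convex_halfspace_le)
  qed
  have nz: "(\<lambda>(s, t). K s t) z \<noteq> 0" if "z \<in> triangle" for z
    using assms(2)[of "fst z" "snd z"] that by (simp add: case_prod_beta)
  obtain G where G: "continuous_on triangle G" "\<And>z. z \<in> triangle \<Longrightarrow> exp (G z) = (\<lambda>(s, t). K s t) z"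
    using log_on_convex[OF cvx assms(1) nz] by blast
  have "D 1 - D 0 = G (1, 1) - G (0, 0)"
    by (rule log_change_scaled[where c = c1])
       (use assms G(2) in \<open>auto simp: triangle_def intro!: continuous_on_compose2[OF G(1)] continuous_intros\<close>)
  moreover have "L 1 - L 0 = G (0, 1) - G (0, 0)"
    by (rule log_change_scaled[where c = c2])
       (use assms G(2) in \<open>auto simp: triangle_def intro!: continuous_on_compose2[OF G(1)] continuous_intros\<close>)
  moreover have "U 1 - U 0 = G (1, 1) - G (0, 1)"
    by (rule log_change_scaled[where c = c3])
       (use assms G(2) in \<open>auto simp: triangle_def intro!: continuous_on_compose2[OF G(1)] continuous_intros\<close>)
  ultimately show ?thesis by simp
qed

text \<open>Segments and cones spanned by 1 and a point of the slit plane stay in the slit plane; this is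
  what makes the principal branch available for the linear models.\<close>

lemma slit_combination:
  fixes \<alpha> \<beta> :: real and z :: complex
  assumes "z \<notin> \<real>\<^sub>\<le>\<^sub>0" "0 \<le> \<alpha>" "0 \<le> \<beta>" "\<alpha> \<noteq> 0 \<or> \<beta> \<noteq> 0"
  shows "of_real \<alpha> + of_real \<beta> * z \<notin> \<real>\<^sub>\<le>\<^sub>0"
proof
  assume "of_real \<alpha> + of_real \<beta> * z \<in> \<real>\<^sub>\<le>\<^sub>0"
  then have *: "\<alpha> + \<beta> * Re z \<le> 0" "\<beta> * Im z = 0" by (auto simp: complex_nonpos_Reals_iff)
  have "0 < \<beta>" using * assms by (cases "\<beta> = 0") auto
  with * assms have "Im z = 0" "0 < Re z" by (auto simp: complex_nonpos_Reals_iff)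
  then show False using * \<open>0 < \<beta>\<close> assms by (smt (verit) mult_pos_pos)
qed

section \<open>Turning of the tangent along a loop with a corner\<close>

text \<open>Near the vertex \<open>(0, 1)\<close> of the triangle the secant map is asymptotic to
  \<open>- (s * c' 0 + (1 - t) * c' 1)\<close>, because \<open>c 0 = c 1\<close>.  Up to the factor \<open>- c' 1\<close> this is the map
  \<open>N\<close>, and after division by \<open>t - s\<close> and \<open>N\<close> neither the diagonal nor the vertex is special any
  more.\<close>

lemma secant_with_corner:
  fixes c c' :: "real \<Rightarrow> complex"
  assumes der: "\<And>t. (c has_vector_derivative c' t) (at t)" and cont: "continuous_on UNIV c'"
    and loop: "c 0 = c 1" and nz: "c' 1 \<noteq> 0" and z: "c' 0 / c' 1 \<notin> \<real>\<^sub>\<le>\<^sub>0"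
  defines "N \<equiv> \<lambda>s t::real. of_real (1 - t) + of_real s * (c' 0 / c' 1)"
  obtains H where "continuous_on triangle (\<lambda>(s, t). H s t)" "H 0 1 = - c' 1"
    "\<And>s t. \<lbrakk>(s, t) \<in> triangle; (s, t) \<noteq> (0, 1)\<rbrakk> \<Longrightarrow> c t - c s = of_real (t - s) * (N s t * H s t)"
    "\<And>t. 0 \<le> t \<Longrightarrow> t \<le> 1 \<Longrightarrow> c' t = N t t * H t t"
proof -
  obtain \<sigma> where \<sigma>: "continuous_on UNIV (\<lambda>(s, t). \<sigma> s t)" "\<And>t. \<sigma> t t = c' t"
    "\<And>s t. c t - c s = of_real (t - s) * \<sigma> s t"
    using secant_slope[OF der cont] by metis
  have N0: "N s t \<noteq> 0" if "(s, t) \<in> triangle" "(s, t) \<noteq> (0, 1)" for s t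
    using slit_combination[OF z, of "1 - t" s] that unfolding N_def triangle_def
    by (auto simp del: of_real_diff)
  \<comment> \<open>The value at the vertex is the limit, as the computation in the case \<open>x = (0, 1)\<close> shows.\<close>
  define H where "H = (\<lambda>s t. if (s, t) = (0, 1) then - c' 1 else \<sigma> s t / N s t)"
  have cH: "continuous_on triangle (\<lambda>(s, t). H s t)"
    unfolding continuous_on_eq_continuous_within
  proof
    fix x assume x: "x \<in> triangle"
    have cs: "isCont (\<lambda>(s, t). \<sigma> s t) y" for y
      using \<sigma>(1) by (metis continuous_on_eq_continuous_at open_UNIV UNIV_I)
    have cN: "continuous_on UNIV (\<lambda>(s,t). N s t)"
      unfolding N_def by (auto simp: case_prod_beta nz intro!: continuous_intros)
    show "continuous (at x within triangle) (\<lambda>(s, t). H s t)"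
    proof (cases "x = (0, 1)")
      case False
      have "continuous (at x within triangle) (\<lambda>z. (\<lambda>(s, t). \<sigma> s t) z / (\<lambda>(s, t). N s t) z)"
      proof (intro continuous_at_within_divide)
        show "continuous (at x within triangle) (\<lambda>(s, t). \<sigma> s t)"
          using cs by (rule continuous_at_imp_continuous_at_within)
        show "continuous (at x within triangle) (\<lambda>(s, t). N s t)"
          using cN by (metis continuous_on_eq_continuous_at open_UNIV UNIV_I continuous_at_imp_continuous_at_within)
        show "(\<lambda>(s, t). N s t) x \<noteq> 0"
          using N0[of "fst x" "snd x"] x False by (simp add: case_prod_beta)
      qed
      moreover have "\<forall>\<^sub>F z in at x within triangle. z \<noteq> (0, 1)"
        using False by (auto simp: eventually_at_filter intro!: eventually_mono[OF t1_space_nhds])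
      ultimately show ?thesis
        unfolding continuous_within using False
        by (auto elim!: Lim_transform_eventually eventually_mono simp: H_def case_prod_beta prod_eq_iff)
    next
      case True
      let ?F = "at (0, 1) within triangle :: (real \<times> real) filter"
      obtain m where m: "0 < m" "\<And>\<alpha> \<beta>. \<lbrakk>0 \<le> \<alpha>; 0 \<le> \<beta>\<rbrakk> \<Longrightarrow> m * (\<alpha> + \<beta>) \<le> norm (of_real \<alpha> * c' 0 + of_real \<beta> * c' 1)"
        using linear_model_bound_quadrant[OF nz z] by metis
      have lA: "((\<lambda>x. \<sigma> 0 (fst x)) \<longlongrightarrow> c' 0) ?F"
      proof -
        have "((\<lambda>x. (\<lambda>(s, t). \<sigma> s t) (0, fst x)) \<longlongrightarrow> (\<lambda>(s, t). \<sigma> s t) (0, 0)) ?F"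
          by (rule isCont_tendsto_compose[OF cs]) (auto intro!: tendsto_eq_intros)
        then show ?thesis by (simp add: \<sigma>)
      qed
      have lB: "((\<lambda>x. \<sigma> 1 (snd x)) \<longlongrightarrow> c' 1) ?F"
      proof -
        have "((\<lambda>x. (\<lambda>(s, t). \<sigma> s t) (1, snd x)) \<longlongrightarrow> (\<lambda>(s, t). \<sigma> s t) (1, 1)) ?F"
          by (rule isCont_tendsto_compose[OF cs]) (auto intro!: tendsto_eq_intros)
        then show ?thesis by (simp add: \<sigma>)
      qed
      have "((\<lambda>x. (of_real (fst x) * \<sigma> 0 (fst x) + of_real (1 - snd x) * \<sigma> 1 (snd x)) /
                (of_real (fst x) * c' 0 + of_real (1 - snd x) * c' 1)) \<longlongrightarrow> 1) ?F"
        by (rule linear_model_ratio_tendsto[OF lA lB m(1)])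
           (use m(2) in \<open>auto simp: eventually_at_filter triangle_def simp del: of_real_diff intro!: always_eventually\<close>)
      moreover have "((\<lambda>x. - c' 1 / of_real (snd x - fst x)) \<longlongrightarrow> - c' 1) ?F"
        by (rule tendsto_eq_intros refl | simp)+
      ultimately have "((\<lambda>x. (- c' 1 / of_real (snd x - fst x)) * ((of_real (fst x) * \<sigma> 0 (fst x) + of_real (1 - snd x) * \<sigma> 1 (snd x)) /
                (of_real (fst x) * c' 0 + of_real (1 - snd x) * c' 1))) \<longlongrightarrow> - c' 1) ?F"
        using tendsto_mult by fastforce
      then have "((\<lambda>(s, t). H s t) \<longlongrightarrow> - c' 1) ?F"
      proof (rule Lim_transform_eventually)
        have "\<forall>\<^sub>F x in ?F. fst x < 1/2 \<and> 1/2 < snd x"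
        proof -
          have "(fst \<longlongrightarrow> (0::real)) ?F" "(snd \<longlongrightarrow> (1::real)) ?F" by (auto intro!: tendsto_eq_intros)
          from order_tendstoD(2)[OF this(1), of "1/2"] order_tendstoD(1)[OF this(2), of "1/2"] show ?thesis
            by (simp add: eventually_conj_iff)
        qed
        moreover have "\<forall>\<^sub>F x in ?F. x \<in> triangle \<and> x \<noteq> (0, 1)" by (auto simp: eventually_at_filter)
        ultimately show "\<forall>\<^sub>F x in ?F. (- c' 1 / of_real (snd x - fst x)) * ((of_real (fst x) * \<sigma> 0 (fst x) + of_real (1 - snd x) * \<sigma> 1 (snd x)) /
                (of_real (fst x) * c' 0 + of_real (1 - snd x) * c' 1)) = (\<lambda>(s, t). H s t) x"
        proof eventually_elim
          case (elim x)
          obtain s t where x: "x = (s, t)" by fastforce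
          have "s < t" using elim x by auto
          have "of_real (t - s) * \<sigma> s t = (c t - c 1) - (c s - c 0)" using \<sigma>(3)[of t s] loop by simp
          also have "\<dots> = - (of_real s * \<sigma> 0 s + of_real (1 - t) * \<sigma> 1 t)"
            using \<sigma>(3)[of t 1] \<sigma>(3)[of s 0] by (simp add: algebra_simps)
          finally have 1: "of_real (t - s) * \<sigma> s t = - (of_real s * \<sigma> 0 s + of_real (1 - t) * \<sigma> 1 t)" .
          have 2: "of_real s * c' 0 + of_real (1 - t) * c' 1 = c' 1 * N s t"
            using nz by (simp add: N_def algebra_simps)
          have "- c' 1 / of_real (t - s) * ((of_real s * \<sigma> 0 s + of_real (1 - t) * \<sigma> 1 t) / (c' 1 * N s t))
             = (- (of_real s * \<sigma> 0 s + of_real (1 - t) * \<sigma> 1 t)) / (of_real (t - s) * N s t)"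
            using nz by (simp del: of_real_diff minus_add_distrib)
          also have "\<dots> = \<sigma> s t / N s t" unfolding 1[symmetric] using \<open>s < t\<close> by simp
          also have "\<dots> = H s t" using elim x by (auto simp: H_def)
          finally show ?case by (simp only: x 2 prod.case fst_conv snd_conv)
        qed
      qed
      then show ?thesis by (simp add: True continuous_within H_def)
    qed
  qed
  show thesis
  proof (rule that[OF cH])
    show "c t - c s = of_real (t - s) * (N s t * H s t)" if "(s, t) \<in> triangle" "(s, t) \<noteq> (0, 1)" for s t
      using \<sigma>(3)[of t s] N0[OF that] that by (auto simp: H_def)
    show "c' t = N t t * H t t" if "0 \<le> t" "t \<le> 1" for t
      using \<sigma>(2)[of t] N0[of t t] that by (auto simp: H_def triangle_def)
  qed (simp add: H_def)
qed

text \<open>The function \<open>K\<close> is the secant map without its zeros.  On the diagonal it is the velocity, on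
  both legs it is the secant through the corner, in each case up to the factors that have been
  divided out.  The factor belonging to the corner runs from 1 to \<open>z\<close> along a segment on the
  diagonal, which accounts for \<open>Ln z\<close>, and is a positive multiple of a constant on the legs; the
  logarithms \<open>\<mu>d\<close>, \<open>\<mu>l\<close>, \<open>\<mu>t\<close> belong to the factor that a self-crossing requires.\<close>

lemma tangent_turning_from_factorisation:
  fixes c c' \<Lambda> l \<mu>d \<mu>l \<mu>t :: "real \<Rightarrow> complex" and K :: "real \<Rightarrow> real \<Rightarrow> complex"
  assumes K: "continuous_on triangle (\<lambda>(s, t). K s t)" "\<And>s t. (s, t) \<in> triangle \<Longrightarrow> K s t \<noteq> 0"
    and z: "z \<notin> \<real>\<^sub>\<le>\<^sub>0"
    and \<Lambda>: "continuous_on {0..1} \<Lambda>" "\<And>t. \<lbrakk>0 < t; t < 1\<rbrakk> \<Longrightarrow> exp (\<Lambda> t) = c' t"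
    and l: "continuous_on {0..1} l" "\<And>t. \<lbrakk>0 < t; t < 1\<rbrakk> \<Longrightarrow> c t - c 0 = of_real (t * (1 - t)) * exp (l t)"
    and \<mu>: "continuous_on {0..1} \<mu>d" "continuous_on {0..1} \<mu>l" "continuous_on {0..1} \<mu>t"
    and D: "\<And>t. \<lbrakk>0 < t; t < 1\<rbrakk> \<Longrightarrow> c' t = kd * (of_real (1 - t) + of_real t * z) * exp (\<mu>d t) * K t t"
    and L: "\<And>t. \<lbrakk>0 < t; t < 1\<rbrakk> \<Longrightarrow> c t - c 0 = kl * of_real (t * (1 - t)) * exp (\<mu>l t) * K 0 t"
    and T: "\<And>t. \<lbrakk>0 < t; t < 1\<rbrakk> \<Longrightarrow> c t - c 0 = kt * of_real (t * (1 - t)) * exp (\<mu>t t) * K t 1"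
  shows "\<Lambda> 1 - \<Lambda> 0 = 2 * (l 1 - l 0) + Ln z + (\<mu>d 1 - \<mu>d 0) - (\<mu>l 1 - \<mu>l 0) - (\<mu>t 1 - \<mu>t 0)"
proof -
  define \<nu> where "\<nu> = (\<lambda>t. Ln (of_real (1 - t) + of_real t * z))"
  have slit: "of_real (1 - t) + of_real t * z \<notin> \<real>\<^sub>\<le>\<^sub>0" if "0 \<le> t" "t \<le> 1" for t
    using slit_combination[OF z, of "1 - t" t] that by (simp del: of_real_diff)
  have \<nu>: "continuous_on {0..1} \<nu>" "\<And>t. 0 \<le> t \<Longrightarrow> t \<le> 1 \<Longrightarrow> exp (\<nu> t) = of_real (1 - t) + of_real t * z"
  proof -
    show "continuous_on {0..1} \<nu>" unfolding \<nu>_def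
      by (intro continuous_intros) (use slit in auto)
    fix t :: real assume "0 \<le> t" "t \<le> 1"
    then have "of_real (1 - t) + of_real t * z \<noteq> 0" using slit[of t] by (metis nonpos_Reals_zero_I)
    then show "exp (\<nu> t) = of_real (1 - t) + of_real t * z" by (simp add: \<nu>_def)
  qed
  have pos: "of_real (t * (1 - t)) \<noteq> (0::complex)" if "0 < t" "t < 1" for t
    using that by (simp del: of_real_mult of_real_diff)
  have "(\<Lambda> 1 - \<nu> 1 - \<mu>d 1) - (\<Lambda> 0 - \<nu> 0 - \<mu>d 0) =
      ((l 1 - \<mu>l 1) - (l 0 - \<mu>l 0)) + ((l 1 - \<mu>t 1) - (l 0 - \<mu>t 0))"
  proof (rule triangle_log_change[OF K, where D = "\<lambda>t. \<Lambda> t - \<nu> t - \<mu>d t" and L = "\<lambda>t. l t - \<mu>l t" and U = "\<lambda>t. l t - \<mu>t t"])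
    fix t :: real assume t: "0 < t" "t < 1"
    have "exp (\<Lambda> t - \<nu> t - \<mu>d t) = c' t / (exp (\<nu> t) * exp (\<mu>d t))" using \<Lambda>(2)[OF t] by (simp add: exp_diff)
    also have "\<dots> = kd * K t t"
      unfolding D[OF t] using t by (subst \<nu>(2)[symmetric]) auto
    finally show "exp (\<Lambda> t - \<nu> t - \<mu>d t) = kd * K t t" .
    have "exp (l t) = kl * exp (\<mu>l t) * K 0 t" using L[OF t] l(2)[OF t] pos[OF t] by (simp del: of_real_mult of_real_diff)
    then show "exp (l t - \<mu>l t) = kl * K 0 t" by (simp add: exp_diff)
    have "exp (l t) = kt * exp (\<mu>t t) * K t 1" using T[OF t] l(2)[OF t] pos[OF t] by (simp del: of_real_mult of_real_diff)
    then show "exp (l t - \<mu>t t) = kt * K t 1" by (simp add: exp_diff)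
  qed (auto intro!: continuous_intros assms \<nu>)
  moreover have "\<nu> 0 = 0" "\<nu> 1 = Ln z" by (simp_all add: \<nu>_def)
  ultimately show ?thesis by (simp add: algebra_simps)
qed

lemma turning_of_simple_loop:
  fixes c c' \<Lambda> l :: "real \<Rightarrow> complex"
  assumes der: "\<And>t. (c has_vector_derivative c' t) (at t)" and cont: "continuous_on UNIV c'"
    and loop: "c 0 = c 1" and nz: "\<And>t. c' t \<noteq> 0" and z: "c' 0 / c' 1 \<notin> \<real>\<^sub>\<le>\<^sub>0"
    and inj: "\<And>s t. \<lbrakk>0 \<le> s; s < t; t \<le> 1; c s = c t\<rbrakk> \<Longrightarrow> s = 0 \<and> t = 1"
    and \<Lambda>: "continuous_on {0..1} \<Lambda>" "\<And>t. \<lbrakk>0 < t; t < 1\<rbrakk> \<Longrightarrow> exp (\<Lambda> t) = c' t"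
    and l: "continuous_on {0..1} l" "\<And>t. \<lbrakk>0 < t; t < 1\<rbrakk> \<Longrightarrow> c t - c 0 = of_real (t * (1 - t)) * exp (l t)"
  shows "\<Lambda> 1 - \<Lambda> 0 = 2 * (l 1 - l 0) + Ln (c' 0 / c' 1)"
proof -
  obtain H where H: "continuous_on triangle (\<lambda>(s, t). H s t)" "H 0 1 = - c' 1"
    "\<And>s t. \<lbrakk>(s, t) \<in> triangle; (s, t) \<noteq> (0, 1)\<rbrakk> \<Longrightarrow>
       c t - c s = of_real (t - s) * ((of_real (1 - t) + of_real s * (c' 0 / c' 1)) * H s t)"
    "\<And>t. 0 \<le> t \<Longrightarrow> t \<le> 1 \<Longrightarrow> c' t = (of_real (1 - t) + of_real t * (c' 0 / c' 1)) * H t t"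
    using secant_with_corner[OF der cont loop nz z] by metis
  have "\<Lambda> 1 - \<Lambda> 0 = 2 * (l 1 - l 0) + Ln (c' 0 / c' 1) + (0 - 0) - (0 - 0) - (0 - 0)"
  proof (rule tangent_turning_from_factorisation[OF H(1) _ z \<Lambda> l, where kd = 1 and kl = 1 and kt = "- (c' 0 / c' 1)"])
    fix s t assume st: "(s, t) \<in> triangle"
    show "H s t \<noteq> 0"
    proof (cases "(s, t) = (0, 1)")
      case True then show ?thesis using H(2) nz by auto
    next
      case False
      have "s = t \<or> s < t" using st by (auto simp: triangle_def)
      then show ?thesis
        using H(3)[OF st False] H(4)[of t] nz[of t] inj[of s t] st False by (auto simp: triangle_def)
    qed
  next
    fix t :: real assume "0 < t" "t < 1"
    then have "c 1 - c t = of_real (1 - t) * ((of_real (1 - 1) + of_real t * (c' 0 / c' 1)) * H t 1)"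
      by (intro H(3)) (auto simp: triangle_def)
    then have "c t - c 0 = - (of_real (1 - t) * ((of_real (1 - 1) + of_real t * (c' 0 / c' 1)) * H t 1))"
      using loop by (metis minus_diff_eq)
    then show "c t - c 0 = - (c' 0 / c' 1) * of_real (t * (1 - t)) * exp 0 * H t 1"
      by simp
  next
    fix t :: real assume t: "0 < t" "t < 1"
    show "c' t = 1 * (of_real (1 - t) + of_real t * (c' 0 / c' 1)) * exp 0 * H t t"
      using H(4)[of t] t by simp
    have "c t - c 0 = of_real (t - 0) * ((of_real (1 - t) + of_real 0 * (c' 0 / c' 1)) * H 0 t)"
      using t by (intro H(3)) (auto simp: triangle_def)
    then show "c t - c 0 = 1 * of_real (t * (1 - t)) * exp 0 * H 0 t" by simp
  qed auto
  then show ?thesis by simp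
qed

text \<open>\<open>Ln (- z) - Ln z\<close> is \<open>- \<i> * pi\<close> in the upper and \<open>\<i> * pi\<close> in the lower half plane.\<close>

lemma Ln_minus_change:
  assumes "Im z1 * Im z0 < 0"
  shows "(Ln (- z1) - Ln z1) - (Ln (- z0) - Ln z0) = - 2 * of_real pi * \<i> * of_real (sgn (Im z1))"
proof (cases "0 < Im z1")
  case True
  then have "Im z0 < 0" using assms by (simp add: mult_less_0_iff)
  with True have "z1 \<noteq> 0" "z0 \<noteq> 0" by auto
  with True \<open>Im z0 < 0\<close> show ?thesis by (simp add: Ln_minus)
next
  case False
  then have "0 < Im z0" "Im z1 < 0" using assms by (auto simp: mult_less_0_iff)
  then have "z1 \<noteq> 0" "z0 \<noteq> 0" by auto
  with \<open>0 < Im z0\<close> \<open>Im z1 < 0\<close> show ?thesis by (simp add: Ln_minus)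
qed

text \<open>Near the crossing \<open>(a, b)\<close> the secant map is asymptotic to \<open>(t - b) * c' b - (s - a) * c' a\<close>, which
  is \<open>c' b\<close> times the map \<open>M\<close> of the proof and vanishes only at \<open>(a, b)\<close> since the strands are
  transverse.  Around the boundary of the triangle, \<open>M\<close> winds once, in the direction given by the
  sign of the determinant.\<close>

lemma turning_of_loop_with_one_crossing:
  fixes c c' \<Lambda> l :: "real \<Rightarrow> complex"
  assumes der: "\<And>t. (c has_vector_derivative c' t) (at t)" and cont: "continuous_on UNIV c'"
    and loop: "c 0 = c 1" and nz: "\<And>t. c' t \<noteq> 0" and z: "c' 0 / c' 1 \<notin> \<real>\<^sub>\<le>\<^sub>0"
    and ab: "0 < a" "a < b" "b < 1" "c a = c b" and transverse: "det2 (c' a) (c' b) \<noteq> 0"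
    and inj: "\<And>s t. \<lbrakk>0 \<le> s; s < t; t \<le> 1; c s = c t\<rbrakk> \<Longrightarrow> s = 0 \<and> t = 1 \<or> s = a \<and> t = b"
    and \<Lambda>: "continuous_on {0..1} \<Lambda>" "\<And>t. \<lbrakk>0 < t; t < 1\<rbrakk> \<Longrightarrow> exp (\<Lambda> t) = c' t"
    and l: "continuous_on {0..1} l" "\<And>t. \<lbrakk>0 < t; t < 1\<rbrakk> \<Longrightarrow> c t - c 0 = of_real (t * (1 - t)) * exp (l t)"
  shows "\<Lambda> 1 - \<Lambda> 0 = 2 * (l 1 - l 0) + Ln (c' 0 / c' 1)
     - 2 * of_real pi * \<i> * of_real (sgn (det2 (c' a) (c' b)))"
proof -
  define N where "N = (\<lambda>s t. of_real (1 - t) + of_real s * (c' 0 / c' 1))"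
  obtain H where H: "continuous_on triangle (\<lambda>(s, t). H s t)" "H 0 1 = - c' 1"
    "\<And>s t. \<lbrakk>(s, t) \<in> triangle; (s, t) \<noteq> (0, 1)\<rbrakk> \<Longrightarrow> c t - c s = of_real (t - s) * (N s t * H s t)"
    "\<And>t. 0 \<le> t \<Longrightarrow> t \<le> 1 \<Longrightarrow> c' t = N t t * H t t"
    using secant_with_corner[OF der cont loop nz z] unfolding N_def by metis
  obtain \<sigma> where \<sigma>: "continuous_on UNIV (\<lambda>(s, t). \<sigma> s t)" "\<And>t. \<sigma> t t = c' t"
    "\<And>s t. c t - c s = of_real (t - s) * \<sigma> s t"
    using secant_slope[OF der cont] by metis
  define \<rho> where "\<rho> = c' a / c' b"
  have sgn\<rho>: "sgn (Im \<rho>) = - sgn (det2 (c' a) (c' b))"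
  proof -
    have "Im \<rho> = - det2 (c' a) (c' b) / (cmod (c' b))\<^sup>2"
      by (simp add: \<rho>_def det2_def Im_divide cmod_power2 field_simps)
    then show ?thesis using nz[of b] by (simp add: sgn_divide sgn_minus)
  qed
  then have Im\<rho>: "Im \<rho> \<noteq> 0" using transverse by (metis neg_equal_0_iff_equal sgn_0_0)
  define M where "M = (\<lambda>s t. of_real (t - b) - of_real (s - a) * \<rho>)"
  have ImM: "Im (M s t) = - (s - a) * Im \<rho>" and ReM: "Re (M s t) = t - b - (s - a) * Re \<rho>" for s t
    by (simp_all add: M_def algebra_simps)
  have M0: "M s t = 0 \<longleftrightarrow> s = a \<and> t = b" for s t
    using Im\<rho> by (auto simp: complex_eq_iff ImM ReM)
  have N0: "N s t \<noteq> 0" if "(s, t) \<in> triangle" "(s, t) \<noteq> (0, 1)" for s t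
    using slit_combination[OF z, of "1 - t" s] that unfolding N_def triangle_def
    by (auto simp del: of_real_diff)
  have abT: "(a, b) \<in> triangle" "(a, b) \<noteq> (0, 1)" using ab by (auto simp: triangle_def)
  define k where "k = c' b / (of_real (b - a) * N a b)"
  have k0: "k \<noteq> 0" using nz ab N0[OF abT] by (simp add: k_def)
  \<comment> \<open>The value \<open>k\<close> is the limit of the quotient at the crossing.\<close>
  define K where "K = (\<lambda>s t. if (s, t) = (a, b) then k else H s t / M s t)"
  have cK: "continuous_on triangle (\<lambda>(s, t). K s t)"
    unfolding continuous_on_eq_continuous_within
  proof
    fix x assume x: "x \<in> triangle"
    have "continuous_on UNIV (\<lambda>(s,t). N s t)" "continuous_on UNIV (\<lambda>(s,t). M s t)"
      unfolding N_def M_def by (auto simp: case_prod_beta nz intro!: continuous_intros)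
    then have cN: "isCont (\<lambda>(s,t). N s t) y" and cM: "isCont (\<lambda>(s,t). M s t) y" for y
      by (metis continuous_on_eq_continuous_at open_UNIV UNIV_I)+
    have cs: "isCont (\<lambda>(s, t). \<sigma> s t) y" for y
      using \<sigma>(1) by (metis continuous_on_eq_continuous_at open_UNIV UNIV_I)
    show "continuous (at x within triangle) (\<lambda>(s, t). K s t)"
    proof (cases "x = (a, b)")
      case False
      have "continuous (at x within triangle) (\<lambda>z. (\<lambda>(s, t). H s t) z / (\<lambda>(s, t). M s t) z)"
      proof (intro continuous_at_within_divide)
        show "continuous (at x within triangle) (\<lambda>(s, t). H s t)"
          using H(1) x by (simp add: continuous_on_eq_continuous_within)
        show "continuous (at x within triangle) (\<lambda>(s, t). M s t)"
          using cM by (rule continuous_at_imp_continuous_at_within)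
      qed (use M0 False in \<open>auto simp: case_prod_beta prod_eq_iff\<close>)
      moreover have "\<forall>\<^sub>F z in at x within triangle. z \<noteq> (a, b)"
        using False by (auto simp: eventually_at_filter intro!: eventually_mono[OF t1_space_nhds])
      ultimately show ?thesis
        unfolding continuous_within using False
        by (auto elim!: Lim_transform_eventually eventually_mono simp: K_def case_prod_beta prod_eq_iff)
    next
      case True
      let ?F = "at (a, b) within triangle :: (real \<times> real) filter"
      have "- \<rho> \<notin> \<real>" using Im\<rho> by (simp add: complex_is_Real_iff)
      then have "- c' a / c' b \<notin> \<real>" by (simp add: \<rho>_def)
      then obtain m where m: "0 < m" "\<And>\<alpha> \<beta>. m * (\<bar>\<alpha>\<bar> + \<bar>\<beta>\<bar>) \<le> norm (of_real \<alpha> * (- c' a) + of_real \<beta> * c' b)"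
        using linear_model_bound[OF nz] by metis
      have lA: "((\<lambda>x. - \<sigma> a (fst x)) \<longlongrightarrow> - c' a) ?F"
      proof -
        have "((\<lambda>x. (\<lambda>(s, t). \<sigma> s t) (a, fst x)) \<longlongrightarrow> (\<lambda>(s, t). \<sigma> s t) (a, a)) ?F"
          by (rule isCont_tendsto_compose[OF cs]) (auto intro!: tendsto_eq_intros)
        then show ?thesis by (simp add: \<sigma> tendsto_minus)
      qed
      have lB: "((\<lambda>x. \<sigma> b (snd x)) \<longlongrightarrow> c' b) ?F"
      proof -
        have "((\<lambda>x. (\<lambda>(s, t). \<sigma> s t) (b, snd x)) \<longlongrightarrow> (\<lambda>(s, t). \<sigma> s t) (b, b)) ?F"
          by (rule isCont_tendsto_compose[OF cs]) (auto intro!: tendsto_eq_intros)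
        then show ?thesis by (simp add: \<sigma>)
      qed
      have R: "((\<lambda>x. (of_real (fst x - a) * (- \<sigma> a (fst x)) + of_real (snd x - b) * \<sigma> b (snd x)) /
                (of_real (fst x - a) * (- c' a) + of_real (snd x - b) * c' b)) \<longlongrightarrow> 1) ?F"
        by (rule linear_model_ratio_tendsto[OF lA lB m(1)])
           (use m(2) in \<open>auto simp: eventually_at_filter prod_eq_iff simp del: of_real_diff intro!: always_eventually\<close>)
      have Q: "((\<lambda>x. c' b / (of_real (snd x - fst x) * (\<lambda>(s, t). N s t) x)) \<longlongrightarrow> c' b / (of_real (b - a) * N a b)) ?F"
      proof (intro tendsto_intros)
        show "((\<lambda>(s, t). N s t) \<longlongrightarrow> N a b) ?F"
          using continuous_at_imp_continuous_at_within[OF cN, of "(a, b)" triangle] by (simp add: continuous_within)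
      qed (use ab N0[OF abT] in \<open>auto intro!: tendsto_eq_intros\<close>)
      have "((\<lambda>(s, t). K s t) \<longlongrightarrow> k) ?F"
      proof (rule Lim_transform_eventually[rotated])
        show "((\<lambda>x. (c' b / (of_real (snd x - fst x) * (\<lambda>(s, t). N s t) x)) * 
               ((of_real (fst x - a) * (- \<sigma> a (fst x)) + of_real (snd x - b) * \<sigma> b (snd x)) /
                (of_real (fst x - a) * (- c' a) + of_real (snd x - b) * c' b))) \<longlongrightarrow> k) ?F"
          using tendsto_mult[OF Q R] by (simp add: k_def)
        have "\<forall>\<^sub>F x in ?F. 0 < snd x - fst x"
        proof (rule order_tendstoD(1))
          show "((\<lambda>x. snd x - fst x) \<longlongrightarrow> b - a) ?F" by (auto intro!: tendsto_eq_intros)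
        qed (use ab in auto)
        moreover have "\<forall>\<^sub>F x in ?F. x \<in> triangle \<and> x \<noteq> (a, b)" by (auto simp: eventually_at_filter)
        moreover have "\<forall>\<^sub>F x in ?F. x \<noteq> (0, 1)"
          using abT(2) by (auto simp: eventually_at_filter intro!: eventually_mono[OF t1_space_nhds])
        ultimately show "\<forall>\<^sub>F x in ?F. (c' b / (of_real (snd x - fst x) * (\<lambda>(s, t). N s t) x)) * 
               ((of_real (fst x - a) * (- \<sigma> a (fst x)) + of_real (snd x - b) * \<sigma> b (snd x)) /
                (of_real (fst x - a) * (- c' a) + of_real (snd x - b) * c' b)) = (\<lambda>(s, t). K s t) x"
        proof eventually_elim
          case (elim x)
          obtain s t where x: "x = (s, t)" by fastforce
          then have st: "(s, t) \<in> triangle" "(s, t) \<noteq> (0, 1)" "(s, t) \<noteq> (a, b)" "s < t" using elim by auto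
          have "of_real (t - s) * (N s t * H s t) = (c t - c b) - (c s - c a)" using H(3)[OF st(1,2)] ab by simp
          also have "\<dots> = of_real (s - a) * (- \<sigma> a s) + of_real (t - b) * \<sigma> b t"
            unfolding \<sigma>(3)[of t b] \<sigma>(3)[of s a] by (simp del: of_real_diff)
          finally have 1: "of_real (s - a) * (- \<sigma> a s) + of_real (t - b) * \<sigma> b t = of_real (t - s) * (N s t * H s t)" by simp
          have 2: "of_real (s - a) * (- c' a) + of_real (t - b) * c' b = c' b * M s t"
          proof -
            have "c' a = c' b * \<rho>" using nz[of b] by (simp add: \<rho>_def)
            then show ?thesis by (simp add: M_def algebra_simps)
          qed
          have "c' b / (of_real (t - s) * N s t) * ((of_real (t - s) * (N s t * H s t)) / (c' b * M s t)) = H s t / M s t"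
            using nz[of b] N0[OF st(1,2)] st(4) by simp
          also have "\<dots> = K s t" using st by (auto simp: K_def)
          finally show ?case by (simp only: x prod.case fst_conv snd_conv 1 2)
        qed
      qed
      then show ?thesis by (simp add: True continuous_within K_def)
    qed
  qed
  have K0: "K s t \<noteq> 0" if st: "(s, t) \<in> triangle" for s t
  proof (cases "(s, t) = (a, b) \<or> (s, t) = (0, 1)")
    case True then show ?thesis using H(2) nz k0 M0 ab by (auto simp: K_def)
  next
    case False
    have "s = t \<or> s < t" using st by (auto simp: triangle_def)
    then have "H s t \<noteq> 0"
      using H(3)[OF st] H(4)[of t] nz[of t] inj[of s t] st False by (auto simp: triangle_def)
    then show ?thesis using False M0 by (auto simp: K_def)
  qed
  have KM: "M s t * K s t = H s t" if "(s, t) \<noteq> (a, b)" for s t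
    using that M0 by (auto simp: K_def)
  have slitM: "M s t \<notin> \<real>\<^sub>\<le>\<^sub>0" if "s = a \<Longrightarrow> b < t" for s t
    using that Im\<rho> by (auto simp: complex_nonpos_Reals_iff ImM ReM)
  have slitM': "- M t t \<notin> \<real>\<^sub>\<le>\<^sub>0" for t
    using Im\<rho> ab by (auto simp: complex_nonneg_Reals_iff ImM ReM)
  \<comment> \<open>\<open>Ln M\<close> is discontinuous only on the part of the line \<open>s = a\<close> below \<open>b\<close>, which meets the diagonal
    but not the legs; on the diagonal \<open>Ln (- M)\<close> is continuous, being cut along the part above \<open>b\<close>.\<close>
  define \<mu>d \<mu>l \<mu>t where "\<mu>d = (\<lambda>t. Ln (- M t t))" and "\<mu>l = (\<lambda>t. Ln (M 0 t))" and "\<mu>t = (\<lambda>t. Ln (M t 1))"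
  have e1: "\<Lambda> 1 - \<Lambda> 0 = 2 * (l 1 - l 0) + Ln (c' 0 / c' 1) + (\<mu>d 1 - \<mu>d 0) - (\<mu>l 1 - \<mu>l 0) - (\<mu>t 1 - \<mu>t 0)"
  proof (rule tangent_turning_from_factorisation[OF cK K0 z \<Lambda> l, where kd = "-1" and kl = 1 and kt = "- (c' 0 / c' 1)"])
    have cM: "continuous_on UNIV (\<lambda>(s,t). M s t)"
      unfolding M_def by (auto simp: case_prod_beta intro!: continuous_intros)
    show "continuous_on {0..1} \<mu>d" "continuous_on {0..1} \<mu>l" "continuous_on {0..1} \<mu>t"
      unfolding \<mu>d_def \<mu>l_def \<mu>t_def using slitM slitM' ab
      by (auto intro!: continuous_on_Ln continuous_on_minus continuous_on_compose2[OF cM, of _ "\<lambda>t. (t, t)", simplified] continuous_on_compose2[OF cM, of _ "\<lambda>t. (0, t)", simplified]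
         continuous_on_compose2[OF cM, of _ "\<lambda>t. (t, 1)", simplified] continuous_intros)
    fix t :: real assume t: "0 < t" "t < 1"
    have e: "exp (\<mu>d t) = - M t t" "exp (\<mu>l t) = M 0 t" "exp (\<mu>t t) = M t 1"
      using ab M0 by (auto simp: \<mu>d_def \<mu>l_def \<mu>t_def)
    have "c' t = N t t * (M t t * K t t)" using H(4)[of t] KM[of t t] ab t by simp
    then show "c' t = -1 * (of_real (1 - t) + of_real t * (c' 0 / c' 1)) * exp (\<mu>d t) * K t t"
      unfolding e N_def by (simp only: mult_minus_left mult_minus_right mult_1_left minus_minus mult.assoc)
    have "c t - c 0 = of_real (t - 0) * (N 0 t * (M 0 t * K 0 t))"
      using H(3)[of 0 t] KM[of 0 t] ab t by (simp add: triangle_def)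
    then show "c t - c 0 = 1 * of_real (t * (1 - t)) * exp (\<mu>l t) * K 0 t"
      by (simp add: e N_def)
    have "c 1 - c t = of_real (1 - t) * (N t 1 * (M t 1 * K t 1))"
      using H(3)[of t 1] KM[of t 1] ab t by (simp add: triangle_def)
    then have "- (c t - c 0) = of_real (1 - t) * (N t 1 * (M t 1 * K t 1))" using loop by simp
    then have "c t - c 0 = - (of_real (1 - t) * (N t 1 * (M t 1 * K t 1)))" by (metis minus_minus)
    then show "c t - c 0 = - (c' 0 / c' 1) * of_real (t * (1 - t)) * exp (\<mu>t t) * K t 1"
      by (simp add: e N_def)
  qed auto
  have e2: "(\<mu>d 1 - \<mu>d 0) - (\<mu>l 1 - \<mu>l 0) - (\<mu>t 1 - \<mu>t 0)
      = (Ln (- M 1 1) - Ln (M 1 1)) - (Ln (- M 0 0) - Ln (M 0 0))"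
    by (simp add: \<mu>d_def \<mu>l_def \<mu>t_def)
  have e3: "(Ln (- M 1 1) - Ln (M 1 1)) - (Ln (- M 0 0) - Ln (M 0 0)) = - 2 * of_real pi * \<i> * of_real (sgn (Im (M 1 1)))"
  proof (rule Ln_minus_change)
    have "Im (M 1 1) * Im (M 0 0) = - ((1 - a) * a * (Im \<rho>)\<^sup>2)" by (simp add: ImM power2_eq_square algebra_simps)
    then show "Im (M 1 1) * Im (M 0 0) < 0" using ab Im\<rho> by simp
  qed
  have e4: "sgn (Im (M 1 1)) = sgn (det2 (c' a) (c' b))"
    using ab sgn\<rho> by (simp add: ImM sgn_mult sgn_minus)
  have "\<Lambda> 1 - \<Lambda> 0 = 2 * (l 1 - l 0) + Ln (c' 0 / c' 1) + ((\<mu>d 1 - \<mu>d 0) - (\<mu>l 1 - \<mu>l 0) - (\<mu>t 1 - \<mu>t 0))"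
    by (simp only: e1 add_diff_eq)
  also have "\<dots> = 2 * (l 1 - l 0) + Ln (c' 0 / c' 1) + - 2 * of_real pi * \<i> * of_real (sgn (det2 (c' a) (c' b)))"
    by (simp only: e2 e3 e4)
  finally show ?thesis by simp
qed

section \<open>Winding numbers near a corner\<close>

lemma corner_model_tendsto:
  fixes A B :: "'a::topological_space \<Rightarrow> complex" and \<alpha> \<beta> :: "'a \<Rightarrow> real"
  assumes AB: "(A \<longlongrightarrow> A0) F" "(B \<longlongrightarrow> B0) F" and z: "B0 \<noteq> 0" "A0 / B0 \<notin> \<real>\<^sub>\<ge>\<^sub>0"
    and ev: "\<forall>\<^sub>F x in F. 0 \<le> \<alpha> x \<and> 0 \<le> \<beta> x \<and> (\<alpha> x \<noteq> 0 \<or> \<beta> x \<noteq> 0)"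
  shows "((\<lambda>x. (of_real (\<alpha> x) * A x - of_real (\<beta> x) * B x) / (of_real (\<beta> x) - of_real (\<alpha> x) * (A0 / B0))) \<longlongrightarrow> - B0) F"
proof -
  have "A0 / (- B0) \<notin> \<real>\<^sub>\<le>\<^sub>0" using z(2) by (auto simp: complex_nonpos_Reals_iff complex_nonneg_Reals_iff)
  then obtain m where m: "0 < m" "\<And>\<alpha> \<beta>. \<lbrakk>0 \<le> \<alpha>; 0 \<le> \<beta>\<rbrakk> \<Longrightarrow> m * (\<alpha> + \<beta>) \<le> norm (of_real \<alpha> * A0 + of_real \<beta> * (- B0))"
    using linear_model_bound_quadrant[of "- B0" A0] z(1) by (metis neg_equal_0_iff_equal)
  have "((\<lambda>x. (of_real (\<alpha> x) * A x + of_real (\<beta> x) * (- B x)) / (of_real (\<alpha> x) * A0 + of_real (\<beta> x) * (- B0))) \<longlongrightarrow> 1) F"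
  proof (rule linear_model_ratio_tendsto[OF AB(1) tendsto_minus[OF AB(2)] m(1)])
    show "\<forall>\<^sub>F x in F. m * (\<bar>\<alpha> x\<bar> + \<bar>\<beta> x\<bar>) \<le> norm (of_real (\<alpha> x) * A0 + of_real (\<beta> x) * (- B0))"
      using ev by eventually_elim (metis m(2) abs_of_nonneg)
    show "\<forall>\<^sub>F x in F. \<alpha> x \<noteq> 0 \<or> \<beta> x \<noteq> 0"
      using ev by eventually_elim auto
  qed
  from tendsto_mult[OF tendsto_const[of "- B0"] this]
  have "((\<lambda>x. - B0 * ((of_real (\<alpha> x) * A x + of_real (\<beta> x) * (- B x)) / (of_real (\<alpha> x) * A0 + of_real (\<beta> x) * (- B0)))) \<longlongrightarrow> - B0) F"
    by simp
  moreover have "- B0 * ((of_real (\<alpha> x) * A x + of_real (\<beta> x) * (- B x)) / (of_real (\<alpha> x) * A0 + of_real (\<beta> x) * (- B0)))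
      = (of_real (\<alpha> x) * A x - of_real (\<beta> x) * B x) / (of_real (\<beta> x) - of_real (\<alpha> x) * (A0 / B0))" for x
  proof -
    have "of_real (\<alpha> x) * A0 + of_real (\<beta> x) * (- B0) = - B0 * (of_real (\<beta> x) - of_real (\<alpha> x) * (A0 / B0))"
      using z(1) by (simp add: right_diff_distrib)
    then show ?thesis using z(1)
      by (simp only: mult_minus_right add_uminus_conv_diff times_divide_eq_right mult_divide_mult_cancel_left neg_equal_0_iff_equal not_False_eq_True)
  qed
  ultimately show ?thesis by simp
qed

text \<open>A loop with a corner at \<open>v\<close> is written as \<open>v + t * (1 - t) * exp (l t)\<close>: then \<open>exp (l 0)\<close> and
  \<open>exp (l 1)\<close> are the directions of its two branches at \<open>v\<close>, and \<open>l\<close> measures the angle swept by the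
  secants through \<open>v\<close>.  A curve \<open>w\<close> leaves \<open>v\<close> in a direction \<open>D 0\<close> different from both branches.
  The function \<open>g t - w r\<close> on the square vanishes, for small \<open>r\<close>, only on the side \<open>r = 0\<close> at
  \<open>t = 0\<close> and \<open>t = 1\<close>, where it has linear models.  Dividing by these relates the winding number
  around \<open>w r\<close> to the swept angle and the two directions.\<close>

lemma winding_number_near_corner:
  fixes g w D l :: "real \<Rightarrow> complex"
  assumes l: "continuous_on {0..1} l" and g: "\<And>t. t \<in> {0..1} \<Longrightarrow> g t = v + of_real (t * (1 - t)) * exp (l t)"
    and D: "continuous_on {0..1} D" and w: "\<And>r. r \<in> {0..1} \<Longrightarrow> w r = v + of_real r * D r"
    and d0: "D 0 \<noteq> 0" and f: "exp (l 0) / D 0 \<notin> \<real>\<^sub>\<ge>\<^sub>0" and e: "exp (l 1) / D 0 \<notin> \<real>\<^sub>\<ge>\<^sub>0"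
  obtains r0 where "0 < r0" "r0 \<le> 1"
    "\<And>r. \<lbrakk>0 < r; r \<le> r0\<rbrakk> \<Longrightarrow> w r \<notin> path_image g"
    "\<And>r. \<lbrakk>0 < r; r < r0\<rbrakk> \<Longrightarrow> 2 * of_real pi * \<i> * winding_number g (w r) =
        l 1 - l 0 + Ln (- (exp (l 0) / D 0)) - Ln (- (exp (l 1) / D 0))"
proof -
  define a b where "a = exp (l 0) / D 0" and "b = exp (l 1) / D 0"
  note ab = f[folded a_def] e[folded b_def]
  have ab0: "a \<noteq> 0" "b \<noteq> 0" using d0 by (auto simp: a_def b_def)
  define P where "P = (\<lambda>r t::real. of_real r - of_real t * a)"
  define Q where "Q = (\<lambda>r t::real. of_real r - of_real (1 - t) * b)"
  have slit: "of_real r - of_real t * x \<notin> \<real>\<^sub>\<le>\<^sub>0" if "x \<notin> \<real>\<^sub>\<ge>\<^sub>0" "0 \<le> r" "0 \<le> t" "r \<noteq> 0 \<or> t \<noteq> 0" for r t and x :: complex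
    using slit_combination[of "- x" r t] that by simp
  have P: "P r t \<notin> \<real>\<^sub>\<le>\<^sub>0" if "0 \<le> r" "0 \<le> t" "r \<noteq> 0 \<or> t \<noteq> 0" for r t
    using slit[OF ab(1)] that by (simp add: P_def)
  have Q: "Q r t \<notin> \<real>\<^sub>\<le>\<^sub>0" if "0 \<le> r" "t \<le> 1" "r \<noteq> 0 \<or> t \<noteq> 1" for r t
    using slit[OF ab(2), of r "1 - t"] that by (simp add: Q_def del: of_real_diff)
  have P0: "P r t \<noteq> 0" if "0 \<le> r" "0 \<le> t" "r \<noteq> 0 \<or> t \<noteq> 0" for r t
    using P[OF that] by (metis nonpos_Reals_zero_I)
  have Q0: "Q r t \<noteq> 0" if "0 \<le> r" "t \<le> 1" "r \<noteq> 0 \<or> t \<noteq> 1" for r t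
    using Q[OF that] by (metis nonpos_Reals_zero_I)
  define Sq where "Sq = {0..1::real} \<times> {0..1::real}"
  define E where "E = (\<lambda>r t. of_real (t * (1 - t)) * exp (l t) - of_real r * D r)"
  \<comment> \<open>On the side \<open>r = 0\<close> the quotient is \<open>exp (l t) / (a * b)\<close> for \<open>0 < t < 1\<close>; this formula also
    gives the limits at the two corners.\<close>
  define \<Psi> where "\<Psi> = (\<lambda>r t. if r = 0 then exp (l t) / (a * b) else E r t / (P r t * Q r t))"
  have E_w: "g t - w r = E r t" if "t \<in> {0..1}" "r \<in> {0..1}" for r t
    using g[OF that(1)] w[OF that(2)] by (simp add: E_def)
  have \<Psi>_inner: "\<Psi> r t = E r t / (P r t * Q r t)" if "r \<noteq> 0 \<or> (t \<noteq> 0 \<and> t \<noteq> 1)" for r t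
    using that ab0 by (auto simp: \<Psi>_def E_def P_def Q_def)
  have c\<Psi>: "continuous_on Sq (\<lambda>(r, t). \<Psi> r t)"
    unfolding continuous_on_eq_continuous_within
  proof
    fix x assume x: "x \<in> Sq"
    obtain r1 t1 where rt: "x = (r1, t1)" by fastforce
    have cE: "continuous_on Sq (\<lambda>x. E (fst x) (snd x))"
      unfolding E_def Sq_def
      by (intro continuous_intros continuous_on_compose2[OF l] continuous_on_compose2[OF D]) auto
    have lE: "((\<lambda>x. exp (l (snd x))) \<longlongrightarrow> exp (l t1)) (at x within Sq)"
      and lD: "((\<lambda>x. D (fst x)) \<longlongrightarrow> D r1) (at x within Sq)"
      and lt: "((\<lambda>x. of_real (snd x) :: complex) \<longlongrightarrow> of_real t1) (at x within Sq)"
      and lr: "((\<lambda>x. of_real (fst x) :: complex) \<longlongrightarrow> of_real r1) (at x within Sq)"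
    proof -
      have "continuous_on Sq (\<lambda>x. exp (l (snd x)))" "continuous_on Sq (\<lambda>x. D (fst x))"
        unfolding Sq_def by (intro continuous_intros continuous_on_compose2[OF l] continuous_on_compose2[OF D]; auto)+
      then show "((\<lambda>x. exp (l (snd x))) \<longlongrightarrow> exp (l t1)) (at x within Sq)" "((\<lambda>x. D (fst x)) \<longlongrightarrow> D r1) (at x within Sq)"
        using x rt by (force simp: continuous_on_def)+
    qed (auto simp: rt intro!: tendsto_eq_intros)
    have lP: "((\<lambda>y. P (fst y) (snd y)) \<longlongrightarrow> P r1 t1) (at x within Sq)"
      using tendsto_diff[OF lr tendsto_mult[OF lt tendsto_const]] by (simp add: P_def)
    have lQ: "((\<lambda>y. Q (fst y) (snd y)) \<longlongrightarrow> Q r1 t1) (at x within Sq)"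
      using tendsto_diff[OF lr tendsto_mult[OF tendsto_diff[OF tendsto_const lt, of 1] tendsto_const]] by (simp add: Q_def)
    have ne: "\<forall>\<^sub>F y in at x within Sq. y \<in> Sq \<and> y \<noteq> x" by (auto simp: eventually_at_filter)
    have "((\<lambda>y. \<Psi> (fst y) (snd y)) \<longlongrightarrow> \<Psi> (fst x) (snd x)) (at x within Sq)"
    proof -
      consider "r1 = 0" "t1 = 0" | "r1 = 0" "t1 = 1" | "r1 \<noteq> 0 \<or> (t1 \<noteq> 0 \<and> t1 \<noteq> 1)" by auto
      then show ?thesis
      proof cases
        case 1
        have nt: "\<forall>\<^sub>F y in at x within Sq. snd y < 1"
          by (rule order_tendstoD(2)[OF tendsto_snd[OF tendsto_ident_at]]) (use rt 1 in simp)
        have "((\<lambda>y. (of_real (snd y) * (of_real (1 - snd y) * exp (l (snd y))) - of_real (fst y) * D (fst y)) /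
              (of_real (fst y) - of_real (snd y) * (exp (l 0) / D 0))) \<longlongrightarrow> - D 0) (at x within Sq)"
        proof (rule corner_model_tendsto)
          show "((\<lambda>y. of_real (1 - snd y) * exp (l (snd y))) \<longlongrightarrow> exp (l 0)) (at x within Sq)"
            using tendsto_mult[OF tendsto_diff[OF tendsto_const lt] lE, of 1] 1 by simp
          show "\<forall>\<^sub>F y in at x within Sq. 0 \<le> snd y \<and> 0 \<le> fst y \<and> (snd y \<noteq> 0 \<or> fst y \<noteq> 0)"
            using ne by eventually_elim (use rt 1 in \<open>auto simp: Sq_def\<close>)
        qed (use lD 1 d0 f in auto)
        moreover have "((\<lambda>y. 1 / Q (fst y) (snd y)) \<longlongrightarrow> 1 / (- b)) (at x within Sq)"
          using tendsto_divide[OF tendsto_const[of 1] lQ] 1 ab0 by (simp add: Q_def)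
        ultimately have lim: "((\<lambda>y. ((of_real (snd y) * (of_real (1 - snd y) * exp (l (snd y))) - of_real (fst y) * D (fst y)) /
              (of_real (fst y) - of_real (snd y) * (exp (l 0) / D 0))) * (1 / Q (fst y) (snd y))) \<longlongrightarrow> - D 0 * (1 / (- b))) (at x within Sq)"
          by (intro tendsto_mult)
        have val: "- D 0 * (1 / (- b)) = \<Psi> (fst x) (snd x)"
          using d0 rt 1 by (simp add: \<Psi>_def a_def)
        show ?thesis
        proof (rule Lim_transform_eventually[OF lim[unfolded val]])
          show "\<forall>\<^sub>F y in at x within Sq. ((of_real (snd y) * (of_real (1 - snd y) * exp (l (snd y))) - of_real (fst y) * D (fst y)) /
              (of_real (fst y) - of_real (snd y) * (exp (l 0) / D 0))) * (1 / Q (fst y) (snd y)) = \<Psi> (fst y) (snd y)"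
            using ne nt
          proof eventually_elim
            case (elim y)
            then have "fst y \<noteq> 0 \<or> (snd y \<noteq> 0 \<and> snd y \<noteq> 1)" using rt 1 by (auto simp: prod_eq_iff)
            then show ?case by (simp add: \<Psi>_inner E_def P_def a_def mult.assoc)
          qed
        qed
      next
        case 2
        have nt: "\<forall>\<^sub>F y in at x within Sq. 0 < snd y"
          by (rule order_tendstoD(1)[OF tendsto_snd[OF tendsto_ident_at]]) (use rt 2 in simp)
        have "((\<lambda>y. (of_real (1 - snd y) * (of_real (snd y) * exp (l (snd y))) - of_real (fst y) * D (fst y)) /
              (of_real (fst y) - of_real (1 - snd y) * (exp (l 1) / D 0))) \<longlongrightarrow> - D 0) (at x within Sq)"
        proof (rule corner_model_tendsto)
          show "((\<lambda>y. of_real (snd y) * exp (l (snd y))) \<longlongrightarrow> exp (l 1)) (at x within Sq)"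
            using tendsto_mult[OF lt lE] 2 by simp
          show "\<forall>\<^sub>F y in at x within Sq. 0 \<le> 1 - snd y \<and> 0 \<le> fst y \<and> (1 - snd y \<noteq> 0 \<or> fst y \<noteq> 0)"
            using ne by eventually_elim (use rt 2 in \<open>auto simp: Sq_def\<close>)
        qed (use lD 2 d0 e in auto)
        moreover have "((\<lambda>y. 1 / P (fst y) (snd y)) \<longlongrightarrow> 1 / (- a)) (at x within Sq)"
          using tendsto_divide[OF tendsto_const[of 1] lP] 2 ab0 by (simp add: P_def)
        ultimately have lim: "((\<lambda>y. ((of_real (1 - snd y) * (of_real (snd y) * exp (l (snd y))) - of_real (fst y) * D (fst y)) /
              (of_real (fst y) - of_real (1 - snd y) * (exp (l 1) / D 0))) * (1 / P (fst y) (snd y))) \<longlongrightarrow> - D 0 * (1 / (- a))) (at x within Sq)"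
          by (intro tendsto_mult)
        have val: "- D 0 * (1 / (- a)) = \<Psi> (fst x) (snd x)"
          using d0 rt 2 by (simp add: \<Psi>_def b_def)
        show ?thesis
        proof (rule Lim_transform_eventually[OF lim[unfolded val]])
          show "\<forall>\<^sub>F y in at x within Sq. ((of_real (1 - snd y) * (of_real (snd y) * exp (l (snd y))) - of_real (fst y) * D (fst y)) /
              (of_real (fst y) - of_real (1 - snd y) * (exp (l 1) / D 0))) * (1 / P (fst y) (snd y)) = \<Psi> (fst y) (snd y)"
            using ne nt
          proof eventually_elim
            case (elim y)
            then have "fst y \<noteq> 0 \<or> (snd y \<noteq> 0 \<and> snd y \<noteq> 1)" using rt 2 by (auto simp: prod_eq_iff)
            then show ?case by (simp add: \<Psi>_inner E_def Q_def b_def mult_ac)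
          qed
        qed
      next
        case 3
        have nz: "P r1 t1 * Q r1 t1 \<noteq> 0"
          using P0[of r1 t1] Q0[of r1 t1] 3 x rt by (auto simp: Sq_def)
        have "((\<lambda>y. E (fst y) (snd y)) \<longlongrightarrow> E r1 t1) (at x within Sq)"
          using cE x rt by (force simp: continuous_on_def)
        then have "((\<lambda>y. E (fst y) (snd y) / (P (fst y) (snd y) * Q (fst y) (snd y))) \<longlongrightarrow> E r1 t1 / (P r1 t1 * Q r1 t1)) (at x within Sq)"
          by (rule tendsto_divide[OF _ tendsto_mult[OF lP lQ] nz])
        then have "((\<lambda>y. E (fst y) (snd y) / (P (fst y) (snd y) * Q (fst y) (snd y))) \<longlongrightarrow> \<Psi> (fst x) (snd x)) (at x within Sq)"
          using \<Psi>_inner[OF 3] rt by simp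
        moreover have "\<forall>\<^sub>F y in at x within Sq. fst y \<noteq> 0 \<or> (snd y \<noteq> 0 \<and> snd y \<noteq> 1)"
        proof (cases "r1 = 0")
          case False
          have "(fst \<longlongrightarrow> r1) (at x within Sq)" using rt by (auto intro!: tendsto_eq_intros)
          from tendsto_imp_eventually_ne[OF this False] show ?thesis by eventually_elim auto
        next
          case True
          then have "t1 \<noteq> 0" "t1 \<noteq> 1" using 3 by auto
          moreover have "(snd \<longlongrightarrow> t1) (at x within Sq)" using rt by (auto intro!: tendsto_eq_intros)
          ultimately have "\<forall>\<^sub>F y in at x within Sq. snd y \<noteq> 0" "\<forall>\<^sub>F y in at x within Sq. snd y \<noteq> 1"
            by (auto intro: tendsto_imp_eventually_ne)
          then show ?thesis by eventually_elim auto
        qed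
        ultimately show ?thesis
          by (elim Lim_transform_eventually) (auto elim!: eventually_mono simp: \<Psi>_inner)
      qed
    qed
    then show "continuous (at x within Sq) (\<lambda>(r, t). \<Psi> r t)"
      by (simp add: continuous_within case_prod_beta')
  qed
  \<comment> \<open>The quotient has no zeros on the side \<open>r = 0\<close>, hence by compactness none in a strip
    \<open>{0..r0} \<times> {0..1}\<close>.\<close>
  define Z where "Z = {x \<in> Sq. \<Psi> (fst x) (snd x) = 0}"
  have "compact Sq" unfolding Sq_def by (intro compact_Times) auto
  moreover have "closed Z"
  proof -
    have "closedin (top_of_set Sq) (Sq \<inter> (\<lambda>(r, t). \<Psi> r t) -` {0})"
      by (rule continuous_closedin_preimage[OF c\<Psi>]) simp
    moreover have "Sq \<inter> (\<lambda>(r, t). \<Psi> r t) -` {0} = Z" by (auto simp: Z_def)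
    ultimately show ?thesis using compact_imp_closed[OF \<open>compact Sq\<close>] closedin_closed_trans by metis
  qed
  ultimately have "compact Z" by (metis (no_types, lifting) Z_def compact_Int_closed inf.absorb_iff2 mem_Collect_eq subsetI)
  then have "closed (fst ` Z)" by (intro compact_imp_closed compact_continuous_image) (auto intro: continuous_intros)
  moreover have "0 \<notin> fst ` Z" using ab0 by (auto simp: Z_def \<Psi>_def)
  ultimately obtain \<rho> where \<rho>: "0 < \<rho>" "\<And>x. x \<in> fst ` Z \<Longrightarrow> \<rho> \<le> dist 0 x"
    using separate_point_closed by metis
  define r0 where "r0 = min 1 (\<rho> / 2)"
  have r0: "0 < r0" "r0 \<le> 1" "r0 < \<rho>" using \<rho> by (auto simp: r0_def)
  define R where "R = {0..r0} \<times> {0..1::real}"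
  have RSq: "R \<subseteq> Sq" using r0 by (auto simp: R_def Sq_def)
  have nz: "\<Psi> r t \<noteq> 0" if "(r, t) \<in> R" for r t
  proof
    assume "\<Psi> r t = 0"
    then have "(r, t) \<in> Z" using that RSq by (auto simp: Z_def)
    then have "\<rho> \<le> dist 0 r" using \<rho>(2) by force
    then show False using that r0 by (auto simp: R_def)
  qed
  have "convex R" unfolding R_def by (intro convex_Times) auto
  moreover have "(\<lambda>(r, t). \<Psi> r t) x \<noteq> 0" if "x \<in> R" for x
    using nz[of "fst x" "snd x"] that by (simp add: case_prod_beta)
  ultimately obtain \<Theta> where \<Theta>: "continuous_on R \<Theta>" "\<And>x. x \<in> R \<Longrightarrow> exp (\<Theta> x) = (\<lambda>(r, t). \<Psi> r t) x"
    using log_on_convex[OF _ continuous_on_subset[OF c\<Psi> RSq]] by blast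
  have avoid: "w r \<notin> path_image g" if r: "0 < r" "r \<le> r0" for r
  proof
    assume "w r \<in> path_image g"
    then obtain t where t: "t \<in> {0..1}" "w r = g t" by (auto simp: path_image_def)
    then have "E r t = 0" using E_w[OF t(1), of r] r r0 by auto
    then have "\<Psi> r t = 0" using r by (simp add: \<Psi>_def)
    then show False using nz[of r t] t r by (auto simp: R_def)
  qed
  define W where "W = (\<lambda>r. \<Theta> (r, 1) - \<Theta> (r, 0) + Ln (of_real r - a) - Ln (of_real r - b))"
  have cW: "continuous_on {0..r0} W"
    unfolding W_def using slit[OF ab(1), of _ 1] slit[OF ab(2), of _ 1]
    by (intro continuous_intros continuous_on_compose2[OF \<Theta>(1)]) (auto simp: R_def)
  have W: "2 * of_real pi * \<i> * winding_number g (w r) = W r" if r: "0 < r" "r \<le> r0" for r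
  proof -
    define h where "h = (\<lambda>t. \<Theta> (r, t) + Ln (P r t) + Ln (Q r t))"
    have "2 * of_real pi * \<i> * winding_number g (w r) = h 1 - h 0"
    proof (rule winding_number_log_change)
      show "continuous_on {0..1} h"
        unfolding h_def using P[of r] Q[of r] r
        by (intro continuous_intros continuous_on_compose2[OF \<Theta>(1)])
           (auto simp: R_def P_def Q_def intro!: continuous_intros)
      fix t :: real assume t: "t \<in> {0..1}"
      have "P r t \<noteq> 0" "Q r t \<noteq> 0" using P0[of r t] Q0[of r t] t r by auto
      moreover have "exp (\<Theta> (r, t)) = \<Psi> r t" using \<Theta>(2)[of "(r, t)"] t r by (auto simp: R_def)
      ultimately have "exp (h t) = E r t" using r by (simp add: h_def exp_add \<Psi>_def)
      then show "exp (h t) = g t - w r" using E_w[OF t, of r] r r0 by simp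
    qed
    then show ?thesis by (simp add: h_def W_def P_def Q_def)
  qed
  have loop: "pathfinish g = pathstart g" using g[of 0] g[of 1] by (simp add: pathfinish_def pathstart_def)
  have pg: "path g"
  proof -
    have "continuous_on {0..1} (\<lambda>t. v + of_real (t * (1 - t)) * exp (l t))" by (intro continuous_intros l)
    then show ?thesis unfolding path_def by (rule continuous_on_eq) (simp add: g)
  qed
  \<comment> \<open>\<open>W r\<close> is an integer multiple of \<open>2 * pi * \<i>\<close> for \<open>r > 0\<close> and continuous up to \<open>r = 0\<close>, so it is
    constant.\<close>
  have const: "W r = W 0" if r: "0 < r" "r < r0" for r
  proof -
    have "W r - W 0 = (\<lambda>_. 0) r - (\<lambda>_. 0) 0"
    proof (rule log_change_unique_Icc)
      show "continuous_on {0..r} W" by (rule continuous_on_subset[OF cW]) (use r in auto)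
      fix t assume t: "0 < t" "t < r"
      have "winding_number g (w t) \<in> \<int>"
        using integer_winding_number[OF pg loop avoid[of t]] t r by auto
      then obtain k :: int where "winding_number g (w t) = of_int k" by (auto elim: Ints_cases)
      then have "W t = 2 * of_real pi * \<i> * of_int k" using W[of t] t r by simp
      then show "exp (W t) = exp 0" unfolding exp_eq by (auto intro!: exI[of _ k])
    qed (use r in auto)
    then show ?thesis by simp
  qed
  have "\<Theta> (0, 1) - \<Theta> (0, 0) = l 1 - l 0"
    by (rule log_change_scaled[where c = "1 / (a * b)"])
       (use \<Theta>(2) r0 in \<open>auto simp: R_def \<Psi>_def intro!: continuous_on_compose2[OF \<Theta>(1)] continuous_intros l\<close>)
  then have "W 0 = l 1 - l 0 + Ln (- a) - Ln (- b)" by (simp add: W_def)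
  then show thesis
    using that[OF r0(1,2) avoid] W const by (auto simp: a_def b_def)
qed

lemma Im_Ln_minus_polar:
  assumes "y = of_real \<rho> * exp (\<i> * of_real \<theta>)" "0 < \<rho>" "0 < \<theta>" "\<theta> < 2 * pi"
  shows "Im (Ln (- y)) = \<theta> - pi"
proof -
  have "Ln (- y) = Complex (ln \<rho>) (\<theta> - pi)"
  proof (rule Ln_unique)
    have "exp (Complex (ln \<rho>) (\<theta> - pi)) = of_real \<rho> * exp (\<i> * of_real (\<theta> - pi))"
      using assms(2) by (simp add: Complex_eq exp_add exp_of_real del: of_real_diff)
    also have "exp (\<i> * of_real (\<theta> - pi)) = exp (\<i> * of_real \<theta>) / exp (\<i> * of_real pi)"
      by (simp only: of_real_diff right_diff_distrib exp_diff)
    also have "of_real \<rho> * (exp (\<i> * of_real \<theta>) / exp (\<i> * of_real pi)) = - y" by (simp add: assms(1) exp_pi_i')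
    finally show "exp (Complex (ln \<rho>) (\<theta> - pi)) = - y" .
  qed (use assms in auto)
  then show ?thesis by simp
qed

text \<open>The terms \<open>Ln\<close> in \<open>winding_number_near_corner\<close> measure angles with a cut in the direction
  \<open>d = D 0\<close>.  Expressed by the angle \<open>\<alpha>\<close> from \<open>f\<close> counterclockwise to \<open>e\<close>, their difference is \<open>- \<alpha>\<close>, or
  \<open>2 * pi - \<alpha>\<close> if \<open>d\<close> lies between \<open>f\<close> and \<open>e\<close>.\<close>

lemma Im_Ln_change_across_corner:
  assumes f: "f \<noteq> 0" and e: "e \<noteq> 0" and d: "d \<noteq> 0"
  defines "\<phi> \<equiv> Arg2pi (d / f)" and "\<alpha> \<equiv> Arg2pi (e / f)"
  assumes \<phi>: "0 < \<phi>" and ne: "\<phi> \<noteq> \<alpha>"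
  shows "f / d \<notin> \<real>\<^sub>\<ge>\<^sub>0" "e / d \<notin> \<real>\<^sub>\<ge>\<^sub>0"
    "Im (Ln (- (f / d)) - Ln (- (e / d))) = (if \<phi> < \<alpha> then 2 * pi else 0) - \<alpha>"
proof -
  have bounds: "\<phi> < 2 * pi" "0 \<le> \<alpha>" "\<alpha> < 2 * pi" using Arg2pi unfolding \<phi>_def \<alpha>_def by blast+
  have x: "d / f = of_real (norm (d / f)) * exp (\<i> * of_real \<phi>)" "e / f = of_real (norm (e / f)) * exp (\<i> * of_real \<alpha>)"
    using Arg2pi_eq unfolding \<phi>_def \<alpha>_def by metis+
  have fd: "f / d = of_real (1 / norm (d / f)) * exp (\<i> * of_real (2 * pi - \<phi>))"
  proof -
    have "exp (\<i> * of_real (2 * pi - \<phi>)) = 1 / exp (\<i> * of_real \<phi>)"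
      by (simp add: ring_distribs exp_diff exp_two_pi_i' mult_ac)
    then have "of_real (1 / norm (d / f)) * exp (\<i> * of_real (2 * pi - \<phi>)) = 1 / (d / f)"
      by (subst (2) x(1)) simp
    then show ?thesis by simp
  qed
  let ?\<theta> = "if \<phi> < \<alpha> then \<alpha> - \<phi> else \<alpha> - \<phi> + 2 * pi"
  have "e / d = (e / f) * (f / d)" using f by simp
  also have "\<dots> = of_real (norm (e / f) * (1 / norm (d / f))) * (exp (\<i> * of_real \<alpha>) * exp (\<i> * of_real (2 * pi - \<phi>)))"
    by (subst x(2), subst fd) simp
  also have "exp (\<i> * of_real \<alpha>) * exp (\<i> * of_real (2 * pi - \<phi>)) = exp (\<i> * of_real (\<alpha> - \<phi> + 2 * pi))"
    by (simp add: exp_add[symmetric] algebra_simps)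
  also have "\<dots> = exp (\<i> * of_real ?\<theta>)"
    by (simp add: ring_distribs exp_add exp_two_pi_i' mult_ac)
  finally have ed: "e / d = of_real (norm (e / f) * (1 / norm (d / f))) * exp (\<i> * of_real ?\<theta>)" .
  have pos: "0 < 1 / norm (d / f)" "0 < norm (e / f) * (1 / norm (d / f))" using assms by simp_all
  have 1: "Im (Ln (- (f / d))) = 2 * pi - \<phi> - pi"
    by (rule Im_Ln_minus_polar[OF fd pos(1)]) (use bounds \<phi> in auto)
  have 2: "Im (Ln (- (e / d))) = ?\<theta> - pi"
    by (rule Im_Ln_minus_polar[OF ed pos(2)]) (use bounds \<phi> ne in auto)
  show "Im (Ln (- (f / d)) - Ln (- (e / d))) = (if \<phi> < \<alpha> then 2 * pi else 0) - \<alpha>"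
    using 1 2 by simp
  have *: "x \<notin> \<real>\<^sub>\<ge>\<^sub>0" if "Im (Ln (- x)) < pi" "x \<noteq> 0" for x
  proof
    assume "x \<in> \<real>\<^sub>\<ge>\<^sub>0"
    then obtain r where r: "x = of_real r" "0 \<le> r" by (auto elim: nonneg_Reals_cases)
    then have "Im (Ln (- x)) = pi" using that(2) by (simp add: Ln_minus Ln_of_real)
    then show False using that by simp
  qed
  show "f / d \<notin> \<real>\<^sub>\<ge>\<^sub>0" by (rule *) (use 1 \<phi> f d in auto)
  show "e / d \<notin> \<real>\<^sub>\<ge>\<^sub>0" by (rule *) (use 2 \<phi> ne e d bounds in auto)
qed

text \<open>The winding number increases by 1 on entering the sector from \<open>exp (l 0)\<close> counterclockwise to
  \<open>exp (l 1)\<close>.  If 0 and 1 are its only values near the corner, it must be 1 in the sector and 0 in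
  the complementary one, and this forces the swept angle to be the angle of the sector.\<close>

lemma interior_sector_of_corner:
  fixes g l :: "real \<Rightarrow> complex"
  assumes l: "continuous_on {0..1} l" and g: "\<And>t. t \<in> {0..1} \<Longrightarrow> g t = v + of_real (t * (1 - t)) * exp (l t)"
    and wn: "0 < \<epsilon>" "\<And>w. \<lbrakk>w \<in> ball v \<epsilon>; w \<notin> path_image g\<rbrakk> \<Longrightarrow> winding_number g w = 0 \<or> winding_number g w = 1"
    and ne: "0 < Arg2pi (exp (l 1) / exp (l 0))"
  shows "Im (l 1 - l 0) = Arg2pi (exp (l 1) / exp (l 0))"
    and "\<And>w D. \<lbrakk>continuous_on {0..1} D; \<And>r. r \<in> {0..1} \<Longrightarrow> w r = v + of_real r * D r; D 0 \<noteq> 0;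
       0 < Arg2pi (D 0 / exp (l 0)); Arg2pi (D 0 / exp (l 0)) < Arg2pi (exp (l 1) / exp (l 0))\<rbrakk> \<Longrightarrow>
       \<exists>r0>0. r0 \<le> 1 \<and> (\<forall>r. 0 < r \<and> r < r0 \<longrightarrow> w r \<notin> path_image g \<and> winding_number g (w r) = 1)"
proof -
  define f e \<alpha> where "f = exp (l 0)" and "e = exp (l 1)" and "\<alpha> = Arg2pi (e / f)"
  note fe = f_def[symmetric] e_def[symmetric] \<alpha>_def[symmetric]
  have fe0: "f \<noteq> 0" "e \<noteq> 0" by (auto simp: f_def e_def)
  have \<alpha>: "0 < \<alpha>" "\<alpha> < 2 * pi" using ne Arg2pi unfolding fe by (auto simp: \<alpha>_def)
  have key: "\<exists>r0>0. r0 \<le> 1 \<and> (\<forall>r. 0 < r \<and> r < r0 \<longrightarrow> w r \<notin> path_image g \<and>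
        (winding_number g (w r) = 0 \<or> winding_number g (w r) = 1) \<and>
        2 * pi * Re (winding_number g (w r)) = Im (l 1 - l 0) + (if Arg2pi (D 0 / f) < \<alpha> then 2 * pi else 0) - \<alpha>)"
    if D: "continuous_on {0..1} D" "\<And>r. r \<in> {0..1} \<Longrightarrow> w r = v + of_real r * D r" "D 0 \<noteq> 0"
      and \<phi>: "0 < Arg2pi (D 0 / f)" "Arg2pi (D 0 / f) \<noteq> \<alpha>" for w D
  proof -
    note arg = Im_Ln_change_across_corner[OF fe0 D(3) \<phi>(1) \<phi>(2)[unfolded \<alpha>_def]]
    obtain r0 where r0: "0 < r0" "r0 \<le> 1" "\<And>r. \<lbrakk>0 < r; r \<le> r0\<rbrakk> \<Longrightarrow> w r \<notin> path_image g"
      "\<And>r. \<lbrakk>0 < r; r < r0\<rbrakk> \<Longrightarrow> 2 * of_real pi * \<i> * winding_number g (w r) =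
        l 1 - l 0 + Ln (- (f / D 0)) - Ln (- (e / D 0))"
      by (rule winding_number_near_corner[OF l g D arg(1,2)[unfolded f_def e_def]])
         (auto simp: f_def e_def)
    have "continuous_on {0..1} (\<lambda>r. v + of_real r * D r)" by (intro continuous_intros D)
    then have "continuous_on {0..1} w" by (rule continuous_on_eq) (simp add: D(2))
    then have "(w \<longlongrightarrow> w 0) (at 0 within {0..1})" by (simp add: continuous_on_def)
    then have "(w \<longlongrightarrow> v) (at 0 within {0..1})" using D(2)[of 0] by simp
    from tendstoD[OF this wn(1)] obtain \<delta> where \<delta>: "0 < \<delta>" "\<And>r. \<lbrakk>r \<in> {0..1}; r \<noteq> 0; dist r 0 < \<delta>\<rbrakk> \<Longrightarrow> dist (w r) v < \<epsilon>"
      unfolding eventually_at by blast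
    show ?thesis
    proof (intro exI[of _ "min r0 \<delta>"] conjI allI impI)
      fix r assume r: "0 < r \<and> r < min r0 \<delta>"
      show "w r \<notin> path_image g" using r0(3) r by simp
      then show "winding_number g (w r) = 0 \<or> winding_number g (w r) = 1"
        using r r0(2) \<delta>(2)[of r] by (intro wn(2)) (auto simp: dist_commute)
      have "Im (2 * of_real pi * \<i> * winding_number g (w r)) = Im (l 1 - l 0) + Im (Ln (- (f / D 0)) - Ln (- (e / D 0)))"
        using r0(4)[of r] r by simp
      then show "2 * pi * Re (winding_number g (w r)) = Im (l 1 - l 0) + (if Arg2pi (D 0 / f) < \<alpha> then 2 * pi else 0) - \<alpha>"
        using arg(3) by (simp add: \<alpha>_def)
    qed (use r0 \<delta> in auto)
  qed
  have ex: "\<exists>W. (W = 0 \<or> W = (1::real)) \<and> 2 * pi * W = Im (l 1 - l 0) + (if \<theta> < \<alpha> then 2 * pi else 0) - \<alpha>"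
    if \<theta>: "0 < \<theta>" "\<theta> < 2 * pi" "\<theta> \<noteq> \<alpha>" for \<theta>
  proof -
    define d where "d = f * exp (\<i> * of_real \<theta>)"
    have d: "d \<noteq> 0" "Arg2pi (d / f) = \<theta>"
      using fe0 \<theta> by (auto simp: d_def intro!: Arg2pi_unique[of 1])
    obtain r0 where r0: "0 < r0" "\<And>r. \<lbrakk>0 < r; r < r0\<rbrakk> \<Longrightarrow> 
        (winding_number g (v + of_real r * d) = 0 \<or> winding_number g (v + of_real r * d) = 1) \<and>
        2 * pi * Re (winding_number g (v + of_real r * d)) = Im (l 1 - l 0) + (if Arg2pi (d / f) < \<alpha> then 2 * pi else 0) - \<alpha>"
      using key[of "\<lambda>_. d" "\<lambda>r. v + of_real r * d"] d \<theta> by auto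
    from r0(2)[of "r0 / 2"] r0(1) d(2) show ?thesis
      by (intro exI[of _ "Re (winding_number g (v + of_real (r0 / 2) * d))"]) auto
  qed
  show \<beta>: "Im (l 1 - l 0) = Arg2pi (exp (l 1) / exp (l 0))"
  proof -
    \<comment> \<open>One test direction in each of the two sectors: their winding numbers differ by 1.\<close>
    obtain W where W: "W = 0 \<or> W = (1::real)" "2 * pi * W = Im (l 1 - l 0) + 2 * pi - \<alpha>"
      using ex[of "\<alpha> / 2"] \<alpha> by auto
    obtain W' where W': "W' = 0 \<or> W' = (1::real)" "2 * pi * W' = Im (l 1 - l 0) - \<alpha>"
      using ex[of "\<alpha> / 2 + pi"] \<alpha> by auto
    have "2 * pi * W = 2 * pi * W' + 2 * pi" using W W' by simp
    then have "W' = 0" using W(1) W'(1) by auto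
    then show ?thesis using W' by (simp add: fe)
  qed
  fix w D
  assume "continuous_on {0..1} D" "\<And>r. r \<in> {0..1} \<Longrightarrow> w r = v + of_real r * D r" "D 0 \<noteq> 0"
       "0 < Arg2pi (D 0 / exp (l 0))" "Arg2pi (D 0 / exp (l 0)) < Arg2pi (exp (l 1) / exp (l 0))"
  from key[OF this(1-3)] this(4,5) obtain r0 where r0: "0 < r0" "r0 \<le> 1" "\<And>r. \<lbrakk>0 < r; r < r0\<rbrakk> \<Longrightarrow> w r \<notin> path_image g \<and>
        (winding_number g (w r) = 0 \<or> winding_number g (w r) = 1) \<and>
        2 * pi * Re (winding_number g (w r)) = Im (l 1 - l 0) + 2 * pi - \<alpha>"
    unfolding fe by auto
  then have "winding_number g (w r) = 1" if "0 < r" "r < r0" for r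
    using r0(3)[OF that] \<beta>[unfolded fe] by auto
  then show "\<exists>r0>0. r0 \<le> 1 \<and> (\<forall>r. 0 < r \<and> r < r0 \<longrightarrow> w r \<notin> path_image g \<and> winding_number g (w r) = 1)"
    using r0 by blast
qed

text \<open>The two halves of the loop come with their own difference quotients, since a loop
  may be joined from two smooth arcs.\<close>

lemma log_of_cornered_loop:
  fixes g F E :: "real \<Rightarrow> complex"
  assumes F: "continuous_on {0..1/2} F" "\<And>t. t \<in> {0..1/2} \<Longrightarrow> g t = v + of_real t * F t" "F 0 \<noteq> 0"
    and E: "continuous_on {1/2..1} E" "\<And>t. t \<in> {1/2..1} \<Longrightarrow> g t = v + of_real (1 - t) * E t" "E 1 \<noteq> 0"
    and ne: "\<And>t. \<lbrakk>0 < t; t < 1\<rbrakk> \<Longrightarrow> g t \<noteq> v"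
  obtains l where "continuous_on {0..1} l" "\<And>t. t \<in> {0..1} \<Longrightarrow> g t = v + of_real (t * (1 - t)) * exp (l t)"
    "exp (l 0) = F 0" "exp (l 1) = E 1"
proof -
  define B where "B = (\<lambda>t. if t \<le> 1/2 then F t / of_real (1 - t) else E t / of_real t)"
  have mid: "F (1/2) = E (1/2)" using F(2)[of "1/2"] E(2)[of "1/2"] by simp
  have "continuous_on ({0..1/2} \<union> {1/2..1}) B" unfolding B_def
  proof (rule continuous_on_If)
    show "continuous_on {0..1/2} (\<lambda>t. F t / of_real (1 - t))" "continuous_on {1/2..1} (\<lambda>t. E t / of_real t)"
      by (auto intro!: continuous_intros F E simp del: of_real_diff)
    fix t :: real assume "t \<in> {1/2..1}" "t \<le> 1/2"
    then have t: "t = 1/2" by simp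
    show "F t / of_real (1 - t) = E t / of_real t" unfolding t using mid by simp
  next
    fix t :: real assume "t \<in> {0..1/2}" "\<not> t \<le> 1/2"
    then show "F t / of_real (1 - t) = E t / of_real t" by simp
  qed auto
  moreover have "{0..1/2} \<union> {1/2..1::real} = {0..1}" by auto
  ultimately have "continuous_on {0..1} B" by simp
  moreover have B: "g t = v + of_real (t * (1 - t)) * B t" if "t \<in> {0..1}" for t
    using F(2)[of t] E(2)[of t] that by (auto simp: B_def simp del: of_real_diff)
  moreover have "B t \<noteq> 0" if "t \<in> {0..1}" for t
    using B[OF that] ne[of t] F(3) E(3) that by (cases "t = 0 \<or> t = 1") (auto simp: B_def)
  ultimately obtain l where l: "continuous_on {0..1} l" "\<And>t. t \<in> {0..1} \<Longrightarrow> exp (l t) = B t"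
    using log_on_convex[of "{0..1::real}" B] by (metis convex_real_interval(5))
  show thesis
    by (rule that[OF l(1)]) (use B l(2) in \<open>auto simp: B_def\<close>)
qed

section \<open>Nested and tangent loops in the plane\<close>

lemma connected_subset_inside:
  assumes "connected T" "T \<inter> S = {}" "x \<in> T" "x \<in> inside S"
  shows "T \<subseteq> inside S"
  using inside_outside_intersect_connected[OF assms(1), of S] assms inside_Un_outside[of S] by blast

lemma connected_subset_outside:
  assumes "connected T" "T \<inter> S = {}" "x \<in> T" "x \<in> outside S"
  shows "T \<subseteq> outside S"
  using inside_outside_intersect_connected[OF assms(1), of S] assms inside_Un_outside[of S] by blast

text \<open>The outside of the loop is connected, unbounded and disjoint from \<open>J'\<close>, hence outside \<open>J'\<close>.  The
  loop itself consists of boundary points of its outside, so it cannot enter the open set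
  \<open>inside J'\<close>.\<close>

lemma inside_nested_loops:
  fixes c :: "real \<Rightarrow> complex"
  assumes c: "simple_path c" "pathfinish c = pathstart c" and "closed J'"
    and sub: "J' \<subseteq> path_image c \<union> inside (path_image c)"
  shows "inside J' \<subseteq> inside (path_image c)"
proof -
  let ?J = "path_image c"
  note jordan = Jordan_inside_outside[OF c]
  have "outside ?J \<inter> J' = {}" using sub by (auto simp: union_with_inside)
  have "outside ?J \<subseteq> outside J'"
  proof
    fix x assume x: "x \<in> outside ?J"
    have "outside ?J \<subseteq> connected_component_set (- J') x"
      using jordan x \<open>outside ?J \<inter> J' = {}\<close> by (intro connected_component_maximal) auto
    then have "\<not> bounded (connected_component_set (- J') x)"
      using jordan bounded_subset by metis
    then show "x \<in> outside J'" by (simp add: outside)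
  qed
  then have disj: "inside J' \<inter> outside ?J = {}" using inside_Int_outside by blast
  have "inside J' \<inter> ?J = {}"
  proof -
    have "?J \<subseteq> closure (outside ?J)" using jordan by (auto simp: frontier_def)
    moreover have "inside J' \<inter> closure (outside ?J) = {}"
      using disj open_Int_closure_eq_empty[OF open_inside[OF \<open>closed J'\<close>]] by simp
    ultimately show ?thesis by blast
  qed
  with disj have "inside J' \<subseteq> - (?J \<union> outside ?J)" by blast
  then show ?thesis by (simp only: inside_outside[of ?J])
qed

text \<open>A loop \<open>k\<close> inside the loop \<open>c\<close>, touching it in one point \<open>P\<close>.  The part \<open>V\<close> of the plane between
  them is connected by Janiszewski's theorem, because the loops meet in a connected set; and it
  encloses the inside of \<open>k\<close>, because every point of \<open>k\<close> is a boundary point of \<open>V\<close>.\<close>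

lemma region_between_tangent_loops:
  fixes c k :: "real \<Rightarrow> complex"
  assumes c: "simple_path c" "pathfinish c = pathstart c" and k: "simple_path k" "pathfinish k = pathstart k"
    and touch: "path_image c \<inter> path_image k = {P}" and ins: "path_image k - {P} \<subseteq> inside (path_image c)"
    and lim: "P \<in> closure (path_image k - {P})"
  defines "V \<equiv> inside (path_image c) \<inter> outside (path_image k)"
  shows "V \<in> components (- (path_image c \<union> path_image k))"
    and "path_image k \<subseteq> frontier V"
    and "inside (path_image k) \<subseteq> inside (frontier V)"
proof -
  let ?J = "path_image c" and ?K = "path_image k"
  note jJ = Jordan_inside_outside[OF c] and jK = Jordan_inside_outside[OF k]
  have cJ: "compact ?J" and cK: "compact ?K" using c k by (auto simp: compact_simple_path_image)
  have oV: "open V" using jJ jK by (auto simp: V_def)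
  have near: "x \<in> closure V" if "x \<in> ?K - {P}" for x
  proof -
    have "x \<in> closure (outside ?K)" using jK that by (auto simp: frontier_def)
    moreover have "x \<in> inside ?J" using that ins by blast
    ultimately show ?thesis
      using open_Int_closure_subset[of "inside ?J" "outside ?K"] jJ by (auto simp: V_def)
  qed
  have V0: "V \<noteq> {}" 
  proof -
    have "?K - {P} \<noteq> {}" using lim by (metis closure_empty empty_iff)
    then obtain z where "z \<in> closure V" using near by blast
    then show ?thesis by auto
  qed
  have disj: "V \<inter> (?J \<union> ?K) = {}" unfolding V_def using inside_no_overlap outside_no_overlap by blast
  have conn: "connected V"
    unfolding connected_iff_connected_component
  proof (intro ballI)
    fix a b assume ab: "a \<in> V" "b \<in> V"
    have "inside ?J \<subseteq> - ?J" "outside ?K \<subseteq> - ?K" using inside_no_overlap outside_no_overlap by blast+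
    then have "connected_component (- ?J) a b" "connected_component (- ?K) a b"
      unfolding connected_component_def using ab jJ jK by (auto simp only: V_def Int_iff)
    then have "connected_component (- (?J \<union> ?K)) a b"
      using Janiszewski[OF cJ compact_imp_closed[OF cK]] touch by simp
    then obtain T where T: "connected T" "T \<subseteq> - (?J \<union> ?K)" "a \<in> T" "b \<in> T" unfolding connected_component_def by blast
    have "T \<subseteq> inside ?J" "T \<subseteq> outside ?K"
      using connected_subset_inside[OF T(1), of ?J a] connected_subset_outside[OF T(1), of ?K a] T ab by (auto simp: V_def)
    then show "connected_component V a b" using T unfolding connected_component_def V_def by blast
  qed
  show "V \<in> components (- (?J \<union> ?K))"
    unfolding in_components_maximal
  proof (intro conjI allI impI)
    fix T assume T: "T \<noteq> {} \<and> V \<subseteq> T \<and> T \<subseteq> - (?J \<union> ?K) \<and> connected T"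
    obtain a where a: "a \<in> V" using V0 by blast
    have "T \<subseteq> inside ?J" "T \<subseteq> outside ?K"
      using connected_subset_inside[of T ?J a] connected_subset_outside[of T ?K a] T a by (auto simp: V_def)
    then show "T = V" using T by (auto simp: V_def)
  qed (use V0 conn disj in auto)
  have "?K - {P} \<subseteq> frontier V"
    using near disj oV by (auto simp: frontier_def interior_open)
  moreover from this have "closure (?K - {P}) \<subseteq> frontier V"
    by (rule closure_minimal) (rule frontier_closed)
  ultimately show fr: "?K \<subseteq> frontier V" using lim by blast
  have "inside ?K \<inter> frontier V = {}"
  proof -
    have "inside ?K \<inter> V = {}" using inside_Int_outside[of ?K] by (auto simp: V_def simp del: inside_Int_outside)
    moreover have "open (inside ?K)" using jK by simp
    ultimately have "inside ?K \<inter> closure V = {}" by (simp only: open_Int_closure_eq_empty)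
    then show ?thesis by (auto simp: frontier_def)
  qed
  then show "inside ?K \<subseteq> inside (frontier V)" using inside_mono[OF fr] by blast
qed

section \<open>Cutting off a curl\<close>

lemma path_subpath_Icc:
  assumes "continuous_on {x..y} p" "x \<le> y"
  shows "path (subpath x y p)"
proof -
  have "(\<lambda>t. (y - x) * t + x) ` {0..1} \<subseteq> {x..y}"
  proof (clarsimp, intro conjI)
    fix t :: real assume "0 \<le> t" "t \<le> 1"
    then show "0 \<le> (y - x) * t" "(y - x) * t + x \<le> y"
      using assms(2) mult_left_mono[of t 1 "y - x"] by auto
  qed
  then show ?thesis unfolding path_def subpath_def
    by (intro continuous_on_compose2[OF assms(1)] continuous_intros)
qed

lemma winding_number_subpath_log_change:
  fixes g L :: "real \<Rightarrow> complex"
  assumes "x \<le> y" "continuous_on {x..y} L" "\<And>t. t \<in> {x..y} \<Longrightarrow> exp (L t) = g t - w"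
  shows "2 * of_real pi * \<i> * winding_number (subpath x y g) w = L y - L x"
proof -
  have in_xy: "(y - x) * t + x \<in> {x..y}" if "t \<in> {0..1}" for t
  proof -
    have "0 \<le> (y - x) * t" "(y - x) * t \<le> (y - x) * 1" using assms(1) that by (auto intro!: mult_left_mono simp del: mult_1_right)
    then show ?thesis by simp
  qed
  have "2 * of_real pi * \<i> * winding_number (subpath x y g) w = L ((y - x) * 1 + x) - L ((y - x) * 0 + x)"
    by (rule winding_number_log_change)
       (use in_xy assms(3) in \<open>auto simp: subpath_def intro!: continuous_on_compose2[OF assms(2)] continuous_intros\<close>)
  then show ?thesis by simp
qed

text \<open>The curl is replaced by a rest of the same duration at the crossing point, which is how the
  removal of half-twists is parametrised for petal projections.\<close>

definition cut_curl :: "real \<Rightarrow> real \<Rightarrow> (real \<Rightarrow> complex) \<Rightarrow> real \<Rightarrow> complex" where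
  "cut_curl a b p t = (if a < t \<and> t < b then p a else p t)"

text \<open>This form makes continuity evident and carries over to logarithms of the curve.\<close>

lemma cut_curl_eq:
  assumes "a \<le> b" "p a = p b"
  shows "cut_curl a b p t = p (min t a) + p (max t b) - p a"
  using assms by (auto simp: cut_curl_def min_def max_def)

lemma continuous_on_cut_curl:
  assumes "continuous_on {x..y} p" "a \<le> b" "p a = p b" "x \<le> a" "b \<le> y"
  shows "continuous_on {x..y} (cut_curl a b p)"
proof -
  have "continuous_on {x..y} (\<lambda>t. p (min t a) + p (max t b) - p a)"
    using assms(2,4,5) by (intro continuous_intros continuous_on_compose2[OF assms(1)]) auto
  then show ?thesis by (rule continuous_on_eq) (use assms cut_curl_eq in auto)
qed

lemma cut_curl_image:
  assumes "x \<le> a" "a \<le> b" "b \<le> y" "p a = p b"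
  shows "cut_curl a b p ` {x..y} = p ` {x..a} \<union> p ` {b..y}"
proof
  show "cut_curl a b p ` {x..y} \<subseteq> p ` {x..a} \<union> p ` {b..y}"
    using assms by (auto simp: cut_curl_def)
  show "p ` {x..a} \<union> p ` {b..y} \<subseteq> cut_curl a b p ` {x..y}"
  proof
    fix z assume "z \<in> p ` {x..a} \<union> p ` {b..y}"
    then obtain t where "t \<in> {x..a} \<union> {b..y}" "z = p t" by blast
    then show "z \<in> cut_curl a b p ` {x..y}" using assms by (intro image_eqI[of _ _ t]) (auto simp: cut_curl_def)
  qed
qed

lemma log_on_Icc:
  fixes g :: "real \<Rightarrow> complex"
  assumes "continuous_on {x..y} g" "w \<notin> g ` {x..y}"
  obtains L where "continuous_on {x..y} L" "\<And>t. t \<in> {x..y} \<Longrightarrow> exp (L t) = g t - w"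
proof (rule log_on_convex[of "{x..y}" "\<lambda>t. g t - w"])
  show "continuous_on {x..y} (\<lambda>t. g t - w)" by (intro continuous_intros assms)
qed (use assms(2) that in auto)

lemma winding_number_cut_curl:
  fixes p :: "real \<Rightarrow> complex"
  assumes p: "continuous_on {x..y} p" and ab: "x \<le> a" "a \<le> b" "b \<le> y" "p a = p b" and w: "w \<notin> p ` {x..y}"
  shows "winding_number (subpath x y p) w = winding_number (subpath x y (cut_curl a b p)) w + winding_number (subpath a b p) w"
proof -
  obtain L where L: "continuous_on {x..y} L" "\<And>t. t \<in> {x..y} \<Longrightarrow> exp (L t) = p t - w"
    using log_on_Icc[OF p w] by blast
  have 1: "2 * of_real pi * \<i> * winding_number (subpath x y p) w = L y - L x"
    by (rule winding_number_subpath_log_change) (use L ab in auto)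
  have 2: "2 * of_real pi * \<i> * winding_number (subpath a b p) w = L b - L a"
    by (rule winding_number_subpath_log_change) (use L ab in \<open>auto intro: continuous_on_subset\<close>)
  have "2 * of_real pi * \<i> * winding_number (subpath x y (cut_curl a b p)) w
      = (L (min y a) + L (max y b) - L b) - (L (min x a) + L (max x b) - L b)"
  proof (rule winding_number_subpath_log_change)
    show "continuous_on {x..y} (\<lambda>t. L (min t a) + L (max t b) - L b)"
      using ab by (intro continuous_intros continuous_on_compose2[OF L(1)]) auto
    fix t assume t: "t \<in> {x..y}"
    have e: "exp (L a) = exp (L b)" "exp (L b) = p a - w" using L(2)[of a] L(2)[of b] ab by auto
    show "exp (L (min t a) + L (max t b) - L b) = cut_curl a b p t - w"
    proof (cases "a < t \<and> t < b")
      case True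
      then show ?thesis by (simp add: cut_curl_def min_def max_def e)
    next
      case False
      then have "t \<le> a \<or> b \<le> t" by auto
      then show ?thesis
        using False ab L(2)[OF t] e(1) by (auto simp: exp_add exp_diff cut_curl_def min_def max_def)
    qed
  qed (use ab in auto)
  also have "\<dots> = (L y - L x) - (L b - L a)" using ab by (cases "y = a"; cases "b = x") (auto simp: min_def max_def)
  finally have "2 * of_real pi * \<i> * winding_number (subpath x y (cut_curl a b p)) w = (L y - L x) - (L b - L a)" .
  then have "2 * of_real pi * \<i> * winding_number (subpath x y p) w
     = 2 * of_real pi * \<i> * (winding_number (subpath x y (cut_curl a b p)) w + winding_number (subpath a b p) w)"
    unfolding distrib_left 1 2 by simp
  then show ?thesis by simp
qed

text \<open>The loop that remains after cutting off the curl has a second corner at the former crossing.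
  To apply the corner lemmas there, it is started at that point.\<close>

lemma winding_number_cut_curl_from_crossing:
  fixes p :: "real \<Rightarrow> complex"
  assumes p: "continuous_on {x..y} p" and ab: "x \<le> a" "a \<le> b" "b \<le> y" "p a = p b" "p x = p y"
    and w: "w \<notin> p ` {x..a}" "w \<notin> p ` {b..y}"
  shows "winding_number (subpath x y (cut_curl a b p)) w = winding_number (subpath b y p +++ subpath x a p) w"
proof -
  let ?q = "cut_curl a b p"
  obtain L where L: "continuous_on {x..y} L" "\<And>t. t \<in> {x..y} \<Longrightarrow> exp (L t) = ?q t - w"
    using log_on_Icc[OF continuous_on_cut_curl[OF p ab(2,4,1,3)]] w cut_curl_image[OF ab(1-4)] by (metis UnE)
  have q: "?q t = p t" if "t \<le> a \<or> b \<le> t" for t using that by (auto simp: cut_curl_def)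
  have Lab: "L b = L a"
  proof -
    have "L b - L a = (\<lambda>_. L a) b - (\<lambda>_. L a) a"
      by (rule log_change_unique[of "{a..b}"])
         (use ab L in \<open>auto intro: continuous_on_subset simp: cut_curl_def\<close>)
    then show ?thesis by simp
  qed
  have 1: "2 * of_real pi * \<i> * winding_number (subpath x y ?q) w = L y - L x"
    by (rule winding_number_subpath_log_change) (use L ab in auto)
  have 2: "2 * of_real pi * \<i> * winding_number (subpath x a p) w = L a - L x"
    by (rule winding_number_subpath_log_change) (use L ab q in \<open>auto intro: continuous_on_subset\<close>)
  have 3: "2 * of_real pi * \<i> * winding_number (subpath b y p) w = L y - L b"
    by (rule winding_number_subpath_log_change) (use L ab q in \<open>auto intro: continuous_on_subset\<close>)
  have paths: "path (subpath b y p)" "path (subpath x a p)"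
    by (rule path_subpath_Icc; use ab in \<open>auto intro: continuous_on_subset[OF p]\<close>)+
  have "winding_number (subpath b y p +++ subpath x a p) w = winding_number (subpath b y p) w + winding_number (subpath x a p) w"
    by (rule winding_number_join) (use paths w ab in \<open>auto simp: path_image_subpath\<close>)
  then have "2 * of_real pi * \<i> * winding_number (subpath x y ?q) w
     = 2 * of_real pi * \<i> * winding_number (subpath b y p +++ subpath x a p) w"
    by (simp only: distrib_left 1 2 3 Lab) simp
  then show ?thesis by simp
qed

section \<open>Angles between consecutive directions\<close>

text \<open>The sum telescopes if each \<open>\<alpha> s\<close> with \<open>s\<close> not maximal is replaced by the distance to the next
  element.\<close>

lemma sum_gaps_le:
  fixes \<alpha> :: "real \<Rightarrow> real"
  assumes "finite T" "T \<noteq> {}" "\<And>s t. \<lbrakk>s \<in> T; t \<in> T; s < t\<rbrakk> \<Longrightarrow> \<alpha> s \<le> t - s"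
  shows "sum \<alpha> T \<le> Max T + \<alpha> (Max T) - Min T"
  using assms
proof (induction rule: finite_linorder_max_induct)
  case (insert b A)
  show ?case
  proof (cases "A = {}")
    case False
    have "sum \<alpha> A \<le> Max A + \<alpha> (Max A) - Min A" using insert False by auto
    moreover have "\<alpha> (Max A) \<le> b - Max A"
      using insert False by (intro insert.prems) auto
    moreover have "Max (insert b A) = b" using insert by (intro Max_insert2) auto
    moreover have "Min (insert b A) = Min A"
      using insert.hyps Min_in[of A] False by (auto simp: min_def simp del: Min_in) fastforce
    moreover have "sum \<alpha> (insert b A) = \<alpha> b + sum \<alpha> A" using insert by auto
    ultimately show ?thesis by simp
  qed simp
qed simp

text \<open>If every \<open>\<alpha> i\<close> is at most the counterclockwise angle from \<open>u i\<close> to any other direction, the sectors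
  of angles \<open>\<alpha> i\<close> that start at the \<open>u i\<close> do not overlap.  The gap from the largest argument to the
  smallest one closes up the full turn.\<close>

lemma sum_angles_to_next_direction_le:
  fixes u :: "'i \<Rightarrow> complex" and \<alpha> :: "'i \<Rightarrow> real"
  assumes I: "finite I" and u: "\<And>i. i \<in> I \<Longrightarrow> u i \<noteq> 0" and less: "\<And>i. i \<in> I \<Longrightarrow> \<alpha> i \<le> 2 * pi"
    and gap: "\<And>i j. \<lbrakk>i \<in> I; j \<in> I; i \<noteq> j\<rbrakk> \<Longrightarrow> 0 < Arg2pi (u j / u i) \<and> \<alpha> i \<le> Arg2pi (u j / u i)"
  shows "sum \<alpha> I \<le> 2 * pi"
proof (cases "I = {}")
  case False
  \<comment> \<open>The directions are sorted by their arguments in \<open>{0..<2 * pi}\<close>.\<close>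
  define \<theta> where "\<theta> = (\<lambda>i. Arg2pi (u i))"
  have gap': "\<alpha> i \<le> (if \<theta> i < \<theta> j then \<theta> j - \<theta> i else \<theta> j - \<theta> i + 2 * pi) \<and> \<theta> i \<noteq> \<theta> j"
    if ij: "i \<in> I" "j \<in> I" "i \<noteq> j" for i j
  proof (cases "\<theta> i \<le> \<theta> j")
    case True
    then have "Arg2pi (u j / u i) = \<theta> j - \<theta> i" using Arg2pi_divide u ij by (simp add: \<theta>_def)
    then show ?thesis using gap[OF ij] by simp
  next
    case False
    then have "Arg2pi (u i / u j) = \<theta> i - \<theta> j" using Arg2pi_divide u ij by (simp add: \<theta>_def)
    then have "Arg2pi (u j / u i) = 2 * pi - (\<theta> i - \<theta> j)"
      using Arg2pi_inverse[of "u i / u j"] gap[OF ij(2,1)] ij Arg2pi_eq_0_pi[of "u i / u j"]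
      by (auto split: if_splits)
    then show ?thesis using gap[OF ij] False by simp
  qed
  have inj: "inj_on \<theta> I" using gap' by (meson inj_onI)
  define T \<beta> where "T = \<theta> ` I" and "\<beta> = \<alpha> \<circ> inv_into I \<theta>"
  have \<beta>: "\<beta> (\<theta> i) = \<alpha> i" if "i \<in> I" for i using that inj by (simp add: \<beta>_def)
  have T: "finite T" "T \<noteq> {}" using I False by (auto simp: T_def)
  have "sum \<alpha> I = sum \<beta> T" unfolding T_def by (simp add: sum.reindex[OF inj] \<beta>)
  also have "\<dots> \<le> Max T + \<beta> (Max T) - Min T"
  proof (rule sum_gaps_le[OF T])
    fix s t assume "s \<in> T" "t \<in> T" "s < t"
    then obtain i j where "i \<in> I" "j \<in> I" "s = \<theta> i" "t = \<theta> j" by (auto simp: T_def)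
    with \<open>s < t\<close> show "\<beta> s \<le> t - s" using gap'[of i j] \<beta> by auto
  qed
  also have "\<dots> \<le> 2 * pi"
  proof -
    obtain i j where ij: "i \<in> I" "j \<in> I" "Max T = \<theta> i" "Min T = \<theta> j" using Max_in[OF T] Min_in[OF T] by (auto simp: T_def)
    have "\<theta> j \<le> \<theta> i" using ij T by (metis Min_le Max_in)
    show ?thesis
    proof (cases "i = j")
      case True then show ?thesis using less ij \<beta> by simp
    next
      case False then show ?thesis using gap'[of i j] ij \<beta> \<open>\<theta> j \<le> \<theta> i\<close> by simp
    qed
  qed
  finally show ?thesis .
qed simp

section \<open>Standard Lagrangian petal projections\<close>

text \<open>The projection of a Legendrian knot is an immersion: where \<open>x\<close> and \<open>y\<close> are stationary, the contact
  condition makes \<open>z\<close> stationary too.\<close>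

lemma legendrian_projection_regular:
  assumes "legendrian_knot \<gamma>"
  defines "p \<equiv> lagrangian_proj \<gamma>"
  shows "\<And>t. (p has_vector_derivative velocity p t) (at t)" "continuous_on UNIV (velocity p)"
    "\<And>t. velocity p t \<noteq> 0" "\<And>t. p (t + 1) = p t" "\<And>t. velocity p (t + 1) = velocity p t"
proof -
  obtain D where D: "D 0 = \<gamma>" "\<And>k t. (D k has_vector_derivative D (Suc k) t) (at t)"
    using assms(1) unfolding legendrian_knot_def knot_def smooth_curve_def by metis
  have vel: "velocity \<gamma> t = D 1 t" for t
    using vector_derivative_at D(2)[of 0 t] by (simp add: D(1))
  define T :: "real ^ 3 \<Rightarrow> complex" where "T = (\<lambda>v. Complex (v $ 1) (v $ 2))"
  have T: "bounded_linear T"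
    unfolding T_def linear_conv_bounded_linear[symmetric] by (rule linearI) (auto simp: complex_eq_iff)
  have p: "p = (\<lambda>t. T (\<gamma> t))" by (auto simp: p_def lagrangian_proj_def T_def)
  have der: "(p has_vector_derivative T (D 1 t)) (at t)" for t
    unfolding p using bounded_linear.has_vector_derivative[OF T] D(2)[of 0 t] by (simp add: D(1))
  then have vp: "velocity p t = T (D 1 t)" for t by (rule vector_derivative_at)
  show "(p has_vector_derivative velocity p t) (at t)" for t using der vp by simp
  have "continuous_on UNIV (D 1)"
    using D(2)[of 1] by (meson continuous_at_imp_continuous_on has_vector_derivative_continuous)
  then show "continuous_on UNIV (velocity p)"
    unfolding vp[abs_def] by (rule bounded_linear.continuous_on[OF T])
  show "velocity p t \<noteq> 0" for t
  proof
    assume "velocity p t = 0"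
    then have "D 1 t $ 1 = 0" "D 1 t $ 2 = 0" by (auto simp: vp T_def complex_eq_iff)
    moreover have "D 1 t $ 3 - \<gamma> t $ 2 * D 1 t $ 1 = 0"
      using assms(1) by (auto simp: legendrian_knot_def xi_std_def vel)
    ultimately have "D 1 t = 0" by (simp add: vec_eq_iff forall_3)
    then show False using assms(1) by (auto simp: legendrian_knot_def knot_def vel)
  qed
  show per: "p (t + 1) = p t" for t
    using assms(1) by (simp add: legendrian_knot_def knot_def p)
  show "velocity p (t + 1) = velocity p t" for t
  proof -
    have "((\<lambda>s. p (s + 1)) has_vector_derivative T (D 1 (t + 1))) (at t)"
    proof -
      have "((\<lambda>s. s + 1) has_vector_derivative 1) (at t)" by (auto intro!: derivative_eq_intros)
      from vector_diff_chain_at[OF this der] show ?thesis by (simp add: o_def)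
    qed
    then have "(p has_vector_derivative T (D 1 (t + 1))) (at t)" by (simp add: per)
    then show ?thesis unfolding vp by (metis vector_derivative_at vp)
  qed
qed

lemma det2_nonzero_imp_ratio_not_real:
  assumes "det2 z w \<noteq> 0"
  shows "w / z \<notin> \<real>" "z / w \<notin> \<real>"
proof -
  have "det2 z (of_real r * z) = 0" "det2 (of_real r * w) w = 0" for r
    by (simp_all add: det2_def algebra_simps)
  moreover have "z \<noteq> 0" "w \<noteq> 0" using assms by (auto simp: det2_def)
  ultimately show "w / z \<notin> \<real>" "z / w \<notin> \<real>"
    using assms by (auto elim!: Reals_cases simp: divide_eq_eq)
qed

text \<open>In this locale \<open>p\<close> is the Lagrangian projection and \<open>q\<close> the projection without its half-twists;
  \<open>v\<close> is the multi-crossing, and \<open>petal_image i\<close> is the curve traced by petal \<open>i\<close> of \<open>q\<close>.\<close>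

locale standard_petal_diagram =
  fixes \<gamma> :: "real \<Rightarrow> real ^ 3" and \<tau> :: "nat \<Rightarrow> real" and n :: nat
  assumes legendrian: "legendrian_knot \<gamma>"
    and standard: "standard_lagrangian_petal_projection \<gamma> \<tau> n"
    and ccw: "petals_counterclockwise \<gamma> \<tau> n"
begin

definition "p = lagrangian_proj \<gamma>"
definition "q = underlying_projection \<gamma> \<tau> n"
definition "twists = extra_crossings p \<tau> n"
definition "v = p (\<tau> 0)"
definition "petal_image i = path_image (petal q \<tau> i)"
definition "petal_twists i = {(a, b) \<in> twists. \<tau> i < a \<and> b < \<tau> (Suc i)}"

lemmas p_regular = legendrian_projection_regular[OF legendrian, folded p_def]
lemmas p_der = p_regular(1) and p_vel = p_regular(2) and p_nz = p_regular(3)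
  and p_per = p_regular(4) and p_vel_per = p_regular(5)

lemma p_cont: "continuous_on S p"
  using p_der by (meson continuous_at_imp_continuous_on has_vector_derivative_continuous)

lemma odd_n: "odd n" and n_pos: "0 < n"
  using standard by (auto simp: standard_lagrangian_petal_projection_def lagrangian_petal_projection_def odd_pos)

lemma multi: "multi_crossing p \<tau> n"
  using standard by (simp add: standard_lagrangian_petal_projection_def lagrangian_petal_projection_def p_def)

lemma \<tau>_step: "i < n \<Longrightarrow> \<tau> i < \<tau> (Suc i)" and \<tau>_n: "\<tau> n = \<tau> 0 + 1"
  using multi by (auto simp: multi_crossing_def)

lemma \<tau>_less: "i < j \<Longrightarrow> j \<le> n \<Longrightarrow> \<tau> i < \<tau> j"
proof (induction j)
  case (Suc j)
  show ?case
  proof (cases "i = j")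
    case False
    then have "\<tau> i < \<tau> j" using Suc by simp
    also have "\<tau> j < \<tau> (Suc j)" using \<tau>_step Suc by simp
    finally show ?thesis .
  qed (use \<tau>_step Suc in auto)
qed simp

lemma \<tau>_le: "i \<le> j \<Longrightarrow> j \<le> n \<Longrightarrow> \<tau> i \<le> \<tau> j"
  using \<tau>_less[of i j] by (cases "i = j") (auto simp: le_neq_implies_less less_imp_le)

lemma p_at_multicrossing: "i \<le> n \<Longrightarrow> p (\<tau> i) = v"
proof (cases "i = n")
  case True
  then show ?thesis using p_per[of "\<tau> 0"] by (simp only: \<tau>_n v_def)
next
  case False
  moreover assume "i \<le> n"
  ultimately have "i < n" by simp
  then show ?thesis using multi unfolding multi_crossing_def v_def by blast
qed

lemma not_multicrossing_time:
  assumes "i < n" "\<tau> i < t" "t < \<tau> (Suc i)" "j \<le> n"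
  shows "t \<noteq> \<tau> j"
  using \<tau>_le[of j i] \<tau>_le[of "Suc i" j] assms by (cases "j \<le> i") auto

lemma petal_unique:
  assumes "i < n" "\<tau> i < t" "t < \<tau> (Suc i)" "j < n" "\<tau> j < t" "t < \<tau> (Suc j)"
  shows "i = j"
  using \<tau>_le[of "Suc i" j] \<tau>_le[of "Suc j" i] assms by (cases i j rule: linorder_cases) auto

lemma \<tau>_bounds: "i < n \<Longrightarrow> \<tau> 0 \<le> \<tau> i" "i < n \<Longrightarrow> \<tau> (Suc i) \<le> \<tau> n"
  by (auto intro: \<tau>_le)

lemma locate:
  assumes "\<tau> 0 \<le> t" "t < \<tau> n"
  obtains i where "i < n" "\<tau> i \<le> t" "t < \<tau> (Suc i)"
proof -
  have "\<exists>i<m. \<tau> i \<le> t \<and> t < \<tau> (Suc i)" if "t < \<tau> m" "m \<le> n" for m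
    using that
  proof (induction m)
    case (Suc m)
    then show ?case by (cases "t < \<tau> m") (auto intro: less_SucI)
  qed (use assms in auto)
  from this[of n] assms that show thesis by auto
qed

lemma finite_twists: "finite twists"
  using standard by (simp add: standard_lagrangian_petal_projection_def lagrangian_petal_projection_def p_def twists_def)

lemma half_twist_of_twists: "h \<in> twists \<Longrightarrow> half_twist \<gamma> \<tau> n h"
  using standard by (simp add: standard_lagrangian_petal_projection_def lagrangian_petal_projection_def p_def twists_def)

lemma twist_in_petal:
  assumes "(a, b) \<in> twists"
  obtains i where "i < n" "\<tau> i < a" "a < b" "b < \<tau> (Suc i)"
  using half_twist_of_twists[OF assms] by (auto simp: half_twist_def)

lemma twists_memI:
  assumes "\<tau> 0 \<le> s" "s < t" "t < \<tau> n" "p s = p t" "s \<notin> \<tau> ` {..<n} \<or> t \<notin> \<tau> ` {..<n}"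
  shows "(s, t) \<in> twists"
  using assms by (auto simp: twists_def extra_crossings_def)

text \<open>A further passage through the multi-crossing would form an extra crossing with the time \<open>\<tau> 0\<close>;
  but both times of a half-twist lie strictly inside one petal.\<close>

lemma p_ne_v:
  assumes "i < n" "\<tau> i < t" "t < \<tau> (Suc i)"
  shows "p t \<noteq> v"
proof
  assume "p t = v"
  then have "(\<tau> 0, t) \<in> twists"
    using assms \<tau>_bounds[OF assms(1)] not_multicrossing_time[OF assms] by (intro twists_memI) (auto simp: v_def image_iff)
  then obtain j where "j < n" "\<tau> j < \<tau> 0" by (rule twist_in_petal)
  then show False using \<tau>_le[of 0 j] by simp
qed

lemma petal_self_crossing:
  assumes "i < n" "\<tau> i \<le> s" "s < t" "t \<le> \<tau> (Suc i)" "p s = p t"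
  shows "s = \<tau> i \<and> t = \<tau> (Suc i) \<or> (s, t) \<in> petal_twists i"
proof (cases "s = \<tau> i \<or> t = \<tau> (Suc i)")
  case True
  then have "p s = v" "p t = v" using p_at_multicrossing[of i] p_at_multicrossing[of "Suc i"] assms by auto
  then show ?thesis using p_ne_v[of i s] p_ne_v[of i t] assms True by fastforce
next
  case False
  then have "(s, t) \<in> twists"
    using assms \<tau>_bounds[OF assms(1)] not_multicrossing_time[of i s] by (intro twists_memI) (auto simp: image_iff)
  then show ?thesis using assms False by (auto simp: petal_twists_def)
qed

lemma distinct_petals_disjoint:
  assumes "i < n" "j < n" "i \<noteq> j" "\<tau> i < s" "s < \<tau> (Suc i)" "\<tau> j < t" "t < \<tau> (Suc j)"
  shows "p s \<noteq> p t"
proof -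
  have *: False if "i < n" "j < n" "i \<noteq> j" "\<tau> i < s" "s < \<tau> (Suc i)" "\<tau> j < t" "t < \<tau> (Suc j)" "s < t" "p s = p t" for i j s t
  proof -
    have "(s, t) \<in> twists" using that \<tau>_bounds[of i] \<tau>_bounds[of j] not_multicrossing_time[of i s] by (intro twists_memI) (auto simp: image_iff)
    then obtain m where "m < n" "\<tau> m < s" "s < t" "t < \<tau> (Suc m)" by (rule twist_in_petal)
    then show False using petal_unique[of i s m] petal_unique[of j t m] that by auto
  qed
  have "s \<noteq> t" using petal_unique[of i s j] assms by auto
  then show ?thesis using *[of i j s t] *[of j i t s] assms by (metis linorder_neqE)
qed

lemma petal_twists_cases:
  assumes "i < n"
  obtains "petal_twists i = {}" | a b where "petal_twists i = {(a, b)}" "\<tau> i < a" "a < b" "b < \<tau> (Suc i)" "p a = p b" "(a, b) \<in> twists"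
proof (cases "petal_twists i = {}")
  case False
  have "card (petal_twists i) \<le> 1"
    using standard assms unfolding standard_lagrangian_petal_projection_def petal_twists_def twists_def p_def by blast
  moreover have "finite (petal_twists i)" by (rule finite_subset[OF _ finite_twists]) (auto simp: petal_twists_def)
  ultimately have "card (petal_twists i) = 1" using False by (simp add: le_Suc_eq)
  then obtain h where "petal_twists i = {h}" using card_1_singletonE by blast
  then obtain a b where ab: "petal_twists i = {(a, b)}" by (cases h) auto
  then have "(a, b) \<in> twists" "\<tau> i < a" "b < \<tau> (Suc i)" unfolding petal_twists_def by auto
  then show thesis using that(2)[OF ab] by (auto simp: twists_def extra_crossings_def)
qed (rule that(1))

lemma q_eq:
  assumes "i < n" "\<tau> i \<le> t" "t \<le> \<tau> (Suc i)"
  shows "q t = p (Min (insert t {a. \<exists>b. (a, b) \<in> petal_twists i \<and> a < t \<and> t < b}))"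
proof -
  have "(a, b) \<in> twists \<and> a < t \<and> t < b \<longleftrightarrow> (a, b) \<in> petal_twists i \<and> a < t \<and> t < b" for a b
  proof
    assume *: "(a, b) \<in> twists \<and> a < t \<and> t < b"
    then obtain j where j: "j < n" "\<tau> j < a" "a < b" "b < \<tau> (Suc j)" by (metis twist_in_petal)
    then have "t \<noteq> \<tau> i" "t \<noteq> \<tau> (Suc i)" using * not_multicrossing_time[of j t i] not_multicrossing_time[of j t "Suc i"] assms by auto
    then have "j = i" using petal_unique[of j t i] j * assms by auto
    then show "(a, b) \<in> petal_twists i \<and> a < t \<and> t < b" using * j by (auto simp: petal_twists_def)
  qed (auto simp: petal_twists_def)
  then show ?thesis by (simp add: q_def underlying_projection_def untwist_def p_def twists_def)
qed

lemma q_untwisted: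
  assumes "i < n" "petal_twists i = {}" "\<tau> i \<le> t" "t \<le> \<tau> (Suc i)"
  shows "q t = p t"
  using q_eq[OF assms(1,3,4)] assms(2) by simp

lemma q_twisted:
  assumes "i < n" "petal_twists i = {(a, b)}" "\<tau> i \<le> t" "t \<le> \<tau> (Suc i)"
  shows "q t = cut_curl a b p t"
proof -
  have "{a'. \<exists>b'. (a', b') \<in> petal_twists i \<and> a' < t \<and> t < b'} = (if a < t \<and> t < b then {a} else {})"
    using assms(2) by auto
  then show ?thesis using q_eq[OF assms(1,3,4)] by (auto simp: cut_curl_def)
qed

lemma petal_q_cong:
  assumes "i < n" "\<And>t. \<tau> i \<le> t \<Longrightarrow> t \<le> \<tau> (Suc i) \<Longrightarrow> q t = h t" "0 \<le> t" "t \<le> 1"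
  shows "petal q \<tau> i t = subpath (\<tau> i) (\<tau> (Suc i)) h t"
proof -
  have "0 \<le> (\<tau> (Suc i) - \<tau> i) * t" "(\<tau> (Suc i) - \<tau> i) * t \<le> (\<tau> (Suc i) - \<tau> i) * 1"
    using \<tau>_step[OF assms(1)] assms(3,4) by (auto intro!: mult_left_mono simp del: mult_1_right)
  then show ?thesis using assms(2)[of "(\<tau> (Suc i) - \<tau> i) * t + \<tau> i"] by (simp add: petal_def subpath_def)
qed

lemma petal_image_eq: "i < n \<Longrightarrow> petal_image i = q ` {\<tau> i..\<tau> (Suc i)}"
  using \<tau>_step[of i] by (simp add: petal_image_def petal_def path_image_subpath)

lemma petal_image_untwisted: "i < n \<Longrightarrow> petal_twists i = {} \<Longrightarrow> petal_image i = p ` {\<tau> i..\<tau> (Suc i)}"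
  by (simp add: petal_image_eq q_untwisted cong: image_cong_simp)

lemma petal_image_twisted:
  assumes "i < n" "petal_twists i = {(a, b)}" "\<tau> i < a" "a < b" "b < \<tau> (Suc i)" "p a = p b"
  shows "petal_image i = p ` {\<tau> i..a} \<union> p ` {b..\<tau> (Suc i)}"
proof -
  have "petal_image i = cut_curl a b p ` {\<tau> i..\<tau> (Suc i)}"
    using q_twisted[OF assms(1,2)] by (simp add: petal_image_eq[OF assms(1)] cong: image_cong_simp)
  then show ?thesis using assms by (simp add: cut_curl_image)
qed

lemma petal_image_subset: "i < n \<Longrightarrow> petal_image i \<subseteq> p ` {\<tau> i..\<tau> (Suc i)}"
  by (rule petal_twists_cases[of i]) (auto simp: petal_image_untwisted petal_image_twisted)

lemma v_in_petal_image: "i < n \<Longrightarrow> v \<in> petal_image i"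
proof (rule petal_twists_cases[of i])
  assume i: "i < n"
  have v: "v = p (\<tau> i)" using p_at_multicrossing i by simp
  show "v \<in> petal_image i" if "petal_twists i = {}" using i v that \<tau>_step[OF i] by (auto simp: petal_image_untwisted)
  show "v \<in> petal_image i" if "petal_twists i = {(a, b)}" "\<tau> i < a" "a < b" "b < \<tau> (Suc i)" "p a = p b" for a b
    using i v that by (auto simp: petal_image_twisted)
qed

lemma path_petal: "i < n \<Longrightarrow> path (petal q \<tau> i)"
proof -
  assume i: "i < n"
  have "continuous_on {\<tau> i..\<tau> (Suc i)} q"
  proof (rule petal_twists_cases[OF i])
    assume "petal_twists i = {}"
    then show ?thesis by (intro continuous_on_eq[OF p_cont]) (simp add: q_untwisted[OF i])
  next
    fix a b assume ab: "petal_twists i = {(a, b)}" "\<tau> i < a" "a < b" "b < \<tau> (Suc i)" "p a = p b"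
    show ?thesis
      by (rule continuous_on_eq[OF continuous_on_cut_curl[OF p_cont]])
         (use ab in \<open>auto simp: q_twisted[OF i ab(1)]\<close>)
  qed
  then show ?thesis unfolding petal_def using \<tau>_step[OF i] by (intro path_subpath_Icc) auto
qed

lemma petal_ends:
  assumes i: "i < n"
  shows "q (\<tau> i) = v" "q (\<tau> (Suc i)) = v"
  using p_at_multicrossing[of i] p_at_multicrossing[of "Suc i"] i \<tau>_step[OF i]
  by (rule_tac petal_twists_cases[OF i]; auto simp: q_untwisted q_twisted cut_curl_def)+

lemma petal_winding_inside: "i < n \<Longrightarrow> w \<in> inside (petal_image i) \<Longrightarrow> winding_number (petal q \<tau> i) w = 1"
  using ccw by (auto simp: petals_counterclockwise_def petal_image_def q_def)

lemma petal_winding_outside: "i < n \<Longrightarrow> w \<in> outside (petal_image i) \<Longrightarrow> winding_number (petal q \<tau> i) w = 0"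
  using petal_ends[of i] path_petal[of i]
  by (intro winding_number_zero_in_outside) (auto simp: petal_image_def petal_def)

lemma petal_winding_cases:
  assumes "i < n" "w \<notin> petal_image i"
  shows "winding_number (petal q \<tau> i) w = 0 \<or> winding_number (petal q \<tau> i) w = 1"
    and "winding_number (petal q \<tau> i) w = 1 \<Longrightarrow> w \<in> inside (petal_image i)"
proof -
  have "w \<in> inside (petal_image i) \<or> w \<in> outside (petal_image i)" using assms(2) inside_Un_outside[of "petal_image i"] by blast
  then show "winding_number (petal q \<tau> i) w = 0 \<or> winding_number (petal q \<tau> i) w = 1"
    "winding_number (petal q \<tau> i) w = 1 \<Longrightarrow> w \<in> inside (petal_image i)"
    using petal_winding_inside petal_winding_outside assms(1) by fastforce+
qed

text \<open>The curve \<open>petal q \<tau> i\<close> itself is not a simple path if it rests, so a twisted petal is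
  reparametrised as a join of the two arcs outside the curl.\<close>

lemma petal_simple_loop:
  assumes i: "i < n"
  obtains c where "simple_path c" "pathfinish c = pathstart c" "path_image c = petal_image i"
proof (rule petal_twists_cases[OF i])
  let ?c = "subpath (\<tau> i) (\<tau> (Suc i)) p"
  assume "petal_twists i = {}"
  moreover have "simple_path ?c"
    unfolding simple_path_subpath_eq
    using \<tau>_step[OF i] petal_self_crossing[OF i] \<open>petal_twists i = {}\<close>
    by (auto simp: closed_segment_eq_real_ivl intro!: path_subpath_Icc p_cont) (metis linorder_neqE)+
  ultimately show thesis
    using that[of ?c] p_at_multicrossing[of i] p_at_multicrossing[of "Suc i"] i \<tau>_step[OF i] by (simp add: path_image_subpath petal_image_untwisted)
next
  fix a b assume ab: "petal_twists i = {(a, b)}" "\<tau> i < a" "a < b" "b < \<tau> (Suc i)" "p a = p b"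
  note cr = petal_self_crossing[OF i, unfolded ab(1)]
  let ?c1 = "subpath b (\<tau> (Suc i)) p" and ?c2 = "subpath (\<tau> i) a p"
  have ends: "p (\<tau> i) = p (\<tau> (Suc i))" using p_at_multicrossing[of i] p_at_multicrossing[of "Suc i"] i by simp
  have "simple_path (?c1 +++ ?c2)"
  proof (rule simple_path_join_loop)
    have "p s \<noteq> p t" if "\<tau> i \<le> s" "s < t" "t \<le> \<tau> (Suc i)" "t \<le> a \<or> b \<le> s" for s t
      using cr[OF that(1-3)] that ab(2-4) by auto
    then have "inj_on p {b..\<tau> (Suc i)}" "inj_on p {\<tau> i..a}"
      using ab(2-4) by (intro linorder_inj_onI'; simp)+
    then show "arc ?c1" "arc ?c2"
      using ab by (auto simp: arc_subpath_eq closed_segment_eq_real_ivl intro!: path_subpath_Icc p_cont)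
    show "path_image ?c1 \<inter> path_image ?c2 \<subseteq> {pathstart ?c1, pathstart ?c2}"
    proof
      fix z assume "z \<in> path_image ?c1 \<inter> path_image ?c2"
      then obtain s t where "s \<in> {\<tau> i..a}" "t \<in> {b..\<tau> (Suc i)}" "z = p s" "z = p t" using ab by (auto simp: path_image_subpath)
      then show "z \<in> {pathstart ?c1, pathstart ?c2}" using cr[of s t] ab by auto
    qed
  qed (use ends ab in auto)
  moreover have "path_image (?c1 +++ ?c2) = petal_image i"
    using ab ends by (subst path_image_join) (auto simp: path_image_subpath petal_image_twisted[OF i ab])
  moreover have "pathfinish (?c1 +++ ?c2) = pathstart (?c1 +++ ?c2)" using ab by simp
  ultimately show thesis using that by blast
qed

lemma compact_petal_image: "i < n \<Longrightarrow> compact (petal_image i)"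
  unfolding petal_image_def by (intro compact_path_image path_petal)

lemma petal_interior_disjoint_petal_image:
  assumes "i < n" "j < n" "i \<noteq> j"
  shows "p ` {\<tau> j<..<\<tau> (Suc j)} \<inter> petal_image i = {}"
proof -
  have "p t \<notin> petal_image i" if t: "\<tau> j < t" "t < \<tau> (Suc j)" for t
  proof
    assume "p t \<in> petal_image i"
    then obtain s where s: "s \<in> {\<tau> i..\<tau> (Suc i)}" "p t = p s" using petal_image_subset[OF assms(1)] by auto
    show False
    proof (cases "s = \<tau> i \<or> s = \<tau> (Suc i)")
      case True
      then show False using p_at_multicrossing[of i] p_at_multicrossing[of "Suc i"] p_ne_v[OF assms(2) t] s assms by auto
    next
      case False
      then show False using distinct_petals_disjoint[of i j s t] s t assms by auto
    qed
  qed
  then show ?thesis by auto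
qed

text \<open>Petals meet only in \<open>v\<close>, so a petal that is not outside another one lies inside it apart from
  \<open>v\<close>, and then so does everything that it encloses; this would be a nesting.\<close>

lemma other_petal_outside:
  assumes "i < n" "j < n" "i \<noteq> j"
  shows "p ` {\<tau> j<..<\<tau> (Suc j)} \<subseteq> outside (petal_image i)"
proof (rule ccontr)
  let ?S = "p ` {\<tau> j<..<\<tau> (Suc j)}"
  assume "\<not> ?S \<subseteq> outside (petal_image i)"
  then obtain z where z: "z \<in> ?S" "z \<notin> outside (petal_image i)" by blast
  have disj: "?S \<inter> petal_image i = {}" by (rule petal_interior_disjoint_petal_image[OF assms])
  then have "z \<in> inside (petal_image i)" using z inside_Un_outside[of "petal_image i"] by blast
  moreover have "connected ?S" by (intro connected_continuous_image p_cont) simp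
  ultimately have S: "?S \<subseteq> inside (petal_image i)" using connected_subset_inside disj z by blast
  have "petal_image j \<subseteq> petal_image i \<union> inside (petal_image i)"
  proof
    fix z assume "z \<in> petal_image j"
    then obtain t where t: "t \<in> {\<tau> j..\<tau> (Suc j)}" "z = p t" using petal_image_subset[OF assms(2)] by auto
    show "z \<in> petal_image i \<union> inside (petal_image i)"
    proof (cases "t = \<tau> j \<or> t = \<tau> (Suc j)")
      case True
      then have "z = v" using p_at_multicrossing[of j] p_at_multicrossing[of "Suc j"] t assms by auto
      then show ?thesis using v_in_petal_image assms by auto
    next
      case False
      then have "z \<in> ?S" using t by auto
      then show ?thesis using S by blast
    qed
  qed
  moreover obtain c where c: "simple_path c" "pathfinish c = pathstart c" "path_image c = petal_image i"
    using petal_simple_loop[OF assms(1)] by blast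
  ultimately have "inside (petal_image j) \<subseteq> inside (petal_image i)"
    using inside_nested_loops[OF c(1,2) compact_imp_closed[OF compact_petal_image[OF assms(2)]]] by simp
  moreover have "petal_projection q \<tau> n"
    using standard by (simp add: standard_lagrangian_petal_projection_def lagrangian_petal_projection_def q_def)
  ultimately show False using assms by (auto simp: petal_projection_def petal_image_def)
qed

lemma curl_avoids_rest:
  assumes "(a, b) \<in> twists" "\<tau> 0 \<le> t" "t \<le> \<tau> n" "t \<notin> {a..b}"
  shows "p t \<notin> inside (p ` {a..b})"
  using half_twist_of_twists[OF assms(1)] assms(2-4) by (auto simp: half_twist_def p_def)

text \<open>The curl of a half-twist does not wind around \<open>v\<close>, which is a point of the rest of the diagram.
  Near \<open>v\<close> the petal may therefore be replaced by the original arc of \<open>p\<close>, which is smooth up to its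
  corner.\<close>

lemma winding_near_multicrossing:
  assumes i: "i < n"
  obtains \<epsilon> where "0 < \<epsilon>" "\<And>w. \<lbrakk>w \<in> ball v \<epsilon>; w \<notin> p ` {\<tau> i..\<tau> (Suc i)}\<rbrakk> \<Longrightarrow>
     winding_number (subpath (\<tau> i) (\<tau> (Suc i)) p) w = winding_number (petal q \<tau> i) w"
proof (rule petal_twists_cases[OF i])
  assume "petal_twists i = {}"
  then have "winding_number (subpath (\<tau> i) (\<tau> (Suc i)) p) w = winding_number (petal q \<tau> i) w" for w
    by (intro winding_number_cong) (simp add: petal_q_cong[OF i] q_untwisted[OF i])
  then show thesis using that[of 1] by simp
next
  fix a b assume ab: "petal_twists i = {(a, b)}" "\<tau> i < a" "a < b" "b < \<tau> (Suc i)" "p a = p b" "(a, b) \<in> twists"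
  let ?K = "p ` {a..b}"
  have "v \<notin> ?K"
  proof
    assume "v \<in> ?K"
    then obtain t where "a \<le> t" "t \<le> b" "v = p t" by auto
    then show False using p_ne_v[OF i, of t] ab(2,4) by simp
  qed
  moreover have "v \<notin> inside ?K"
    using curl_avoids_rest[OF ab(6), of "\<tau> i"] p_at_multicrossing[of i] i \<tau>_bounds[OF i] \<tau>_step[OF i] ab by auto
  ultimately have "v \<in> outside ?K" using inside_Un_outside[of ?K] by blast
  moreover have "compact ?K" by (intro compact_continuous_image p_cont) simp
  then have "open (outside ?K)" by (intro open_outside compact_imp_closed)
  ultimately obtain \<epsilon> where \<epsilon>: "0 < \<epsilon>" "ball v \<epsilon> \<subseteq> outside ?K" using open_contains_ball by blast
  show thesis
  proof (rule that[OF \<epsilon>(1)])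
    fix w assume w: "w \<in> ball v \<epsilon>" "w \<notin> p ` {\<tau> i..\<tau> (Suc i)}"
    have "winding_number (subpath a b p) w = 0"
      by (rule winding_number_zero_in_outside)
         (use ab w \<epsilon> in \<open>auto simp: path_image_subpath intro!: path_subpath_Icc p_cont\<close>)
    moreover have "winding_number (subpath (\<tau> i) (\<tau> (Suc i)) (cut_curl a b p)) w = winding_number (petal q \<tau> i) w"
      using petal_q_cong[OF i q_twisted[OF i ab(1)]] by (intro winding_number_cong) simp
    ultimately show "winding_number (subpath (\<tau> i) (\<tau> (Suc i)) p) w = winding_number (petal q \<tau> i) w"
      using winding_number_cut_curl[OF p_cont, where x = "\<tau> i" and y = "\<tau> (Suc i)" and a = a and b = b and w = w] ab w by simp
  qed
qed

abbreviation "p' \<equiv> velocity p"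

text \<open>The interior angle of petal \<open>i\<close> at the multi-crossing, from its outgoing branch counterclockwise
  to its reversed incoming branch.\<close>

definition "petal_angle i = Arg2pi (- p' (\<tau> (Suc i)) / p' (\<tau> i))"

lemma p_secant:
  obtains \<sigma> where "\<And>t. \<sigma> t t = p' t" "\<And>s t. p t - p s = of_real (t - s) * \<sigma> s t"
    "\<And>(S :: real set) s h. continuous_on S h \<Longrightarrow> continuous_on S (\<lambda>t. \<sigma> s (h t))"
proof -
  obtain \<sigma> where \<sigma>: "continuous_on UNIV (\<lambda>(s, t). \<sigma> s t)" "\<And>t. \<sigma> t t = p' t"
    "\<And>s t. p t - p s = of_real (t - s) * \<sigma> s t"
    using secant_slope[OF p_der p_vel] by metis
  have "continuous_on S (\<lambda>t. \<sigma> s (h t))" if "continuous_on S h" for S :: "real set" and s h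
  proof -
    have "continuous_on S (\<lambda>t. (s, h t))" by (intro continuous_intros that)
    from continuous_on_compose2[OF \<sigma>(1) this] show ?thesis by simp
  qed
  then show thesis by (rule that[OF \<sigma>(2,3)])
qed

lemma strands_transverse:
  assumes "i < n" "j < n" "i \<noteq> j"
  shows "det2 (p' (\<tau> i)) (p' (\<tau> j)) \<noteq> 0"
  using multi assms unfolding multi_crossing_def by blast

text \<open>A petal does not end with a cusp.  For a single petal both ends have the same velocity by
  periodicity; otherwise the two strands are transverse.\<close>

lemma petal_ends_ratio:
  assumes i: "i < n"
  shows "p' (\<tau> i) / p' (\<tau> (Suc i)) \<notin> \<real>\<^sub>\<le>\<^sub>0"
proof -
  have *: ?thesis if "det2 (p' (\<tau> i)) (p' (\<tau> (Suc i))) \<noteq> 0"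
    using det2_nonzero_imp_ratio_not_real(2)[OF that] nonpos_Reals_Real by blast
  consider "Suc i < n" | "Suc i = n" "i = 0" | "Suc i = n" "i \<noteq> 0" using i by linarith
  then show ?thesis
  proof cases
    case 1 then show ?thesis using strands_transverse[of i "Suc i"] i by (intro *) auto
  next
    case 2
    then have "p' (\<tau> (Suc i)) = p' (\<tau> i)" using p_vel_per[of "\<tau> 0"] by (simp add: \<tau>_n)
    then show ?thesis using p_nz by simp
  next
    case 3
    then have "p' (\<tau> (Suc i)) = p' (\<tau> 0)" using p_vel_per[of "\<tau> 0"] by (simp add: \<tau>_n)
    then show ?thesis using strands_transverse[of i 0] i 3 by (intro *) auto
  qed
qed

lemma petal_angle_pos: "i < n \<Longrightarrow> 0 < petal_angle i" and petal_angle_less: "petal_angle i < 2 * pi"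
proof -
  show "petal_angle i < 2 * pi" using Arg2pi by (auto simp: petal_angle_def)
  assume i: "i < n"
  have "- p' (\<tau> (Suc i)) / p' (\<tau> i) \<notin> \<real>\<^sub>\<ge>\<^sub>0"
  proof
    assume "- p' (\<tau> (Suc i)) / p' (\<tau> i) \<in> \<real>\<^sub>\<ge>\<^sub>0"
    then have "p' (\<tau> (Suc i)) / p' (\<tau> i) \<in> \<real>\<^sub>\<le>\<^sub>0" by (metis minus_divide_left minus_minus uminus_nonneg_Reals_iff)
    then have "inverse (p' (\<tau> (Suc i)) / p' (\<tau> i)) \<in> \<real>\<^sub>\<le>\<^sub>0" by (simp only: nonpos_Reals_inverse_iff)
    then show False using petal_ends_ratio[OF i] by simp
  qed
  then have "petal_angle i \<noteq> 0" by (auto simp: petal_angle_def Arg2pi_eq_0 complex_nonneg_Reals_iff complex_is_Real_iff)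
  then show "0 < petal_angle i" using Arg2pi_ge_0 by (simp add: petal_angle_def order_less_le)
qed

lemma petal_corner:
  assumes i: "i < n"
  defines "g \<equiv> subpath (\<tau> i) (\<tau> (Suc i)) p"
  obtains l where "continuous_on {0..1} l" "\<And>t. t \<in> {0..1} \<Longrightarrow> g t = v + of_real (t * (1 - t)) * exp (l t)"
    "Im (l 1 - l 0) = petal_angle i"
    "\<And>w D. \<lbrakk>continuous_on {0..1} D; \<And>r. r \<in> {0..1} \<Longrightarrow> w r = v + of_real r * D r; D 0 \<noteq> 0;
       0 < Arg2pi (D 0 / p' (\<tau> i)); Arg2pi (D 0 / p' (\<tau> i)) < petal_angle i\<rbrakk> \<Longrightarrow>
       \<exists>r0>0. r0 \<le> 1 \<and> (\<forall>r. 0 < r \<and> r < r0 \<longrightarrow> w r \<notin> path_image g \<and> winding_number g (w r) = 1)"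
proof -
  let ?x = "\<tau> i" and ?y = "\<tau> (Suc i)"
  define d where "d = ?y - ?x"
  have d: "0 < d" using \<tau>_step[OF i] by (simp add: d_def)
  have g: "g t = p (d * t + ?x)" for t by (simp add: g_def subpath_def d_def)
  have ends: "p ?x = v" "p ?y = v" using p_at_multicrossing[of i] p_at_multicrossing[of "Suc i"] i by auto
  obtain \<sigma> where \<sigma>: "\<And>t. \<sigma> t t = p' t" "\<And>s t. p t - p s = of_real (t - s) * \<sigma> s t"
    and \<sigma>c: "\<And>(S :: real set) s h. continuous_on S h \<Longrightarrow> continuous_on S (\<lambda>t. \<sigma> s (h t))"
    using p_secant by blast
  define F E where "F = (\<lambda>t. of_real d * \<sigma> ?x (d * t + ?x))" and "E = (\<lambda>t. - (of_real d * \<sigma> ?y (d * t + ?x)))"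
  have gF: "g t = v + of_real t * F t" for t
    using \<sigma>(2)[of "d * t + ?x" ?x] ends by (simp add: g F_def algebra_simps)
  have gE: "g t = v + of_real (1 - t) * E t" for t
  proof -
    have "d * t + ?x - ?y = - (d * (1 - t))" by (simp add: d_def algebra_simps)
    then have "p (d * t + ?x) - p ?y = of_real (- (d * (1 - t))) * \<sigma> ?y (d * t + ?x)" using \<sigma>(2)[of "d * t + ?x" ?y] by simp
    then show ?thesis using ends by (simp add: g E_def algebra_simps)
  qed
  have F0: "F 0 = of_real d * p' ?x" and E1: "E 1 = of_real d * - p' ?y"
    by (simp_all add: F_def E_def \<sigma> d_def)
  obtain l where l: "continuous_on {0..1} l" "\<And>t. t \<in> {0..1} \<Longrightarrow> g t = v + of_real (t * (1 - t)) * exp (l t)"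
    "exp (l 0) = F 0" "exp (l 1) = E 1"
  proof (rule log_of_cornered_loop[of F g v E])
    show "continuous_on {0..1/2} F" "continuous_on {1/2..1} E"
      unfolding F_def E_def by (intro continuous_intros \<sigma>c)+
    show "F 0 \<noteq> 0" "E 1 \<noteq> 0" using d p_nz by (auto simp: F0 E1)
    fix t :: real assume t: "0 < t" "t < 1"
    then have "0 < d * t" "d * t < d * 1" using d by (simp_all del: mult_1_right)
    then show "g t \<noteq> v" unfolding g by (intro p_ne_v[OF i]) (auto simp: d_def)
  qed (use gF gE in auto)
  have ratio: "exp (l 1) / exp (l 0) = - p' ?y / p' ?x" using d by (simp add: l F0 E1)
  have petal_angle: "Arg2pi (exp (l 1) / exp (l 0)) = petal_angle i" by (simp add: petal_angle_def ratio)
  have D0: "Arg2pi (z / exp (l 0)) = Arg2pi (z / p' ?x)" for z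
  proof -
    have "z / exp (l 0) = (z / p' ?x) / of_real d" by (simp add: l F0)
    then show ?thesis using d by (simp only: Arg2pi_divide_of_real)
  qed
  obtain \<epsilon> where \<epsilon>: "0 < \<epsilon>" "\<And>w. \<lbrakk>w \<in> ball v \<epsilon>; w \<notin> p ` {?x..?y}\<rbrakk> \<Longrightarrow>
     winding_number g w = winding_number (petal q \<tau> i) w"
    using winding_near_multicrossing[OF i] unfolding g_def by blast
  have img: "path_image g = p ` {?x..?y}" using \<tau>_step[OF i] by (simp add: g_def path_image_subpath)
  have wn: "winding_number g w = 0 \<or> winding_number g w = 1" if "w \<in> ball v \<epsilon>" "w \<notin> path_image g" for w
    using \<epsilon>(2)[of w] petal_winding_cases(1)[OF i, of w] petal_image_subset[OF i] that by (auto simp: img)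
  have pos: "0 < Arg2pi (exp (l 1) / exp (l 0))" using petal_angle petal_angle_pos[OF i] by simp
  note sector = interior_sector_of_corner[OF l(1,2) \<epsilon>(1) wn pos]
  show thesis
  proof (rule that[OF l(1,2)])
    show "Im (l 1 - l 0) = petal_angle i" using sector(1) petal_angle by simp
    fix w D
    assume A: "continuous_on {0..1} D" "\<And>r. r \<in> {0..1} \<Longrightarrow> w r = v + of_real r * D r" "D 0 \<noteq> 0"
      "0 < Arg2pi (D 0 / p' ?x)" "Arg2pi (D 0 / p' ?x) < petal_angle i"
    show "\<exists>r0>0. r0 \<le> 1 \<and> (\<forall>r. 0 < r \<and> r < r0 \<longrightarrow> w r \<notin> path_image g \<and> winding_number g (w r) = 1)"
    proof (rule sector(2)[OF _ _ _ A(1-3)])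
      show "0 < Arg2pi (D 0 / exp (l 0))" using A(4) by (simp only: D0)
      show "Arg2pi (D 0 / exp (l 0)) < Arg2pi (exp (l 1) / exp (l 0))" unfolding petal_angle using A(5) by (simp only: D0)
    qed auto
  qed
qed

text \<open>Points of petal \<open>j\<close> shortly after \<open>\<tau> j\<close> are outside petal \<open>i\<close>, whereas near \<open>v\<close> the open sector of
  petal \<open>i\<close> is inside it.\<close>

lemma strand_outside_sector:
  assumes ij: "i < n" "j < n" "i \<noteq> j"
  shows "0 < Arg2pi (p' (\<tau> j) / p' (\<tau> i))" "petal_angle i \<le> Arg2pi (p' (\<tau> j) / p' (\<tau> i))"
proof -
  have "p' (\<tau> j) / p' (\<tau> i) \<notin> \<real>" using det2_nonzero_imp_ratio_not_real(1)[OF strands_transverse[OF ij]] .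
  then show pos: "0 < Arg2pi (p' (\<tau> j) / p' (\<tau> i))"
    using Arg2pi_eq_0 Arg2pi_ge_0 by (metis order_less_le)
  let ?g = "subpath (\<tau> i) (\<tau> (Suc i)) p"
  obtain l where sector: "\<And>w D. \<lbrakk>continuous_on {0..1} D; \<And>r. r \<in> {0..1} \<Longrightarrow> w r = v + of_real r * D r; D 0 \<noteq> 0;
       0 < Arg2pi (D 0 / p' (\<tau> i)); Arg2pi (D 0 / p' (\<tau> i)) < petal_angle i\<rbrakk> \<Longrightarrow>
       \<exists>r0>0. r0 \<le> 1 \<and> (\<forall>r. 0 < r \<and> r < r0 \<longrightarrow> w r \<notin> path_image ?g \<and> winding_number ?g (w r) = 1)"
    using petal_corner[OF ij(1)] by blast
  obtain \<sigma> where \<sigma>: "\<And>t. \<sigma> t t = p' t" "\<And>s t. p t - p s = of_real (t - s) * \<sigma> s t"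
    and \<sigma>c: "\<And>(S :: real set) s h. continuous_on S h \<Longrightarrow> continuous_on S (\<lambda>t. \<sigma> s (h t))"
    using p_secant by blast
  show "petal_angle i \<le> Arg2pi (p' (\<tau> j) / p' (\<tau> i))"
  proof (rule ccontr)
    assume less: "\<not> petal_angle i \<le> Arg2pi (p' (\<tau> j) / p' (\<tau> i))"
    have "\<exists>r0>0. r0 \<le> 1 \<and> (\<forall>r. 0 < r \<and> r < r0 \<longrightarrow> p (\<tau> j + r) \<notin> path_image ?g \<and> winding_number ?g (p (\<tau> j + r)) = 1)"
    proof (rule sector)
      show "continuous_on {0..1} (\<lambda>r. \<sigma> (\<tau> j) (\<tau> j + r))"
        by (intro \<sigma>c continuous_intros)
      show "p (\<tau> j + r) = v + of_real r * \<sigma> (\<tau> j) (\<tau> j + r)" for r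
        using \<sigma>(2)[of "\<tau> j + r" "\<tau> j"] p_at_multicrossing[of j] ij by (simp add: algebra_simps)
    qed (use p_nz pos less in \<open>simp_all add: \<sigma>\<close>)
    then obtain r0 where r0: "0 < r0"
      "\<And>r. \<lbrakk>0 < r; r < r0\<rbrakk> \<Longrightarrow> p (\<tau> j + r) \<notin> path_image ?g \<and> winding_number ?g (p (\<tau> j + r)) = 1" by blast
    obtain \<epsilon> where \<epsilon>: "0 < \<epsilon>" "\<And>w. \<lbrakk>w \<in> ball v \<epsilon>; w \<notin> p ` {\<tau> i..\<tau> (Suc i)}\<rbrakk> \<Longrightarrow>
       winding_number ?g w = winding_number (petal q \<tau> i) w"
      using winding_near_multicrossing[OF ij(1)] by blast
    have "isCont p (\<tau> j)" using p_cont[of UNIV] by (simp add: continuous_on_eq_continuous_at)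
    then obtain \<delta> where \<delta>: "0 < \<delta>" "\<And>t. dist t (\<tau> j) < \<delta> \<Longrightarrow> dist (p t) (p (\<tau> j)) < \<epsilon>"
      unfolding continuous_at_eps_delta dist_real_def using \<epsilon>(1) by (metis dist_real_def)
    define r where "r = min (min r0 \<delta>) (\<tau> (Suc j) - \<tau> j) / 2"
    have r: "0 < r" "r < r0" "r < \<delta>" "\<tau> j + r < \<tau> (Suc j)"
      using r0(1) \<delta>(1) \<tau>_step[OF ij(2)] by (auto simp: r_def min_def field_simps)
    let ?w = "p (\<tau> j + r)"
    have "?w \<in> ball v \<epsilon>" using \<delta>(2)[of "\<tau> j + r"] r p_at_multicrossing[of j] ij by (simp add: dist_commute dist_real_def)
    moreover have "?w \<notin> p ` {\<tau> i..\<tau> (Suc i)}" using r0(2)[OF r(1,2)] \<tau>_step[OF ij(1)] by (simp add: path_image_subpath)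
    ultimately have "winding_number (petal q \<tau> i) ?w = 1" using \<epsilon>(2) r0(2)[OF r(1,2)] by metis
    moreover have "?w \<in> outside (petal_image i)"
      using other_petal_outside[OF ij] r by (auto simp: image_subset_iff)
    ultimately show False using petal_winding_outside[OF ij(1)] by fastforce
  qed
qed

lemma sum_petal_angle: "0 < (\<Sum>i<n. petal_angle i)" "(\<Sum>i<n. petal_angle i) \<le> 2 * pi"
proof -
  show "0 < (\<Sum>i<n. petal_angle i)" using n_pos petal_angle_pos by (intro sum_pos) auto
  show "(\<Sum>i<n. petal_angle i) \<le> 2 * pi"
    by (rule sum_angles_to_next_direction_le[where u = "\<lambda>i. p' (\<tau> i)"])
       (use p_nz petal_angle_less strand_outside_sector in \<open>auto intro: less_imp_le\<close>)
qed

lemma range_p: "range p = p ` {\<tau> 0..<\<tau> n}"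
proof -
  have per: "p (t + of_nat m) = p t" for t and m :: nat
  proof (induction m)
    case (Suc m)
    have "p (t + of_nat (Suc m)) = p ((t + of_nat m) + 1)" by (simp add: algebra_simps)
    then show ?case using Suc p_per by simp
  qed simp
  have per_int: "p (t + of_int m) = p t" for t and m :: int
  proof (cases "0 \<le> m")
    case True
    then show ?thesis using per[of t "nat m"] by simp
  next
    case False
    then show ?thesis using per[of "t + of_int m" "nat (- m)"] by simp
  qed
  have "p t \<in> p ` {\<tau> 0..<\<tau> n}" for t
  proof -
    let ?s = "t + of_int (- \<lfloor>t - \<tau> 0\<rfloor>)"
    have "?s \<in> {\<tau> 0..<\<tau> n}" unfolding \<tau>_n atLeastLessThan_iff by (simp, linarith)
    then show ?thesis using per_int[of t "- \<lfloor>t - \<tau> 0\<rfloor>"] by (metis imageI)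
  qed
  then show ?thesis by auto
qed

text \<open>At the crossing \<open>P\<close> of a half-twist the petal without its curl has a corner with outgoing branch
  \<open>p' b\<close> and reversed incoming branch \<open>- p' a\<close>.  If the determinant were negative, the initial
  direction \<open>p' a\<close> of the curl would lie in the interior sector of this corner.  The curl would then
  run inside the petal, and the region enclosed by it would be encircled by the region that
  remains between petal and curl.\<close>

lemma curl_turns_left:
  assumes i: "i < n" and ab: "petal_twists i = {(a, b)}" "\<tau> i < a" "a < b" "b < \<tau> (Suc i)" "p a = p b" "(a, b) \<in> twists"
  shows "0 < det2 (p' a) (p' b)"
proof (rule ccontr)
  let ?x = "\<tau> i" and ?y = "\<tau> (Suc i)" and ?K = "p ` {a..b}"
  assume "\<not> 0 < det2 (p' a) (p' b)"
  moreover have "det2 (p' a) (p' b) \<noteq> 0"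
    using half_twist_of_twists[OF ab(6)] by (auto simp: half_twist_def crossing_sign_def p_def)
  ultimately have neg: "det2 (p' a) (p' b) < 0" by simp
  \<comment> \<open>The petal without its curl, started at the crossing.\<close>
  define g where "g = subpath b ?y p +++ subpath ?x a p"
  define P where "P = p a"
  have petal_image: "petal_image i = p ` {?x..a} \<union> p ` {b..?y}" using petal_image_twisted[OF i ab(1-5)] .
  have ends: "p ?x = p ?y" using p_at_multicrossing[of i] p_at_multicrossing[of "Suc i"] i by simp
  note cr = petal_self_crossing[OF i, unfolded ab(1)]
  obtain \<sigma> where \<sigma>: "\<And>t. \<sigma> t t = p' t" "\<And>s t. p t - p s = of_real (t - s) * \<sigma> s t"
    and \<sigma>c: "\<And>(S :: real set) s h. continuous_on S h \<Longrightarrow> continuous_on S (\<lambda>t. \<sigma> s (h t))"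
    using p_secant by blast
  have g_first: "g t = p ((?y - b) * (2 * t) + b)" if "t \<le> 1/2" for t
    using that by (simp add: g_def joinpaths_def subpath_def)
  have g_second: "g t = p ((a - ?x) * (2 * t - 1) + ?x)" if "1/2 \<le> t" for t
  proof (cases "t = 1/2")
    case True
    show ?thesis unfolding True using ends by (simp add: g_def joinpaths_def subpath_def)
  next
    case False
    then show ?thesis using that by (simp add: g_def joinpaths_def subpath_def)
  qed
  define F E where "F = (\<lambda>t. of_real (2 * (?y - b)) * \<sigma> b ((?y - b) * (2 * t) + b))"
    and "E = (\<lambda>t. - (of_real (2 * (a - ?x)) * \<sigma> a ((a - ?x) * (2 * t - 1) + ?x)))"
  have gF: "g t = P + of_real t * F t" if "t \<le> 1/2" for t
    using \<sigma>(2)[of "(?y - b) * (2 * t) + b" b] g_first[OF that] ab(5) by (simp add: F_def P_def algebra_simps)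
  have gE: "g t = P + of_real (1 - t) * E t" if "1/2 \<le> t" for t
  proof -
    have "(a - ?x) * (2 * t - 1) + ?x - a = - (2 * (a - ?x) * (1 - t))" by (simp add: algebra_simps)
    then have "g t - p a = of_real (- (2 * (a - ?x) * (1 - t))) * \<sigma> a ((a - ?x) * (2 * t - 1) + ?x)"
      using \<sigma>(2)[of "(a - ?x) * (2 * t - 1) + ?x" a] g_second[OF that] by simp
    then show ?thesis by (simp add: E_def P_def algebra_simps)
  qed
  have F0: "F 0 = of_real (2 * (?y - b)) * p' b" and E1: "E 1 = - (of_real (2 * (a - ?x)) * p' a)"
    by (simp_all add: F_def E_def \<sigma>)
  have scale: "0 < 2 * (?y - b)" "0 < 2 * (a - ?x)" using ab by auto
  obtain l where l: "continuous_on {0..1} l" "\<And>t. t \<in> {0..1} \<Longrightarrow> g t = P + of_real (t * (1 - t)) * exp (l t)"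
    "exp (l 0) = F 0" "exp (l 1) = E 1"
  proof (rule log_of_cornered_loop[of F g P E])
    show "continuous_on {0..1/2} F" "continuous_on {1/2..1} E"
      unfolding F_def E_def by (intro continuous_intros \<sigma>c)+
    show "F 0 \<noteq> 0" "E 1 \<noteq> 0" using scale p_nz by (auto simp: F0 E1)
    fix t :: real assume t: "0 < t" "t < 1"
    show "g t \<noteq> P"
    proof (cases "t \<le> 1/2")
      case True
      have "0 < (?y - b) * (2 * t)" "(?y - b) * (2 * t) \<le> ?y - b"
        using t True ab(4) mult_left_mono[of "2 * t" 1 "?y - b"] by auto
      then have "b < (?y - b) * (2 * t) + b" "(?y - b) * (2 * t) + b \<le> ?y" by linarith+
      then show ?thesis unfolding g_first[OF True] P_def
        using cr[of a "(?y - b) * (2 * t) + b"] ab(2-4) by (metis less_imp_le less_trans order_less_irrefl prod.inject singletonD)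
    next
      case False
      then have "0 < (a - ?x) * (2 * t - 1)" "(a - ?x) * (2 * t - 1) < a - ?x"
        using t ab(2) mult_strict_left_mono[of "2 * t - 1" 1 "a - ?x"] by auto
      then have "?x < (a - ?x) * (2 * t - 1) + ?x" "(a - ?x) * (2 * t - 1) + ?x < a" by linarith+
      then show ?thesis unfolding P_def
        using g_second[of t] cr[of "(a - ?x) * (2 * t - 1) + ?x" a] ab False by auto
    qed
  qed (use gF gE in auto)
  have img: "path_image g = petal_image i"
    using ab ends unfolding g_def petal_image by (subst path_image_join) (auto simp: path_image_subpath)
  have wq: "winding_number g w = winding_number (petal q \<tau> i) w" if "w \<notin> petal_image i" for w
  proof -
    have "winding_number (petal q \<tau> i) w = winding_number (subpath ?x ?y (cut_curl a b p)) w"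
      using petal_q_cong[OF i q_twisted[OF i ab(1)]] by (intro winding_number_cong) simp
    also have "\<dots> = winding_number g w"
      unfolding g_def by (rule winding_number_cut_curl_from_crossing[OF p_cont])
        (use ab ends that petal_image in auto)
    finally show ?thesis by simp
  qed
  \<comment> \<open>The sector of the corner has angle \<open>Arg2pi (- z) > pi\<close> and contains the direction of \<open>p' a\<close> at
    angle \<open>Arg2pi z < pi\<close>.\<close>
  define z where "z = p' a / p' b"
  have "Im z = - det2 (p' a) (p' b) / (cmod (p' b))\<^sup>2"
    by (simp add: z_def det2_def Im_divide cmod_power2 field_simps)
  then have Imz: "0 < Im z" using neg p_nz[of b] by (simp add: divide_neg_pos)
  have "Arg2pi (exp (l 1) / exp (l 0)) = Arg2pi (- z)"
  proof -
    have "exp (l 1) / exp (l 0) = - z * of_real (2 * (a - ?x)) / of_real (2 * (?y - b))" by (simp add: l F0 E1 z_def mult.commute)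
    then show ?thesis using scale by (simp only: Arg2pi_divide_of_real Arg2pi_times_of_real2)
  qed
  moreover have "pi < Arg2pi (- z)" using Arg2pi_le_pi[of "- z"] Imz by simp
  moreover have "Arg2pi (\<sigma> a (a + 0) / exp (l 0)) = Arg2pi z"
  proof -
    have "\<sigma> a (a + 0) / exp (l 0) = z / of_real (2 * (?y - b))" by (simp add: l F0 z_def \<sigma>)
    then show ?thesis using scale by (simp only: Arg2pi_divide_of_real)
  qed
  moreover have "0 < Arg2pi z" "Arg2pi z < pi" using Arg2pi_lt_pi[of z] Imz by auto
  ultimately have angles: "0 < Arg2pi (exp (l 1) / exp (l 0))" "0 < Arg2pi (\<sigma> a (a + 0) / exp (l 0))"
    "Arg2pi (\<sigma> a (a + 0) / exp (l 0)) < Arg2pi (exp (l 1) / exp (l 0))" using pi_gt_zero by linarith+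
  have "\<exists>r0>0. r0 \<le> 1 \<and> (\<forall>r. 0 < r \<and> r < r0 \<longrightarrow> p (a + r) \<notin> path_image g \<and> winding_number g (p (a + r)) = 1)"
  proof (rule interior_sector_of_corner(2)[OF l(1,2), where \<epsilon> = 1 and D = "\<lambda>r. \<sigma> a (a + r)"])
    show "winding_number g w = 0 \<or> winding_number g w = 1" if "w \<notin> path_image g" for w
      using wq[of w] petal_winding_cases(1)[OF i, of w] that by (simp add: img)
    show "continuous_on {0..1} (\<lambda>r. \<sigma> a (a + r))" by (intro \<sigma>c continuous_intros)
    show "p (a + r) = P + of_real r * \<sigma> a (a + r)" for r
      using \<sigma>(2)[of "a + r" a] by (simp add: P_def algebra_simps)
  qed (use angles p_nz in \<open>auto simp: \<sigma>\<close>)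
  then obtain r0 where r0: "0 < r0" "\<And>r. \<lbrakk>0 < r; r < r0\<rbrakk> \<Longrightarrow> p (a + r) \<notin> petal_image i \<and> winding_number g (p (a + r)) = 1"
    using img by auto
  define r where "r = min r0 (b - a) / 2"
  have r: "0 < r" "r < r0" "a + r < b" using r0(1) ab by (auto simp: r_def min_def field_simps)
  have start: "p (a + r) \<in> inside (petal_image i)"
    using r0(2)[OF r(1,2)] wq petal_winding_cases(2)[OF i] by metis
  let ?I = "p ` {a<..<b}"
  have disj: "?I \<inter> petal_image i = {}"
  proof -
    have no: False if "a < s" "s < b" "t \<in> {?x..a} \<union> {b..?y}" "p s = p t" for s t
      using cr[of s t] cr[of t s] that ab by auto
    show ?thesis
    proof (rule equals0I)
      fix z assume "z \<in> ?I \<inter> petal_image i"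
      then obtain s t where "s \<in> {a<..<b}" "z = p s" "t \<in> {?x..a} \<union> {b..?y}" "z = p t" unfolding petal_image by blast
      then show False using no[of s t] by simp
    qed
  qed
  have "connected ?I" by (intro connected_continuous_image p_cont) simp
  then have I_in: "?I \<subseteq> inside (petal_image i)"
    using connected_subset_inside[OF _ disj _ start] r by auto
  obtain c where c: "simple_path c" "pathfinish c = pathstart c" "path_image c = petal_image i"
    using petal_simple_loop[OF i] by blast
  let ?k = "subpath a b p"
  have k: "simple_path ?k" "pathfinish ?k = pathstart ?k" "path_image ?k = ?K"
  proof -
    have *: "s = a \<and> t = b" if "a \<le> s" "s < t" "t \<le> b" "p s = p t" for s t
    proof -
      have "?x \<le> s" "t \<le> ?y" "s \<noteq> ?x" using that ab(2-4) by linarith+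
      then show ?thesis using cr[of s t] that by simp
    qed
    have "s = t \<or> s = a \<and> t = b \<or> s = b \<and> t = a" if "s \<in> {a..b}" "t \<in> {a..b}" "p s = p t" for s t
      using *[of s t] *[of t s] that by (cases s t rule: linorder_cases) auto
    moreover have "path ?k" using ab(3) by (intro path_subpath_Icc p_cont) simp
    ultimately show "simple_path ?k"
      unfolding simple_path_subpath_eq using ab(3) by (simp add: closed_segment_eq_real_ivl)
  qed (use ab in \<open>auto simp: path_image_subpath\<close>)
  have K_split: "?K = ?I \<union> {P}"
  proof -
    have "{a..b} = {a<..<b} \<union> {a, b}" using ab(3) by auto
    then have "?K = ?I \<union> {p a, p b}" by (simp only: image_Un image_insert image_empty)
    then show ?thesis by (simp only: P_def ab(5)[symmetric] insert_absorb2)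
  qed
  have P_J: "P \<in> petal_image i" using ab by (auto simp: petal_image P_def)
  have touch: "petal_image i \<inter> ?K = {P}" using K_split disj P_J by auto
  have K_diff: "?K - {P} = ?I" using K_split disj P_J by auto
  have lim: "P \<in> closure (?K - {P})"
  proof -
    have "p ` closure {a<..<b} \<subseteq> closure ?I"
      by (rule image_closure_subset[OF p_cont]) (auto simp: closure_subset)
    then show ?thesis using ab(3) K_diff by (auto simp: P_def)
  qed
  \<comment> \<open>Two bounded regions of the diagram that contradict the assumption that it is standard.\<close>
  define U V where "U = inside ?K" and "V = inside (petal_image i) \<inter> outside ?K"
  note region = region_between_tangent_loops[OF c(1,2) k(1,2), of P, unfolded c(3) k(3), folded U_def V_def,
      OF touch _ lim]
  have V: "V \<in> components (- (petal_image i \<union> ?K))" "?K \<subseteq> frontier V" "U \<subseteq> inside (frontier V)"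
    using region I_in K_diff by auto
  note jK = Jordan_inside_outside[OF k(1,2), unfolded k(3), folded U_def]
  have range_sub: "- range p \<subseteq> - (petal_image i \<union> ?K)" "- range p \<subseteq> - ?K" unfolding petal_image by auto
  have U_comp: "U \<in> components (- ?K)"
    unfolding U_def inside_in_components using jK by (simp add: U_def)
  have "U \<subseteq> - range p"
  proof -
    have "p t \<notin> U" if "t \<in> {\<tau> 0..<\<tau> n}" for t
    proof (cases "t \<in> {a..b}")
      case True
      then have "p t \<in> ?K" by blast
      then show ?thesis using inside_no_overlap[of ?K] unfolding U_def by blast
    next
      case False
      then show ?thesis using curl_avoids_rest[OF ab(6), of t] that by (auto simp: U_def)
    qed
    then show ?thesis unfolding range_p by auto
  qed
  then have "U \<in> components (- range p)"
    by (rule components_intermediate_subset[OF U_comp _ range_sub(2)])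
  moreover have "bounded U" using jK by simp
  ultimately have U_reg: "U \<in> bounded_regions p" by (simp add: bounded_regions_def)
  have "V \<subseteq> - range p"
  proof -
    have "p t \<notin> V" if t: "t \<in> {\<tau> 0..<\<tau> n}" for t
    proof -
      obtain j where j: "j < n" "\<tau> j \<le> t" "t < \<tau> (Suc j)" using locate t by auto
      have in_JK: "p t \<notin> V" if "p t \<in> petal_image i \<union> ?K"
        using that inside_no_overlap[of "petal_image i"] outside_no_overlap[of ?K] unfolding V_def by blast
      consider "j = i" | "j \<noteq> i" "t = \<tau> j" | "j \<noteq> i" "\<tau> j < t" using j by linarith
      then show ?thesis
      proof cases
        case 1
        then have "t \<in> {?x..a} \<union> {b..?y} \<union> {a..b}" using j by auto
        then show ?thesis by (intro in_JK) (auto simp: petal_image)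
      next
        case 2
        then have "p t = v" using p_at_multicrossing[of j] j by simp
        then show ?thesis using v_in_petal_image[OF i] by (intro in_JK) simp
      next
        case 3
        then have "p t \<in> outside (petal_image i)" using other_petal_outside[OF i j(1)] j by (auto simp: image_subset_iff)
        then show ?thesis using inside_Int_outside[of "petal_image i"] by (auto simp: V_def simp del: inside_Int_outside)
      qed
    qed
    then show ?thesis unfolding range_p by auto
  qed
  then have "V \<in> components (- range p)"
    by (rule components_intermediate_subset[OF V(1) _ range_sub(1)])
  moreover have "bounded V"
    using Jordan_inside_outside[OF c(1,2)] unfolding c(3) V_def by (meson bounded_Int)
  ultimately have V_reg: "V \<in> bounded_regions p" by (simp add: bounded_regions_def)
  have "U \<noteq> V"
  proof
    assume "U = V"
    then have "U \<subseteq> outside ?K" by (simp add: V_def)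
    then have "U = {}" using inside_Int_outside[of ?K] unfolding U_def by blast
    then show False using jK by simp
  qed
  then show False
    using standard U_reg V_reg V(3) unfolding standard_lagrangian_petal_projection_def p_def by blast
qed

text \<open>The swept angle contributes twice \<open>petal_angle i\<close> and the exterior angle is \<open>pi - petal_angle i\<close>.\<close>

lemma petal_turning:
  assumes i: "i < n" and \<Lambda>: "continuous_on UNIV \<Lambda>" "\<And>t. exp (\<Lambda> t) = p' t"
  shows "Im (\<Lambda> (\<tau> (Suc i)) - \<Lambda> (\<tau> i)) = pi + petal_angle i - 2 * pi * card (petal_twists i)"
proof -
  let ?x = "\<tau> i" and ?y = "\<tau> (Suc i)"
  define d where "d = ?y - ?x"
  have d: "0 < d" using \<tau>_step[OF i] by (simp add: d_def)
  define c c' where "c = subpath ?x ?y p" and "c' = (\<lambda>t. of_real d * p' (d * t + ?x))"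
  have c: "c t = p (d * t + ?x)" for t by (simp add: c_def subpath_def d_def)
  have der: "(c has_vector_derivative c' t) (at t)" for t
  proof -
    have "((\<lambda>t. d * t + ?x) has_vector_derivative d) (at t)" by (auto intro!: derivative_eq_intros)
    from vector_diff_chain_at[OF this p_der] show ?thesis
      by (simp add: o_def c[abs_def] c'_def scaleR_conv_of_real)
  qed
  have cont: "continuous_on UNIV c'"
    unfolding c'_def by (intro continuous_intros continuous_on_compose2[OF p_vel]) auto
  have loop: "c 0 = c 1" using p_at_multicrossing[of i] p_at_multicrossing[of "Suc i"] i by (simp add: c d_def)
  have nz: "c' t \<noteq> 0" for t using d p_nz by (simp add: c'_def)
  have ends: "c' 0 / c' 1 = p' ?x / p' ?y" using d by (simp add: c'_def d_def)
  then have z: "c' 0 / c' 1 \<notin> \<real>\<^sub>\<le>\<^sub>0" using petal_ends_ratio[OF i] by simp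
  obtain l where l: "continuous_on {0..1} l" "\<And>t. t \<in> {0..1} \<Longrightarrow> c t = v + of_real (t * (1 - t)) * exp (l t)"
    "Im (l 1 - l 0) = petal_angle i"
    by (rule petal_corner[OF i, folded c_def]) (rule that; simp)
  have "c 0 = v" using l(2)[of 0] by simp
  then have l': "c t - c 0 = of_real (t * (1 - t)) * exp (l t)" if "0 < t" "t < 1" for t
    using l(2)[of t] that by simp
  define M where "M = (\<lambda>t. \<Lambda> (d * t + ?x) + of_real (ln d))"
  have M: "continuous_on {0..1} M" "\<And>t. \<lbrakk>0 < t; t < 1\<rbrakk> \<Longrightarrow> exp (M t) = c' t"
  proof -
    show "continuous_on {0..1} M" unfolding M_def by (intro continuous_intros continuous_on_compose2[OF \<Lambda>(1)]) auto
    show "exp (M t) = c' t" for t using d by (simp add: M_def c'_def exp_add \<Lambda> exp_of_real)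
  qed
  have change: "\<Lambda> ?y - \<Lambda> ?x = M 1 - M 0" by (simp add: M_def d_def)
  have ImLn: "Im (Ln (c' 0 / c' 1)) = pi - petal_angle i"
  proof -
    have "petal_angle i = Im (Ln (- (- p' ?y / p' ?x))) + pi"
      using Arg2pi_Ln[OF petal_angle_pos[OF i, unfolded petal_angle_def]] by (simp only: petal_angle_def)
    moreover have "- (- p' ?y / p' ?x) = inverse (c' 0 / c' 1)" by (simp add: ends)
    ultimately show ?thesis using Ln_inverse[OF z] by simp
  qed
  have param: "?x \<le> d * t + ?x" "d * t + ?x \<le> ?y" if "0 \<le> t" "t \<le> 1" for t
  proof -
    have "0 \<le> d * t" "d * t \<le> d * 1" using d that by (auto intro!: mult_left_mono simp del: mult_1_right)
    then show "?x \<le> d * t + ?x" "d * t + ?x \<le> ?y" using d_def by linarith+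
  qed
  have crossing: "s = 0 \<and> t = 1 \<or> (d * s + ?x, d * t + ?x) \<in> petal_twists i" if "0 \<le> s" "s < t" "t \<le> 1" "c s = c t" for s t
  proof -
    have "d * s + ?x = ?x \<and> d * t + ?x = ?y \<or> (d * s + ?x, d * t + ?x) \<in> petal_twists i"
      using that d param(1)[of s] param(2)[of t] by (intro petal_self_crossing[OF i]) (auto simp: c)
    moreover have "d * t + ?x = ?y \<longleftrightarrow> t = 1"
    proof -
      have "?y = d + ?x" by (simp add: d_def)
      then show ?thesis using d by simp
    qed
    ultimately show ?thesis using d by auto
  qed
  show ?thesis
  proof (rule petal_twists_cases[OF i])
    assume e: "petal_twists i = {}"
    have "M 1 - M 0 = 2 * (l 1 - l 0) + Ln (c' 0 / c' 1)"
      by (rule turning_of_simple_loop[OF der cont loop nz z _ M l(1) l'])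
         (use crossing e in auto)
    then have "Im (M 1 - M 0) = 2 * Im (l 1 - l 0) + Im (Ln (c' 0 / c' 1))" by simp
    then show ?thesis unfolding change l(3) ImLn by (simp add: e)
  next
    fix a b assume ab: "petal_twists i = {(a, b)}" "?x < a" "a < b" "b < ?y" "p a = p b" "(a, b) \<in> twists"
    define a' b' where "a' = (a - ?x) / d" and "b' = (b - ?x) / d"
    have a'b': "d * a' + ?x = a" "d * b' + ?x = b" "0 < a'" "a' < b'" "b' < 1"
      using d ab by (auto simp: a'_def b'_def divide_strict_right_mono d_def)
    have "c' a' = of_real d * p' a" "c' b' = of_real d * p' b" by (simp_all add: c'_def a'b')
    then have "det2 (c' a') (c' b') = d\<^sup>2 * det2 (p' a) (p' b)"
      by (simp add: det2_def power2_eq_square algebra_simps)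
    then have pos: "0 < det2 (c' a') (c' b')" using d curl_turns_left[OF i ab] by simp
    have "M 1 - M 0 = 2 * (l 1 - l 0) + Ln (c' 0 / c' 1) - 2 * of_real pi * \<i> * of_real (sgn (det2 (c' a') (c' b')))"
    proof (rule turning_of_loop_with_one_crossing[OF der cont loop nz z a'b'(3-5) _ _ _ M l(1) l'])
      show "c a' = c b'" using ab(5) by (simp add: c a'b')
      show "s = 0 \<and> t = 1 \<or> s = a' \<and> t = b'" if "0 \<le> s" "s < t" "t \<le> 1" "c s = c t" for s t
      proof -
        have "d * s + ?x = d * a' + ?x \<and> d * t + ?x = d * b' + ?x \<or> s = 0 \<and> t = 1"
          using crossing[OF that] ab(1) by (auto simp: a'b')
        then show ?thesis using d by auto
      qed
    qed (use pos in auto)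
    also have "of_real (sgn (det2 (c' a') (c' b'))) = (1::complex)" using pos by simp
    finally have "Im (M 1 - M 0) = 2 * Im (l 1 - l 0) + Im (Ln (c' 0 / c' 1)) - 2 * pi" by simp
    then show ?thesis unfolding change l(3) ImLn by (simp add: ab)
  qed
qed

lemma card_twists: "card twists = (\<Sum>i<n. card (petal_twists i))"
proof -
  have "twists = (\<Union>i<n. petal_twists i)"
  proof
    show "twists \<subseteq> (\<Union>i<n. petal_twists i)"
    proof
      fix h assume h: "h \<in> twists"
      obtain a b where ab: "h = (a, b)" by fastforce
      obtain i where "i < n" "\<tau> i < a" "b < \<tau> (Suc i)" using twist_in_petal h ab by metis
      then show "h \<in> (\<Union>i<n. petal_twists i)" using h ab by (auto simp: petal_twists_def)
    qed
  qed (auto simp: petal_twists_def)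
  moreover have "finite (petal_twists i)" for i by (rule finite_subset[OF _ finite_twists]) (auto simp: petal_twists_def)
  moreover have "petal_twists i \<inter> petal_twists j = {}" if "i < n" "j < n" "i \<noteq> j" for i j
  proof -
    have False if "(a, b) \<in> petal_twists i" "(a, b) \<in> petal_twists j" for a b
      using that petal_unique[of i a j] \<open>i < n\<close> \<open>j < n\<close> \<open>i \<noteq> j\<close> by (auto simp: petal_twists_def twists_def extra_crossings_def)
    then show ?thesis by auto
  qed
  ultimately show ?thesis by (simp add: card_UN_disjoint)
qed

text \<open>The integrality of the rotation number and the parity of \<open>n\<close> replace the direct determination of
  the sum of the interior angles.\<close>

lemma rotation_number_eq: "rotation_number \<gamma> = (of_nat n + 1) / 2 - of_nat (card twists)"
proof -
  obtain \<Lambda> where \<Lambda>: "continuous_on UNIV \<Lambda>" "\<And>t. exp (\<Lambda> t) = p' t"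
    using log_on_convex[OF convex_UNIV p_vel] p_nz by (metis UNIV_I)
  have R: "rotation_number \<gamma> = winding_number p' 0" by (simp add: rotation_number_def p_def)
  have "2 * of_real pi * \<i> * winding_number p' 0 = \<Lambda> 1 - \<Lambda> 0"
    by (rule winding_number_log_change) (use \<Lambda> in \<open>auto intro: continuous_on_subset\<close>)
  also have "\<dots> = \<Lambda> (\<tau> n) - \<Lambda> (\<tau> 0)"
  proof -
    have "\<Lambda> (\<tau> 0 + 1) - \<Lambda> (0 + 1) = \<Lambda> (\<tau> 0) - \<Lambda> 0"
      by (rule log_change_unique[of UNIV "\<lambda>t. \<Lambda> (t + 1)"])
         (auto simp: \<Lambda> p_vel_per intro!: continuous_on_compose2[OF \<Lambda>(1)] continuous_intros)
    then show ?thesis by (simp add: \<tau>_n algebra_simps)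
  qed
  also have "\<dots> = (\<Sum>i<n. \<Lambda> (\<tau> (Suc i)) - \<Lambda> (\<tau> i))" by (rule sum_lessThan_telescope[of "\<lambda>i. \<Lambda> (\<tau> i)", symmetric])
  finally have "Im (2 * of_real pi * \<i> * winding_number p' 0) = (\<Sum>i<n. Im (\<Lambda> (\<tau> (Suc i)) - \<Lambda> (\<tau> i)))" by simp
  also have "\<dots> = (\<Sum>i<n. pi + petal_angle i - 2 * pi * card (petal_twists i))" using petal_turning[OF _ \<Lambda>] by (intro sum.cong) auto
  also have "\<dots> = n * pi + (\<Sum>i<n. petal_angle i) - 2 * pi * card twists"
    by (simp add: sum.distrib sum_subtractf card_twists sum_distrib_left)
  finally have total: "2 * pi * Re (winding_number p' 0) = n * pi + (\<Sum>i<n. petal_angle i) - 2 * pi * card twists" by simp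
  have "path p'" unfolding path_def by (rule continuous_on_subset[OF p_vel]) simp
  moreover have "0 \<notin> path_image p'" using p_nz by (auto simp: path_image_def)
  moreover have "pathfinish p' = pathstart p'" using p_vel_per[of 0] by (simp add: pathfinish_def pathstart_def)
  ultimately have "winding_number p' 0 \<in> \<int>" by (intro integer_winding_number) auto
  then obtain m where m: "winding_number p' 0 = of_int m" by (auto elim: Ints_cases)
  obtain h where h: "n = 2 * h + 1" using odd_n by (auto elim: oddE)
  \<comment> \<open>The sum of the interior angles is \<open>j * pi\<close> with \<open>j\<close> odd.\<close>
  define j where "j = 2 * m + 2 * int (card twists) - int n"
  have S: "(\<Sum>i<n. petal_angle i) = pi * of_int j" using total by (simp add: m j_def algebra_simps)
  have "0 < pi * of_int j" "pi * of_int j \<le> pi * 2" using sum_petal_angle unfolding S by simp_all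
  then have "0 < j" "j \<le> 2" by (simp_all add: zero_less_mult_iff)
  moreover have "odd j" using odd_n by (simp add: j_def)
  ultimately have "j = 1" by presburger
  then have "m = int h + 1 - int (card twists)" by (simp add: j_def h)
  then show ?thesis by (simp add: R m h)
qed

end

theorem theorem4p5:
  fixes \<gamma> :: "real \<Rightarrow> real ^ 3" and \<tau> :: "nat \<Rightarrow> real" and n k :: nat
  assumes "legendrian_knot \<gamma>"
    and "standard_lagrangian_petal_projection \<gamma> \<tau> n"
    and "num_half_twists \<gamma> \<tau> n = k"
    and "petals_counterclockwise \<gamma> \<tau> n"
  shows "rotation_number \<gamma> = (of_nat n + 1) / 2 - of_nat k"
proof -
  interpret standard_petal_diagram \<gamma> \<tau> n by unfold_locales (use assms in auto)
  show ?thesis using rotation_number_eq assms(3) by (simp add: num_half_twists_def twists_def p_def)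
qed

end
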